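(* Let $X$ be a Banach space and let $T\in B(X)$ be an $\mathcal R$-Ritt$_E$ operator of $\mathcal R$-type $r\in(0,1)$. Assume that there is a constant $C>0$ such that $$\|x\|_{T,1}\le C\|x\|\quad(x\in X)\qquad\text{and}\qquad\|y\|_{T^*,1}\le C\|y\|\quad(y\in X^* ).$$ Then for all $s\in(r,1)$, $T$ admits a bounded $H^\infty(E_s)$ functional calculus.
   Context: $X$ is a complex Banach space, $X^*$ its dual, $T^*\in B(X^* )$ the Banach space adjoint (transpose) of $T$, $R(z,T)=(z-T)^{-1}$, $\mathbb D$ the open unit disc, $\mathbb T$ the unit circle, $D(0,2)$ the open disc of radius 2. $E=\{\xi_1,\dots,\xi_N\}\subset\mathbb T$ is a fixed finite set of $N\ge1$ distinct points. $(\varepsilon_k)_{k\ge1}$ are independent Rademacher variables on a probability space $(\Omega,\mathbb P)$ and $\|\sum_k\varepsilon_k\otimes x_k\|_{\mathrm{Rad}(X)}=\big(\int_\Omega\|\sum_k\varepsilon_k(u)x_k\|_X^2\,d\mathbb P(u)\big)^{1/2}$. A set $F\subset B(X)$ is $\mathcal R$-bounded if there is $C>0$ with $\|\sum_{k}\varepsilon_k\otimes T_kx_k\|_{\mathrm{Rad}(X)}\le C\|\sum_{k}\varepsilon_k\otimes x_k\|_{\mathrm{Rad}(X)}$ for all finite sequences $(T_k)$ in $F$, $(x_k)$ in $X$. $T\in B(X)$ is a Ritt$_E$ (resp. $\mathcal R$-Ritt$_E$) operator if $\sigma(T)\subset\overline{\mathbb D}$, $\sigma(T)\cap\mathbb T\subset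 E$ and for every $C>1$ the set $\{\prod_{j=1}^N(1-\overline{\xi_j}z)R(z,T):1<|z|<C\}$ is bounded (resp. $\mathcal R$-bounded). If $T$ is Ritt$_E$ then so is $T^*$. For $r\in(0,1)$, $E_r$ is the interior of the convex hull of $E\cup r\mathbb D$; $r$ is $E$-large enough if every segment $[\xi_i,\xi_j]$, $i\neq j$, meets $r\mathbb D$. $T$ is of type $r$ (resp. $\mathcal R$-type $r$) if $r$ is $E$-large enough, $\sigma(T)\subset\overline{E_r}$, and for every $s\in(r,1)$ the set $\{R(z,T)\prod_{j=1}^N(\xi_j-z): z\in D(0,2)\setminus\overline{E_s}\}$ is bounded (resp. $\mathcal R$-bounded). $H_0^\infty(E_s)$ is the space of bounded holomorphic $\phi:E_s\to\mathbb C$ such that $|\phi(z)|\le C_1\prod_{j=1}^N|\xi_j-z|^{s_j}$ on $E_s$ for some $C_1,s_1,\dots,s_N>0$; $\|\cdot\|_{\infty,E_s}$ is the sup norm on $E_s$. If $T$ is of type $r<s$ and $\phi\in H_0^\infty(E_s)$, then $\phi(T)=\frac1{2\pi i}\int_{\partial E_u}\phi(z)R(z,T)\,dz$ for any $u\in(r,s)$. $T$ (of type $r<s$) admits a bounded $H^\infty(E_s)$ functional calculus if there is $K\ge1$ with $\|\phi(T)\|\le K\|\phi\|_{\infty,E_s}$ for all $\phi\in H_0^\infty(E_s)$. For a Ritt$_E$ operator $S$ on a Banach space $Y$ and $y\in Y$, $$\|y\|_{S,1}=\lim_{n\to\infty}\Big\|\sum_{k=1}^nk^{1/2}\varepsilon_k\otimes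 S^{k-1}\prod_{j=1}^N(I-\overline{\xi_j}S)y\Big\|_{\mathrm{Rad}(Y)}\in[0,\infty]$$ (nondecreasing limit). *)

theory Defs
  imports "HOL-Probability.Probability"
begin

section \<open>Complex Banach spaces\<close>

class complex_normed_vector = real_normed_vector +
  fixes scaleC :: "complex \<Rightarrow> 'a \<Rightarrow> 'a"  (infixr \<open>*\<^sub>C\<close> 75)
  assumes scaleC_add_right: "a *\<^sub>C (x + y) = a *\<^sub>C x + a *\<^sub>C y"
    and scaleC_add_left: "(a + b) *\<^sub>C x = a *\<^sub>C x + b *\<^sub>C x"
    and scaleC_scaleC: "a *\<^sub>C b *\<^sub>C x = (a * b) *\<^sub>C x"
    and scaleC_one: "1 *\<^sub>C x = x"
    and scaleR_scaleC: "r *\<^sub>R x = complex_of_real r *\<^sub>C x"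
    and norm_scaleC: "norm (a *\<^sub>C x) = cmod a * norm x"

class complex_banach = complex_normed_vector + banach

instantiation complex :: complex_banach
begin

definition scaleC_complex :: "complex \<Rightarrow> complex \<Rightarrow> complex"
  where "scaleC_complex a x = a * x"

instance
  by standard (simp_all add: scaleC_complex_def algebra_simps norm_mult scaleR_conv_of_real)

end

lemma bounded_linear_scaleC: "bounded_linear (\<lambda>x::'a::complex_normed_vector. c *\<^sub>C x)"
proof (rule bounded_linear_intro[where K="cmod c"])
  fix x y :: 'a and r :: real
  show "c *\<^sub>C (x + y) = c *\<^sub>C x + c *\<^sub>C y" by (rule scaleC_add_right)
  show "c *\<^sub>C r *\<^sub>R x = r *\<^sub>R c *\<^sub>C x"
    by (simp add: scaleR_scaleC scaleC_scaleC mult.commute)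
  show "norm (c *\<^sub>C x) \<le> norm x * cmod c" by (simp add: norm_scaleC mult.commute)
qed

lemma scaleC_scaleR_commute: "c *\<^sub>C r *\<^sub>R x = r *\<^sub>R c *\<^sub>C (x::'a::complex_normed_vector)"
  by (simp add: scaleR_scaleC scaleC_scaleC mult.commute)

lemma scaleC_diff_right: "c *\<^sub>C (x - y) = c *\<^sub>C x - c *\<^sub>C (y::'a::complex_normed_vector)"
  by (rule linear_diff[OF bounded_linear.linear[OF bounded_linear_scaleC]])

lemma scaleC_minus_right: "c *\<^sub>C (- x) = - (c *\<^sub>C (x::'a::complex_normed_vector))"
  by (rule linear_neg[OF bounded_linear.linear[OF bounded_linear_scaleC]])

lemma scaleC_zero_right: "c *\<^sub>C (0::'a::complex_normed_vector) = 0"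
  by (rule linear_0[OF bounded_linear.linear[OF bounded_linear_scaleC]])


section \<open>Bounded complex-linear operators\<close>

typedef (overloaded) ('a, 'b) cblinfun =
  "{f :: 'a::complex_normed_vector \<Rightarrow>\<^sub>L 'b::complex_normed_vector.
      \<forall>c x. blinfun_apply f (c *\<^sub>C x) = c *\<^sub>C blinfun_apply f x}"
  morphisms blinfun_of_cblinfun cblinfun_of_blinfun
  by (rule exI[where x=0]) (simp add: scaleC_zero_right)

setup_lifting type_definition_cblinfun

lift_definition cblinfun_apply ::
  "('a::complex_normed_vector, 'b::complex_normed_vector) cblinfun \<Rightarrow> 'a \<Rightarrow> 'b"
  is blinfun_apply .

lemma cblinfun_eqI: "(\<And>x. cblinfun_apply f x = cblinfun_apply g x) \<Longrightarrow> f = g"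
  by transfer (rule blinfun_eqI)

lemma cblinfun_apply_scaleC: "cblinfun_apply f (c *\<^sub>C x) = c *\<^sub>C cblinfun_apply f x"
  by transfer simp

lemma bounded_linear_cblinfun_apply: "bounded_linear (cblinfun_apply f)"
  by transfer (rule blinfun.bounded_linear_right)

lemma ex_cblinfun_apply:
  assumes "bounded_linear f" and "\<And>c x. f (c *\<^sub>C x) = c *\<^sub>C f x"
  shows "\<exists>g. cblinfun_apply g = f"
  using assms
  by (intro exI[where x="cblinfun_of_blinfun (Blinfun f)"])
     (simp add: cblinfun_apply.rep_eq cblinfun_of_blinfun_inverse bounded_linear_Blinfun_apply)

instantiation cblinfun :: (complex_normed_vector, complex_normed_vector) complex_normed_vector
begin

lift_definition zero_cblinfun :: "('a, 'b) cblinfun" is 0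
  by (simp add: scaleC_zero_right)

lift_definition plus_cblinfun :: "('a, 'b) cblinfun \<Rightarrow> ('a, 'b) cblinfun \<Rightarrow> ('a, 'b) cblinfun"
  is "(+)" by (simp add: blinfun.add_left scaleC_add_right)

lift_definition minus_cblinfun :: "('a, 'b) cblinfun \<Rightarrow> ('a, 'b) cblinfun \<Rightarrow> ('a, 'b) cblinfun"
  is "(-)" by (simp add: blinfun.diff_left scaleC_diff_right)

lift_definition uminus_cblinfun :: "('a, 'b) cblinfun \<Rightarrow> ('a, 'b) cblinfun"
  is "uminus" by (simp add: blinfun.minus_left scaleC_minus_right)

lift_definition scaleR_cblinfun :: "real \<Rightarrow> ('a, 'b) cblinfun \<Rightarrow> ('a, 'b) cblinfun"
  is "(*\<^sub>R)" by (simp add: blinfun.scaleR_left scaleC_scaleR_commute)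

lift_definition scaleC_cblinfun :: "complex \<Rightarrow> ('a, 'b) cblinfun \<Rightarrow> ('a, 'b) cblinfun"
  is "\<lambda>c f. Blinfun (\<lambda>x. c *\<^sub>C x) o\<^sub>L f"
  by (simp add: bounded_linear_Blinfun_apply[OF bounded_linear_scaleC] scaleC_scaleC mult.commute)

lift_definition norm_cblinfun :: "('a, 'b) cblinfun \<Rightarrow> real" is norm .

definition dist_cblinfun :: "('a, 'b) cblinfun \<Rightarrow> ('a, 'b) cblinfun \<Rightarrow> real"
  where "dist_cblinfun f g = norm (f - g)"

definition sgn_cblinfun :: "('a, 'b) cblinfun \<Rightarrow> ('a, 'b) cblinfun"
  where "sgn_cblinfun f = inverse (norm f) *\<^sub>R f"

definition uniformity_cblinfun :: "(('a, 'b) cblinfun \<times> ('a, 'b) cblinfun) filter"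
  where "uniformity_cblinfun = (INF e\<in>{0 <..}. principal {(x, y). dist x y < e})"

definition open_cblinfun :: "('a, 'b) cblinfun set \<Rightarrow> bool"
  where "open_cblinfun S = (\<forall>x\<in>S. \<forall>\<^sub>F (x', y) in uniformity. x' = x \<longrightarrow> y \<in> S)"

lemma blinfun_apply_scaleC_aux:
  "blinfun_apply (Blinfun (\<lambda>x::'c::complex_normed_vector. c *\<^sub>C x)) y = c *\<^sub>C y"
  by (simp add: bounded_linear_Blinfun_apply[OF bounded_linear_scaleC])

lemma norm_scaleC_blinfun_le:
  fixes f :: "'c::real_normed_vector \<Rightarrow>\<^sub>L 'd::complex_normed_vector"
  shows "norm (Blinfun (\<lambda>x. c *\<^sub>C x) o\<^sub>L f) \<le> cmod c * norm f"
proof (rule norm_blinfun_bound)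
  fix x
  have "norm (blinfun_apply (Blinfun (\<lambda>x. c *\<^sub>C x) o\<^sub>L f) x) = cmod c * norm (blinfun_apply f x)"
    by (simp add: blinfun_apply_scaleC_aux norm_scaleC)
  also have "\<dots> \<le> cmod c * (norm f * norm x)"
    by (intro mult_left_mono norm_blinfun) simp
  finally show "norm (blinfun_apply (Blinfun (\<lambda>x. c *\<^sub>C x) o\<^sub>L f) x) \<le> cmod c * norm f * norm x"
    by (simp add: mult.assoc)
qed simp

lemma norm_scaleC_blinfun:
  fixes f :: "'c::real_normed_vector \<Rightarrow>\<^sub>L 'd::complex_normed_vector"
  shows "norm (Blinfun (\<lambda>x. c *\<^sub>C x) o\<^sub>L f) = cmod c * norm f"
proof (cases "c = 0")
  case True
  then show ?thesis using norm_scaleC_blinfun_le[of c f] by simp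
next
  case False
  let ?g = "Blinfun (\<lambda>x. c *\<^sub>C x) o\<^sub>L f"
  have "Blinfun (\<lambda>x. inverse c *\<^sub>C x) o\<^sub>L ?g = f"
    by (rule blinfun_eqI)
       (use False in \<open>simp add: blinfun_apply_scaleC_aux scaleC_scaleC scaleC_one\<close>)
  then have "norm f \<le> cmod (inverse c) * norm ?g"
    using norm_scaleC_blinfun_le[of "inverse c" ?g] by simp
  then have "cmod c * norm f \<le> norm ?g"
    using False by (simp add: norm_inverse norm_divide field_simps)
  with norm_scaleC_blinfun_le[of c f] show ?thesis by linarith
qed

instance
proof
  fix x y z :: "('a, 'b) cblinfun" and r s :: real and a b :: complex and S :: "('a, 'b) cblinfun set"
  show "x + y + z = x + (y + z)" "x + y = y + x" "0 + x = x" "- x + x = 0" "x - y = x + - y"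
    "r *\<^sub>R (x + y) = r *\<^sub>R x + r *\<^sub>R y" "(r + s) *\<^sub>R x = r *\<^sub>R x + s *\<^sub>R x"
    "r *\<^sub>R s *\<^sub>R x = (r * s) *\<^sub>R x" "1 *\<^sub>R x = x"
    by (transfer; simp add: algebra_simps)+
  show "dist x y = norm (x - y)" by (rule dist_cblinfun_def)
  show "sgn x = inverse (norm x) *\<^sub>R x" by (rule sgn_cblinfun_def)
  show "(uniformity :: (('a, 'b) cblinfun \<times> ('a, 'b) cblinfun) filter)
      = (INF e\<in>{0 <..}. principal {(x, y). dist x y < e})"
    by (rule uniformity_cblinfun_def)
  show "open S = (\<forall>x\<in>S. \<forall>\<^sub>F (x', y) in uniformity. x' = x \<longrightarrow> y \<in> S)"
    by (rule open_cblinfun_def)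
  show "(norm x = 0) = (x = 0)" "norm (x + y) \<le> norm x + norm y"
    "norm (r *\<^sub>R x) = \<bar>r\<bar> * norm x"
    by (transfer; simp add: norm_triangle_ineq)+
  show "a *\<^sub>C (x + y) = a *\<^sub>C x + a *\<^sub>C y" "(a + b) *\<^sub>C x = a *\<^sub>C x + b *\<^sub>C x"
    "a *\<^sub>C b *\<^sub>C x = (a * b) *\<^sub>C x" "1 *\<^sub>C x = x" "r *\<^sub>R x = complex_of_real r *\<^sub>C x"
    by (transfer; rule blinfun_eqI;
        simp add: blinfun_apply_scaleC_aux blinfun.bilinear_simps scaleC_add_right scaleC_add_left
          scaleC_scaleC scaleC_one scaleR_scaleC)+
  show "norm (a *\<^sub>C x) = cmod a * norm x"
    by transfer (rule norm_scaleC_blinfun)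
qed

end

instance cblinfun :: (complex_normed_vector, complex_banach) complex_banach
proof
  fix X :: "nat \<Rightarrow> ('a, 'b) cblinfun"
  assume C: "Cauchy X"
  let ?Y = "\<lambda>n. blinfun_of_cblinfun (X n)"
  have dist_eq: "dist (blinfun_of_cblinfun f) (blinfun_of_cblinfun g) = dist f g"
    for f g :: "('a, 'b) cblinfun"
    by (simp add: dist_norm norm_cblinfun.rep_eq minus_cblinfun.rep_eq)
  have "Cauchy ?Y"
    using C by (simp add: Cauchy_def dist_eq)
  then obtain L where L: "?Y \<longlonglongrightarrow> L"
    by (auto simp: Cauchy_convergent_iff convergent_def)
  have lim: "(\<lambda>n. blinfun_apply (?Y n) x) \<longlonglongrightarrow> blinfun_apply L x" for x
    by (rule blinfun.tendsto[OF L tendsto_const])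
  have "blinfun_apply L (c *\<^sub>C x) = c *\<^sub>C blinfun_apply L x" for c x
  proof (rule LIMSEQ_unique[OF lim])
    show "(\<lambda>n. blinfun_apply (?Y n) (c *\<^sub>C x)) \<longlonglongrightarrow> c *\<^sub>C blinfun_apply L x"
    proof -
      have "blinfun_apply (?Y n) (c *\<^sub>C x) = c *\<^sub>C blinfun_apply (?Y n) x" for n
        using blinfun_of_cblinfun[of "X n"] by simp
      then show ?thesis
        using bounded_linear.tendsto[OF bounded_linear_scaleC lim, of c x] by simp
    qed
  qed
  then have "blinfun_of_cblinfun (cblinfun_of_blinfun L) = L"
    by (intro cblinfun_of_blinfun_inverse) simp
  then have "dist (X n) (cblinfun_of_blinfun L) = dist (?Y n) L" for n
    by (metis dist_eq)
  then have "X \<longlonglongrightarrow> cblinfun_of_blinfun L"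
    using L by (simp add: tendsto_iff)
  then show "convergent X" by (auto simp: convergent_def)
qed

type_synonym 'a cdual = "('a, complex) cblinfun"

lift_definition cblinfun_compose ::
  "('b::complex_normed_vector, 'c::complex_normed_vector) cblinfun \<Rightarrow>
   ('a::complex_normed_vector, 'b) cblinfun \<Rightarrow> ('a, 'c) cblinfun"  (infixl \<open>o\<^sub>C\<close> 67)
  is "\<lambda>f g. f o\<^sub>L g" by simp

lift_definition cblinfun_id :: "('a::complex_normed_vector, 'a) cblinfun"
  is id_blinfun by simp

lemma cblinfun_apply_compose: "cblinfun_apply (f o\<^sub>C g) x = cblinfun_apply f (cblinfun_apply g x)"
  by transfer simp

definition cadjoint ::
  "('a::complex_normed_vector, 'b::complex_normed_vector) cblinfun \<Rightarrow> ('b cdual, 'a cdual) cblinfun"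
  where "cadjoint T = (THE S. \<forall>f. cblinfun_apply S f = f o\<^sub>C T)"

lemma cadjoint_apply:
  fixes T :: "('a::complex_normed_vector, 'b::complex_normed_vector) cblinfun"
  shows "cblinfun_apply (cadjoint T) f = f o\<^sub>C T"
proof -
  have "bounded_linear (\<lambda>f :: 'b cdual. f o\<^sub>C T)"
  proof (rule bounded_linear_intro[where K="norm T"])
    show "norm (f o\<^sub>C T) \<le> norm f * norm T" for f :: "'b cdual"
      unfolding norm_cblinfun.rep_eq cblinfun_compose.rep_eq by (rule norm_blinfun_compose)
    show "(f + g) o\<^sub>C T = f o\<^sub>C T + g o\<^sub>C T" for f g :: "'b cdual"
      by transfer (rule blinfun_eqI, simp add: blinfun.bilinear_simps)
    show "(r *\<^sub>R f) o\<^sub>C T = r *\<^sub>R (f o\<^sub>C T)" for r and f :: "'b cdual"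
      by transfer (rule blinfun_eqI, simp add: blinfun.bilinear_simps)
  qed
  moreover have "(c *\<^sub>C f) o\<^sub>C T = c *\<^sub>C (f o\<^sub>C T)" for c and f :: "'b cdual"
    by transfer (rule blinfun_eqI, simp)
  ultimately obtain S where S: "\<And>f :: 'b cdual. cblinfun_apply S f = f o\<^sub>C T"
    using ex_cblinfun_apply[of "\<lambda>f :: 'b cdual. f o\<^sub>C T"] by metis
  have "cadjoint T = S"
    unfolding cadjoint_def by (rule the_equality) (use S in \<open>auto intro: cblinfun_eqI\<close>)
  with S show ?thesis by simp
qed

definition cblinfun_inverse_of ::
  "('a::complex_normed_vector, 'a) cblinfun \<Rightarrow> ('a, 'a) cblinfun \<Rightarrow> bool"
  where "cblinfun_inverse_of A B \<longleftrightarrow> A o\<^sub>C B = cblinfun_id \<and> B o\<^sub>C A = cblinfun_id"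

definition spectrum :: "('a::complex_normed_vector, 'a) cblinfun \<Rightarrow> complex set"
  where "spectrum T = {z. \<not> (\<exists>B. cblinfun_inverse_of (z *\<^sub>C cblinfun_id - T) B)}"

definition resolvent :: "complex \<Rightarrow> ('a::complex_normed_vector, 'a) cblinfun \<Rightarrow> ('a, 'a) cblinfun"
  where "resolvent z T = (THE B. cblinfun_inverse_of (z *\<^sub>C cblinfun_id - T) B)"


section \<open>Rademacher averages and R-boundedness\<close>

definition rademacher_seq :: "'w measure \<Rightarrow> (nat \<Rightarrow> 'w \<Rightarrow> real) \<Rightarrow> bool"
  where "rademacher_seq M \<epsilon> \<longleftrightarrow>
    prob_space M \<and> prob_space.indep_vars M (\<lambda>_. borel) \<epsilon> {1..} \<and>
    (\<forall>k\<ge>1. measure M {u \<in> space M. \<epsilon> k u = 1} = 1/2 \<and>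
           measure M {u \<in> space M. \<epsilon> k u = -1} = 1/2)"

definition rad_norm ::
  "'w measure \<Rightarrow> (nat \<Rightarrow> 'w \<Rightarrow> real) \<Rightarrow> nat \<Rightarrow> (nat \<Rightarrow> 'x::real_normed_vector) \<Rightarrow> real"
  where "rad_norm M \<epsilon> n x = sqrt (LINT u|M. (norm (\<Sum>k=1..n. \<epsilon> k u *\<^sub>R x k))\<^sup>2)"

definition R_bounded ::
  "'w measure \<Rightarrow> (nat \<Rightarrow> 'w \<Rightarrow> real) \<Rightarrow> ('a::complex_normed_vector, 'a) cblinfun set \<Rightarrow> bool"
  where "R_bounded M \<epsilon> F \<longleftrightarrow>
    (\<exists>C>0. \<forall>n A x. (\<forall>k\<in>{1..n}. A k \<in> F) \<longrightarrow>
       rad_norm M \<epsilon> n (\<lambda>k. cblinfun_apply (A k) (x k)) \<le> C * rad_norm M \<epsilon> n x)"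


section \<open>Operators of Ritt type\<close>

text \<open>The finite set \<open>E\<close> is given by a duplicate-free list \<open>\<xi>s\<close> enumerating it, which makes
  products of operators over \<open>E\<close> directly expressible.\<close>

definition R_Ritt ::
  "'w measure \<Rightarrow> (nat \<Rightarrow> 'w \<Rightarrow> real) \<Rightarrow> complex list \<Rightarrow> ('a::complex_normed_vector, 'a) cblinfun \<Rightarrow> bool"
  where "R_Ritt M \<epsilon> \<xi>s T \<longleftrightarrow>
    spectrum T \<subseteq> cball 0 1 \<and> spectrum T \<inter> sphere 0 1 \<subseteq> set \<xi>s \<and>
    (\<forall>C>1. R_bounded M \<epsilon>
       {(\<Prod>\<xi>\<in>set \<xi>s. 1 - cnj \<xi> * z) *\<^sub>C resolvent z T | z. 1 < cmod z \<and> cmod z < C})"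

definition E_dom :: "complex list \<Rightarrow> real \<Rightarrow> complex set"
  where "E_dom \<xi>s r = interior (convex hull (set \<xi>s \<union> ball 0 r))"

definition E_large_enough :: "complex list \<Rightarrow> real \<Rightarrow> bool"
  where "E_large_enough \<xi>s r \<longleftrightarrow>
    (\<forall>\<xi>\<in>set \<xi>s. \<forall>\<eta>\<in>set \<xi>s. \<xi> \<noteq> \<eta> \<longrightarrow> closed_segment \<xi> \<eta> \<inter> ball 0 r \<noteq> {})"

definition R_type ::
  "'w measure \<Rightarrow> (nat \<Rightarrow> 'w \<Rightarrow> real) \<Rightarrow> complex list \<Rightarrow> real \<Rightarrow>
   ('a::complex_normed_vector, 'a) cblinfun \<Rightarrow> bool"
  where "R_type M \<epsilon> \<xi>s r T \<longleftrightarrow>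
    E_large_enough \<xi>s r \<and> spectrum T \<subseteq> closure (E_dom \<xi>s r) \<and>
    (\<forall>s\<in>{r<..<1}. R_bounded M \<epsilon>
       {(\<Prod>\<xi>\<in>set \<xi>s. \<xi> - z) *\<^sub>C resolvent z T | z. z \<in> ball 0 2 - closure (E_dom \<xi>s s)})"


section \<open>Functional calculus\<close>

definition H0_inf :: "complex list \<Rightarrow> real \<Rightarrow> (complex \<Rightarrow> complex) set"
  where "H0_inf \<xi>s s = {\<phi>. \<phi> holomorphic_on E_dom \<xi>s s \<and> bounded (\<phi> ` E_dom \<xi>s s) \<and>
    (\<exists>C>0. \<exists>a. (\<forall>\<xi>\<in>set \<xi>s. 0 < a \<xi>) \<and>
       (\<forall>z\<in>E_dom \<xi>s s. cmod (\<phi> z) \<le> C * (\<Prod>\<xi>\<in>set \<xi>s. cmod (\<xi> - z) powr a \<xi>)))}"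

definition sup_norm :: "complex list \<Rightarrow> real \<Rightarrow> (complex \<Rightarrow> complex) \<Rightarrow> real"
  where "sup_norm \<xi>s s \<phi> = (SUP z\<in>E_dom \<xi>s s. cmod (\<phi> z))"

text \<open>\<open>E_dom \<xi>s u\<close> is a bounded convex neighbourhood of \<open>0\<close>, so each ray from \<open>0\<close> meets its
  boundary in exactly one point. Polar coordinates therefore give the counterclockwise
  parametrisation of the boundary by \<open>[0, 2\<pi>]\<close>. It is piecewise smooth, with corners only at
  points of \<open>E\<close>.\<close>

definition E_bdry :: "complex list \<Rightarrow> real \<Rightarrow> real \<Rightarrow> complex"
  where "E_bdry \<xi>s u \<theta> = complex_of_real (Sup {\<rho>. 0 \<le> \<rho> \<and> complex_of_real \<rho> * cis \<theta> \<in> E_dom \<xi>s u}) * cis \<theta>"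

text \<open>The boundary passes through the points of \<open>E\<close>, where \<open>\<phi>\<close> and the resolvent need not be
  defined and the integrand may be unbounded. These are finitely many parameter values, and the
  gauge integral includes the (absolutely convergent) improper integral.\<close>

definition H_calc ::
  "complex list \<Rightarrow> real \<Rightarrow> (complex \<Rightarrow> complex) \<Rightarrow> ('a::complex_banach, 'a) cblinfun \<Rightarrow> ('a, 'a) cblinfun"
  where "H_calc \<xi>s u \<phi> T = (1 / (2 * of_real pi * \<i>)) *\<^sub>C
    integral {0..2*pi} (\<lambda>\<theta>. (\<phi> (E_bdry \<xi>s u \<theta>) * vector_derivative (E_bdry \<xi>s u) (at \<theta>))
                              *\<^sub>C resolvent (E_bdry \<xi>s u \<theta>) T)"

text \<open>For \<open>T\<close> of type \<open>r < s\<close> the operator \<open>H_calc \<xi>s u \<phi> T\<close> is \<open>\<phi>(T)\<close> for any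
  \<open>u\<close> strictly between \<open>r\<close> and \<open>s\<close>; by Cauchy's theorem it does not depend on \<open>u\<close>.\<close>

definition bounded_Hinf_calculus ::
  "complex list \<Rightarrow> real \<Rightarrow> real \<Rightarrow> ('a::complex_banach, 'a) cblinfun \<Rightarrow> bool"
  where "bounded_Hinf_calculus \<xi>s r s T \<longleftrightarrow>
    (\<exists>K\<ge>1. \<forall>\<phi>\<in>H0_inf \<xi>s s. \<forall>u\<in>{r<..<s}. norm (H_calc \<xi>s u \<phi> T) \<le> K * sup_norm \<xi>s s \<phi>)"


section \<open>Square functions\<close>

definition E_prod :: "complex list \<Rightarrow> ('a::complex_normed_vector, 'a) cblinfun \<Rightarrow> ('a, 'a) cblinfun"
  where "E_prod \<xi>s S = foldr (\<lambda>\<xi> A. (cblinfun_id - cnj \<xi> *\<^sub>C S) o\<^sub>C A) \<xi>s cblinfun_id"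

definition square_fun ::
  "'w measure \<Rightarrow> (nat \<Rightarrow> 'w \<Rightarrow> real) \<Rightarrow> complex list \<Rightarrow> ('a::complex_normed_vector, 'a) cblinfun \<Rightarrow>
   'a \<Rightarrow> ennreal"
  where "square_fun M \<epsilon> \<xi>s S y =
    lim (\<lambda>n. ennreal (rad_norm M \<epsilon> n
      (\<lambda>k. sqrt (real k) *\<^sub>R (cblinfun_apply S ^^ (k - 1)) (cblinfun_apply (E_prod \<xi>s S) y))))"

end

theory Submission
  imports Defs "HOL-Complex_Analysis.Complex_Analysis"
begin

text \<open>Write \<open>A(z) = \<Prod>(1 - cnj \<xi>\<^sub>j z)\<close>. The coefficients of
  \<open>1 / A(z)\<^sup>3 = \<Sum> c\<^sub>k z\<^sup>k\<close> are \<open>O(k\<^sup>2)\<close>, so that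
  \<open>\<phi>(T) = \<Sum> c\<^sub>k \<phi>(T) T\<^sup>k A(T)\<^sup>3\<close>. Splitting \<open>T\<^sup>k\<close> into thirds,
  \<open>\<langle>\<phi>(T)x, y\<rangle>\<close> becomes a sum of pairings of \<open>m\<^sup>1\<^sup>/\<^sup>2 T\<^sup>m A(T) x\<close> and
  \<open>m\<^sup>1\<^sup>/\<^sup>2 (T\<^sup>*)\<^sup>m A(T\<^sup>*) y\<close> through the operators \<open>m T\<^sup>m A(T) \<phi>(T)\<close>. The latter
  are contour integrals of \<open>A(z) R(z,T)\<close> against \<open>m z\<^sup>m \<phi>(z)\<close>, whose total mass on
  \<open>\<partial>E\<^sub>u\<close> is at most a constant times the supremum of \<open>\<phi>\<close>, because \<open>1 - \<bar>z\<bar>\<close> is comparable there with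
  the distance from \<open>z\<close> to \<open>E\<close>. R-boundedness and the two square function estimates then bound
  the sum. To make all series and contour deformations legitimate, \<open>\<phi>(z)\<close> is first replaced by
  \<open>\<phi>(tz) A(z)\<^sup>3 / A(tz)\<^sup>3\<close>, and \<open>t\<close> tends to \<open>1\<close> at the end.\<close>

section \<open>Rademacher averages\<close>

text \<open>Operator-valued integrals are avoided: every estimate concerns scalar functions
  \<open>resolvent_form T y x\<close>, and operator norms come back through norming functionals,
  which is why a Hahn-Banach theorem is proved. The exponent 3 arises because two factors A feed the
  two square functions while the third tames the resolvent, which may blow up at E, where every
  contour passes. The growth k^2 of the coefficients is then used up exactly: one factor m is the
  product of the two weights m^(1/2), the other is absorbed by the contour integral of |z|^m, which
  is of order 1/m. The numerator contains A(z), not A(tz), because the square functions contain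
  A(T); the denominator contains A(tz), so that its series converges uniformly on the contour, and
  t^k <= 1 keeps the constants independent of t. R-boundedness is not applied to integrals of
  operators: it is put into a form with absolute values in which each summand may use its own point
  of the contour, so that each integral can be replaced by a supremum times a mass.\<close>

definition sgn_of :: "nat set \<Rightarrow> nat \<Rightarrow> real"
  where "sgn_of \<sigma> k = (if k \<in> \<sigma> then 1 else - 1)"

definition rad_sum :: "nat set \<Rightarrow> nat \<Rightarrow> (nat \<Rightarrow> 'x::real_vector) \<Rightarrow> 'x"
  where "rad_sum \<sigma> n x = (\<Sum>k=1..n. sgn_of \<sigma> k *\<^sub>R x k)"

lemma rademacher_pattern_prob:
  assumes "rademacher_seq M \<epsilon>"
  shows "measure M {u \<in> space M. \<forall>k\<in>{1..n}. \<epsilon> k u = sgn_of \<sigma> k} = 1 / 2 ^ n"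
proof -
  interpret prob_space M using assms by (simp add: rademacher_seq_def)
  have ind: "indep_vars (\<lambda>_. borel) \<epsilon> {1..}"
    and half: "\<And>k. k \<ge> 1 \<Longrightarrow> prob {u \<in> space M. \<epsilon> k u = 1} = 1/2 \<and> prob {u \<in> space M. \<epsilon> k u = -1} = 1/2"
    using assms by (auto simp: rademacher_seq_def)
  show ?thesis
  proof (cases "n = 0")
    case True
    then show ?thesis by (simp add: prob_space)
  next
    case False
    have "prob (\<Inter>k\<in>{1..n}. \<epsilon> k -` {sgn_of \<sigma> k} \<inter> space M)
        = (\<Prod>k\<in>{1..n}. prob (\<epsilon> k -` {sgn_of \<sigma> k} \<inter> space M))"
      by (rule indep_varsD[OF ind]) (use False in auto)
    also have "\<dots> = (\<Prod>k\<in>{1..n}. 1/2)"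
    proof (rule prod.cong)
      fix k assume "k \<in> {1..n}"
      moreover have "\<epsilon> k -` {sgn_of \<sigma> k} \<inter> space M = {u \<in> space M. \<epsilon> k u = sgn_of \<sigma> k}" by auto
      ultimately show "prob (\<epsilon> k -` {sgn_of \<sigma> k} \<inter> space M) = 1/2"
        using half[of k] by (auto simp: sgn_of_def)
    qed simp
    also have "\<dots> = 1 / 2 ^ n" by (simp add: power_one_over)
    also have "(\<Inter>k\<in>{1..n}. \<epsilon> k -` {sgn_of \<sigma> k} \<inter> space M)
        = {u \<in> space M. \<forall>k\<in>{1..n}. \<epsilon> k u = sgn_of \<sigma> k}"
      using False by auto
    finally show ?thesis .
  qed
qed

text \<open>\<open>rademacher_seq\<close> only prescribes the probabilities of 1 and -1; as they add
  up to 1, all other values form a null set.\<close>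

lemma rademacher_AE_pm1:
  assumes "rademacher_seq M \<epsilon>"
  shows "AE u in M. \<forall>k\<in>{1..n}. \<epsilon> k u = 1 \<or> \<epsilon> k u = - 1"
proof -
  interpret prob_space M using assms by (simp add: rademacher_seq_def)
  have ind: "indep_vars (\<lambda>_. borel) \<epsilon> {1..}"
    and half: "\<And>k. k \<ge> 1 \<Longrightarrow> prob {u \<in> space M. \<epsilon> k u = 1} = 1/2 \<and> prob {u \<in> space M. \<epsilon> k u = -1} = 1/2"
    using assms by (auto simp: rademacher_seq_def)
  have meas: "\<epsilon> k \<in> borel_measurable M" if "k \<ge> 1" for k
    using ind that by (auto simp: indep_vars_def)
  have "AE u in M. \<epsilon> k u = 1 \<or> \<epsilon> k u = - 1" if k: "k \<ge> 1" for k
  proof -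
    note [measurable] = meas[OF k]
    have "prob ({u \<in> space M. \<epsilon> k u = 1} \<union> {u \<in> space M. \<epsilon> k u = -1}) = 1/2 + 1/2"
      by (subst finite_measure_Union) (use half[OF k] in auto)
    also have "{u \<in> space M. \<epsilon> k u = 1} \<union> {u \<in> space M. \<epsilon> k u = -1}
        = {u \<in> space M. \<epsilon> k u = 1 \<or> \<epsilon> k u = - 1}" by auto
    finally show ?thesis by (subst prob_Collect_eq_1[symmetric]) simp_all
  qed
  then show ?thesis by (subst AE_ball_countable) auto
qed

text \<open>Up to a null set the space splits into 2^n equally likely sign patterns, coded by the
  set of indices with sign 1. From here on Rademacher averages are finite averages over
  \<open>Pow {1..n}\<close>.\<close>

lemma rad_norm_sq:
  fixes x :: "nat \<Rightarrow> 'x::real_normed_vector"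
  assumes "rademacher_seq M \<epsilon>"
  shows "(rad_norm M \<epsilon> n x)\<^sup>2 = (\<Sum>\<sigma>\<in>Pow {1..n}. (norm (rad_sum \<sigma> n x))\<^sup>2) / 2 ^ n"
proof -
  interpret prob_space M using assms by (simp add: rademacher_seq_def)
  have ind: "indep_vars (\<lambda>_. borel) \<epsilon> {1..}"
    using assms by (auto simp: rademacher_seq_def)
  have meas: "\<epsilon> k \<in> borel_measurable M" if "k \<ge> 1" for k
    using ind that by (auto simp: indep_vars_def)
  \<comment> \<open>Measurability is known for k >= 1 only; index 0 is overwritten so that every
    coordinate is measurable.\<close>
  define e where "e u k = (if k \<ge> 1 then \<epsilon> k u else 0)" for u and k :: nat
  define P where "P \<sigma> = {u \<in> space M. \<forall>k\<in>{1..n}. \<epsilon> k u = sgn_of \<sigma> k}" for \<sigma>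
  have P: "P \<sigma> \<in> sets M" for \<sigma>
  proof -
    have "P \<sigma> = {u \<in> space M. \<forall>k\<in>{1..n}. e u k = sgn_of \<sigma> k}"
      unfolding P_def e_def by auto
    moreover have "(\<lambda>u. e u k) \<in> borel_measurable M" for k
      unfolding e_def using meas by (cases "k \<ge> 1") auto
    ultimately show ?thesis by simp
  qed
  \<comment> \<open>The vectors need not lie in a separable space, so the norm is treated as a
    continuous function of the whole sequence of signs.\<close>
  have "e \<in> borel_measurable M"
  proof (rule measurable_coordinatewise_then_product)
    show "(\<lambda>u. e u k) \<in> borel_measurable M" for k
      unfolding e_def using meas by (cases "k \<ge> 1") auto
  qed
  moreover have "(\<lambda>f :: nat \<Rightarrow> real. (norm (\<Sum>k=1..n. f k *\<^sub>R x k))\<^sup>2) \<in> borel_measurable borel"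
    by (intro borel_measurable_continuous_onI continuous_intros continuous_on_product_coordinates)
  ultimately have "(\<lambda>u. (norm (\<Sum>k=1..n. e u k *\<^sub>R x k))\<^sup>2) \<in> borel_measurable M"
    by (rule measurable_compose)
  moreover have "(\<Sum>k=1..n. e u k *\<^sub>R x k) = (\<Sum>k=1..n. \<epsilon> k u *\<^sub>R x k)" for u
    by (intro sum.cong) (auto simp: e_def)
  ultimately have m: "(\<lambda>u. (norm (\<Sum>k=1..n. \<epsilon> k u *\<^sub>R x k))\<^sup>2) \<in> borel_measurable M"
    by simp
  have "(LINT u|M. (norm (\<Sum>k=1..n. \<epsilon> k u *\<^sub>R x k))\<^sup>2)
     = (LINT u|M. (\<Sum>\<sigma>\<in>Pow {1..n}. indicator (P \<sigma>) u * (norm (rad_sum \<sigma> n x))\<^sup>2))"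
  proof (rule integral_cong_AE[OF m])
    show "(\<lambda>u. (\<Sum>\<sigma>\<in>Pow {1..n}. indicator (P \<sigma>) u * (norm (rad_sum \<sigma> n x))\<^sup>2)) \<in> borel_measurable M"
      by (intro borel_measurable_sum borel_measurable_times borel_measurable_indicator
          borel_measurable_const P)
    show "AE u in M. (norm (\<Sum>k=1..n. \<epsilon> k u *\<^sub>R x k))\<^sup>2
        = (\<Sum>\<sigma>\<in>Pow {1..n}. indicator (P \<sigma>) u * (norm (rad_sum \<sigma> n x))\<^sup>2)"
      using rademacher_AE_pm1[OF assms, of n] AE_space
    proof eventually_elim
      case (elim u)
      define \<tau> where "\<tau> = {k\<in>{1..n}. \<epsilon> k u = 1}"
      have \<tau>: "\<epsilon> k u = sgn_of \<tau> k" if "k \<in> {1..n}" for k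
        using elim that by (auto simp: \<tau>_def sgn_of_def)
      have "u \<in> P \<sigma> \<longleftrightarrow> \<sigma> = \<tau>" if "\<sigma> \<in> Pow {1..n}" for \<sigma>
      proof
        assume u: "u \<in> P \<sigma>"
        have "k \<in> \<sigma> \<longleftrightarrow> k \<in> \<tau>" if "k \<in> {1..n}" for k
        proof -
          have "sgn_of \<sigma> k = sgn_of \<tau> k" using u \<tau>[OF that] that by (simp add: P_def)
          then show ?thesis by (simp add: sgn_of_def split: if_splits)
        qed
        then show "\<sigma> = \<tau>" using that unfolding \<tau>_def by blast
      qed (use elim \<tau> in \<open>simp add: P_def\<close>)
      then have "(\<Sum>\<sigma>\<in>Pow {1..n}. indicator (P \<sigma>) u * (norm (rad_sum \<sigma> n x))\<^sup>2)
          = (\<Sum>\<sigma>\<in>Pow {1..n}. if \<sigma> = \<tau> then (norm (rad_sum \<sigma> n x))\<^sup>2 else 0)"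
        by (intro sum.cong) (auto simp: indicator_def)
      also have "\<dots> = (norm (rad_sum \<tau> n x))\<^sup>2"
        by (subst sum.delta) (auto simp: \<tau>_def)
      also have "rad_sum \<tau> n x = (\<Sum>k=1..n. \<epsilon> k u *\<^sub>R x k)"
        unfolding rad_sum_def by (intro sum.cong) (auto simp: \<tau>)
      finally show ?case by simp
    qed
  qed
  also have "\<dots> = (\<Sum>\<sigma>\<in>Pow {1..n}. prob (P \<sigma>) * (norm (rad_sum \<sigma> n x))\<^sup>2)"
    using P by (subst Bochner_Integration.integral_sum) (auto simp: emeasure_eq_measure)
  also have "\<dots> = (\<Sum>\<sigma>\<in>Pow {1..n}. (norm (rad_sum \<sigma> n x))\<^sup>2) / 2 ^ n"
    unfolding P_def rademacher_pattern_prob[OF assms] by (simp add: sum_divide_distrib)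
  finally show ?thesis
    unfolding rad_norm_def by (simp add: sum_nonneg)
qed

lemma rad_norm_nonneg: "0 \<le> rad_norm M \<epsilon> n x"
  by (simp add: rad_norm_def)

lemma sum_Pow_Suc:
  fixes f :: "nat set \<Rightarrow> 'b::comm_monoid_add"
  shows "(\<Sum>\<sigma>\<in>Pow {1..Suc n}. f \<sigma>) = (\<Sum>\<sigma>\<in>Pow {1..n}. f \<sigma> + f (insert (Suc n) \<sigma>))"
proof -
  have "{1..Suc n} = insert (Suc n) {1..n}" by auto
  then have "Pow {1..Suc n} = Pow {1..n} \<union> insert (Suc n) ` Pow {1..n}"
    by (simp add: Pow_insert)
  moreover have "inj_on (insert (Suc n)) (Pow {1..n})"
    unfolding inj_on_def by (metis PowD atLeastAtMost_iff insert_ident not_less_eq_eq order_refl subsetD)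
  moreover have "Pow {1..n} \<inter> insert (Suc n) ` Pow {1..n} = {}" by auto
  ultimately show ?thesis
    by (simp add: sum.union_disjoint sum.reindex sum.distrib)
qed

lemma rad_sum_Suc:
  assumes "\<sigma> \<in> Pow {1..n}"
  shows "rad_sum \<sigma> (Suc n) x = rad_sum \<sigma> n x - x (Suc n)"
    and "rad_sum (insert (Suc n) \<sigma>) (Suc n) x = rad_sum \<sigma> n x + x (Suc n)"
proof -
  have "Suc n \<notin> \<sigma>" using assms by auto
  then show "rad_sum \<sigma> (Suc n) x = rad_sum \<sigma> n x - x (Suc n)"
    by (simp add: rad_sum_def sgn_of_def)
  have "(\<Sum>k=1..n. sgn_of (insert (Suc n) \<sigma>) k *\<^sub>R x k) = (\<Sum>k=1..n. sgn_of \<sigma> k *\<^sub>R x k)"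
    by (intro sum.cong) (auto simp: sgn_of_def)
  then show "rad_sum (insert (Suc n) \<sigma>) (Suc n) x = rad_sum \<sigma> n x + x (Suc n)"
    by (simp add: rad_sum_def sgn_of_def)
qed

text \<open>By convexity the squared norm of a is at most the mean of those of a - b and a + b, so
  averaging over the sign of a new term cannot decrease the average. Hence the \<open>lim\<close> in
  \<open>square_fun\<close> is a supremum.\<close>

lemma rad_norm_mono_Suc:
  fixes x :: "nat \<Rightarrow> 'x::real_normed_vector"
  assumes "rademacher_seq M \<epsilon>"
  shows "rad_norm M \<epsilon> n x \<le> rad_norm M \<epsilon> (Suc n) x"
proof (rule power2_le_imp_le[OF _ rad_norm_nonneg])
  have convex: "2 * (norm a)\<^sup>2 \<le> (norm (a - b))\<^sup>2 + (norm (a + b))\<^sup>2" for a b :: 'x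
  proof -
    have "norm ((a - b) + (a + b)) \<le> norm (a - b) + norm (a + b)" by (rule norm_triangle_ineq)
    moreover have "(a - b) + (a + b) = 2 *\<^sub>R a" by (simp add: scaleR_2)
    ultimately have "2 * norm a \<le> norm (a - b) + norm (a + b)" by simp
    then have "(2 * norm a)\<^sup>2 \<le> (norm (a - b) + norm (a + b))\<^sup>2" by (intro power_mono) auto
    also have "\<dots> \<le> 2 * ((norm (a - b))\<^sup>2 + (norm (a + b))\<^sup>2)"
      using zero_le_power2[of "norm (a - b) - norm (a + b)"] by (simp add: power2_eq_square algebra_simps)
    finally show ?thesis by (simp add: power2_eq_square)
  qed
  have "(\<Sum>\<sigma>\<in>Pow {1..n}. 2 * (norm (rad_sum \<sigma> n x))\<^sup>2)
      \<le> (\<Sum>\<sigma>\<in>Pow {1..Suc n}. (norm (rad_sum \<sigma> (Suc n) x))\<^sup>2)"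
    unfolding sum_Pow_Suc by (intro sum_mono) (simp only: rad_sum_Suc convex)
  then show "(rad_norm M \<epsilon> n x)\<^sup>2 \<le> (rad_norm M \<epsilon> (Suc n) x)\<^sup>2"
    unfolding rad_norm_sq[OF assms] by (simp add: sum_distrib_left[symmetric] field_simps)
qed

lemma rad_norm_sign_change:
  fixes x :: "nat \<Rightarrow> 'x::real_normed_vector"
  assumes R: "rademacher_seq M \<epsilon>" and s: "\<And>k. s k = 1 \<or> s k = - 1"
  shows "rad_norm M \<epsilon> n (\<lambda>k. s k *\<^sub>R x k) = rad_norm M \<epsilon> n x"
proof -
  \<comment> \<open>\<open>f\<close> multiplies a sign pattern by \<open>s\<close>; being an
    involution, it only permutes the patterns.\<close>
  define f where "f \<sigma> = {k\<in>{1..n}. k \<in> \<sigma> \<longleftrightarrow> s k = 1}" for \<sigma>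
  have f: "f (f \<sigma>) = \<sigma>" if "\<sigma> \<in> Pow {1..n}" for \<sigma>
    using that by (auto simp: f_def)
  have "rad_sum (f \<sigma>) n x = rad_sum \<sigma> n (\<lambda>k. s k *\<^sub>R x k)" for \<sigma>
    unfolding rad_sum_def
  proof (intro sum.cong refl)
    fix k assume "k \<in> {1..n}"
    then show "sgn_of (f \<sigma>) k *\<^sub>R x k = sgn_of \<sigma> k *\<^sub>R s k *\<^sub>R x k"
      using s[of k] by (auto simp: sgn_of_def f_def)
  qed
  then have "(\<Sum>\<sigma>\<in>Pow {1..n}. (norm (rad_sum \<sigma> n (\<lambda>k. s k *\<^sub>R x k)))\<^sup>2)
      = (\<Sum>\<sigma>\<in>Pow {1..n}. (norm (rad_sum \<sigma> n x))\<^sup>2)"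
    by (intro sum.reindex_bij_witness[of _ f f]) (use f in \<open>auto simp: f_def\<close>)
  then have "(rad_norm M \<epsilon> n (\<lambda>k. s k *\<^sub>R x k))\<^sup>2 = (rad_norm M \<epsilon> n x)\<^sup>2"
    unfolding rad_norm_sq[OF R] by simp
  then show ?thesis by (simp add: rad_norm_nonneg)
qed

section \<open>Pointwise rules for operators, and duality of Rademacher averages\<close>

lemma cblinfun_norm_apply:
  "norm (cblinfun_apply f x) \<le> norm f * norm x"
  by transfer (rule norm_blinfun)

lemma cblinfun_apply_add_left: "cblinfun_apply (f + g) x = cblinfun_apply f x + cblinfun_apply g x"
  by transfer (rule blinfun.add_left)

lemma cblinfun_apply_diff_left: "cblinfun_apply (f - g) x = cblinfun_apply f x - cblinfun_apply g x"
  by transfer (rule blinfun.diff_left)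

lemma cblinfun_apply_scaleR_left: "cblinfun_apply (c *\<^sub>R f) x = c *\<^sub>R cblinfun_apply f x"
  by transfer (rule blinfun.scaleR_left)

lemma cblinfun_apply_scaleC_left: "cblinfun_apply (c *\<^sub>C f) x = c *\<^sub>C cblinfun_apply f x"
  by transfer (simp add: blinfun_apply_scaleC_aux)

lemma cblinfun_apply_id: "cblinfun_apply cblinfun_id x = x"
  by transfer simp

lemma cblinfun_apply_add: "cblinfun_apply f (x + y) = cblinfun_apply f x + cblinfun_apply f y"
  by (rule linear_add[OF bounded_linear.linear[OF bounded_linear_cblinfun_apply]])

lemma cblinfun_apply_diff: "cblinfun_apply f (x - y) = cblinfun_apply f x - cblinfun_apply f y"
  by (rule linear_diff[OF bounded_linear.linear[OF bounded_linear_cblinfun_apply]])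

lemma cblinfun_apply_scaleR: "cblinfun_apply f (c *\<^sub>R x) = c *\<^sub>R cblinfun_apply f x"
  by (rule linear_cmul[OF bounded_linear.linear[OF bounded_linear_cblinfun_apply]])

text \<open>By orthogonality of the signs, \<open>\<Sum> v\<^sub>k(x\<^sub>k)\<close> is the average of
  \<open>(\<Sum> \<epsilon>\<^sub>k v\<^sub>k)(\<Sum> \<epsilon>\<^sub>k x\<^sub>k)\<close>, so Cauchy-Schwarz applies.\<close>

lemma rad_norm_duality:
  fixes x :: "nat \<Rightarrow> 'a::complex_normed_vector" and v :: "nat \<Rightarrow> 'a cdual"
  assumes R: "rademacher_seq M \<epsilon>"
  shows "cmod (\<Sum>k=1..n. cblinfun_apply (v k) (x k)) \<le> rad_norm M \<epsilon> n v * rad_norm M \<epsilon> n x"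
proof -
  have "(\<Sum>\<sigma>\<in>Pow {1..n}. cblinfun_apply (rad_sum \<sigma> n v) (rad_sum \<sigma> n x))
      = 2 ^ n * (\<Sum>k=1..n. cblinfun_apply (v k) (x k))"
  proof (induction n)
    case 0
    then show ?case by (simp add: rad_sum_def zero_cblinfun.rep_eq cblinfun_apply.rep_eq)
  next
    case (Suc n)
    \<comment> \<open>The two signs of the last term cancel the mixed pairings.\<close>
    have "cblinfun_apply (V - w) (X - z) + cblinfun_apply (V + w) (X + z)
        = 2 * cblinfun_apply V X + 2 * cblinfun_apply w z"
      for V w :: "'a cdual" and X z
      by (simp add: cblinfun_apply_add_left cblinfun_apply_diff_left cblinfun_apply_add
          cblinfun_apply_diff algebra_simps)
    then have "(\<Sum>\<sigma>\<in>Pow {1..Suc n}. cblinfun_apply (rad_sum \<sigma> (Suc n) v) (rad_sum \<sigma> (Suc n) x))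
        = (\<Sum>\<sigma>\<in>Pow {1..n}. 2 * cblinfun_apply (rad_sum \<sigma> n v) (rad_sum \<sigma> n x)
            + 2 * cblinfun_apply (v (Suc n)) (x (Suc n)))"
      unfolding sum_Pow_Suc by (intro sum.cong refl) (simp only: rad_sum_Suc)
    also have "\<dots> = 2 ^ Suc n * (\<Sum>k=1..Suc n. cblinfun_apply (v k) (x k))"
      unfolding sum.distrib sum_distrib_left[symmetric] Suc.IH
      by (simp add: card_Pow algebra_simps)
    finally show ?case .
  qed
  from arg_cong[OF this, of cmod] have "2 ^ n * cmod (\<Sum>k=1..n. cblinfun_apply (v k) (x k))
      = cmod (\<Sum>\<sigma>\<in>Pow {1..n}. cblinfun_apply (rad_sum \<sigma> n v) (rad_sum \<sigma> n x))"
    by (simp add: norm_mult norm_power)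
  also have "\<dots> \<le> (\<Sum>\<sigma>\<in>Pow {1..n}. \<bar>norm (rad_sum \<sigma> n v)\<bar> * \<bar>norm (rad_sum \<sigma> n x)\<bar>)"
    by (rule order_trans[OF norm_sum]) (simp add: sum_mono cblinfun_norm_apply)
  also have "\<dots> \<le> L2_set (\<lambda>\<sigma>. norm (rad_sum \<sigma> n v)) (Pow {1..n})
        * L2_set (\<lambda>\<sigma>. norm (rad_sum \<sigma> n x)) (Pow {1..n})"
    by (rule L2_set_mult_ineq)
  also have "\<dots> = 2 ^ n * (rad_norm M \<epsilon> n v * rad_norm M \<epsilon> n x)"
  proof -
    have L2: "L2_set (\<lambda>\<sigma>. norm (rad_sum \<sigma> n f)) (Pow {1..n}) = sqrt (2 ^ n) * rad_norm M \<epsilon> n f"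
      for f :: "nat \<Rightarrow> 'z::real_normed_vector"
    proof -
      have "(\<Sum>\<sigma>\<in>Pow {1..n}. (norm (rad_sum \<sigma> n f))\<^sup>2) = 2 ^ n * (rad_norm M \<epsilon> n f)\<^sup>2"
        by (simp add: rad_norm_sq[OF R])
      then show ?thesis
        by (simp add: L2_set_def real_sqrt_mult rad_norm_nonneg)
    qed
    have "sqrt (2 ^ n) * sqrt (2 ^ n) = (2 ^ n :: real)" by simp
    then show ?thesis unfolding L2
      by (metis (no_types, opaque_lifting) mult.assoc mult.left_commute)
  qed
  finally show ?thesis by simp
qed

text \<open>The partial averages increase, so each of them lies below the limit.\<close>

lemma rad_norm_le_square_fun_bound:
  fixes S :: "('a::complex_normed_vector, 'a) cblinfun"
  assumes R: "rademacher_seq M \<epsilon>" and "square_fun M \<epsilon> \<xi>s S y \<le> ennreal B" and "0 \<le> B"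
  shows "rad_norm M \<epsilon> n
    (\<lambda>k. sqrt (real k) *\<^sub>R (cblinfun_apply S ^^ (k - 1)) (cblinfun_apply (E_prod \<xi>s S) y)) \<le> B"
proof -
  define f where "f n = ennreal (rad_norm M \<epsilon> n
    (\<lambda>k. sqrt (real k) *\<^sub>R (cblinfun_apply S ^^ (k - 1)) (cblinfun_apply (E_prod \<xi>s S) y)))" for n
  have "incseq f"
    unfolding f_def by (intro incseq_SucI ennreal_leI rad_norm_mono_Suc R)
  then have "f \<longlonglongrightarrow> (SUP n. f n)" by (rule LIMSEQ_SUP)
  then have "lim f = (SUP n. f n)" by (rule limI)
  then have "(SUP n. f n) \<le> ennreal B"
    using assms(2) unfolding square_fun_def f_def by simp
  then have "f n \<le> ennreal B" by (rule order_trans[OF SUP_upper[OF UNIV_I]])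
  then show ?thesis using \<open>0 \<le> B\<close> by (simp add: f_def)
qed

section \<open>R-bounded sets\<close>

lemma rad_norm_1:
  fixes x :: "nat \<Rightarrow> 'x::real_normed_vector"
  assumes "rademacher_seq M \<epsilon>"
  shows "rad_norm M \<epsilon> 1 x = norm (x 1)"
proof -
  have "(rad_norm M \<epsilon> 1 x)\<^sup>2 = (norm (x 1))\<^sup>2"
    unfolding rad_norm_sq[OF assms] by (simp add: rad_sum_def sgn_of_def Pow_insert)
  then show ?thesis by (simp add: rad_norm_nonneg)
qed

text \<open>For sequences of length one the average is the plain norm, which turns R-boundedness
  into a uniform norm bound.\<close>

lemma R_bounded_norm_bound:
  fixes F :: "('a::complex_normed_vector, 'a) cblinfun set"
  assumes R: "rademacher_seq M \<epsilon>" and "R_bounded M \<epsilon> F"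
  obtains C where "0 < C" "\<And>A x. A \<in> F \<Longrightarrow> norm (cblinfun_apply A x) \<le> C * norm x"
proof -
  obtain C where "C > 0" and C: "\<And>n A x. (\<forall>k\<in>{1..n}. A k \<in> F) \<Longrightarrow>
       rad_norm M \<epsilon> n (\<lambda>k. cblinfun_apply (A k) (x k)) \<le> C * rad_norm M \<epsilon> n x"
    using assms(2) unfolding R_bounded_def by blast
  have "norm (cblinfun_apply A x) \<le> C * norm x" if "A \<in> F" for A x
    using C[of 1 "\<lambda>_. A" "\<lambda>_. x"] that by (simp only: rad_norm_1[OF R]) simp
  with \<open>C > 0\<close> show ?thesis by (rule that)
qed

text \<open>Choosing the signs one at a time turns R-boundedness into an absolute bound that allows
  a different operator of the set in each summand, so that it survives averaging in each summand
  separately.\<close>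

lemma R_bounded_absolute_sum:
  fixes F :: "('a::complex_normed_vector, 'a) cblinfun set"
  assumes R: "rademacher_seq M \<epsilon>" and "R_bounded M \<epsilon> F"
  obtains C where "0 < C"
    "\<And>n A (x :: nat \<Rightarrow> 'a) (v :: nat \<Rightarrow> 'a cdual). (\<And>k. k \<in> {1..n} \<Longrightarrow> A k \<in> F) \<Longrightarrow>
       (\<Sum>k=1..n. cmod (cblinfun_apply (v k) (cblinfun_apply (A k) (x k))))
         \<le> C * rad_norm M \<epsilon> n v * rad_norm M \<epsilon> n x"
proof -
  obtain C where "C > 0" and C: "\<And>n A x. (\<forall>k\<in>{1..n}. A k \<in> F) \<Longrightarrow>
       rad_norm M \<epsilon> n (\<lambda>k. cblinfun_apply (A k) (x k)) \<le> C * rad_norm M \<epsilon> n x"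
    using assms(2) unfolding R_bounded_def by blast
  have "(\<Sum>k=1..n. cmod (cblinfun_apply (v k) (cblinfun_apply (A k) (x k))))
         \<le> 2 * C * rad_norm M \<epsilon> n v * rad_norm M \<epsilon> n x"
    if A: "\<And>k. k \<in> {1..n} \<Longrightarrow> A k \<in> F"
    for n A and x :: "nat \<Rightarrow> 'a" and v :: "nat \<Rightarrow> 'a cdual"
  proof -
    define w where "w k = cblinfun_apply (v k) (cblinfun_apply (A k) (x k))" for k
    have *: "cmod (\<Sum>k=1..n. s k *\<^sub>R w k) \<le> C * rad_norm M \<epsilon> n v * rad_norm M \<epsilon> n x"
      if s: "\<And>k. s k = 1 \<or> s k = - 1" for s :: "nat \<Rightarrow> real"
    proof -
      have "cmod (\<Sum>k=1..n. s k *\<^sub>R w k)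
          = cmod (\<Sum>k=1..n. cblinfun_apply (s k *\<^sub>R v k) (cblinfun_apply (A k) (x k)))"
        by (simp add: w_def cblinfun_apply_scaleR_left)
      also have "\<dots> \<le> rad_norm M \<epsilon> n (\<lambda>k. s k *\<^sub>R v k) * rad_norm M \<epsilon> n (\<lambda>k. cblinfun_apply (A k) (x k))"
        by (rule rad_norm_duality[OF R])
      also have "\<dots> \<le> rad_norm M \<epsilon> n v * (C * rad_norm M \<epsilon> n x)"
        unfolding rad_norm_sign_change[OF R s]
        by (intro mult_left_mono C rad_norm_nonneg) (use A in blast)
      finally show ?thesis by (simp add: mult_ac)
    qed
    \<comment> \<open>The signs are real, so they can align the real parts or the imaginary parts,
      but not both at once; treating them separately costs the factor 2.\<close>
    have "(\<Sum>k=1..n. \<bar>Re (w k)\<bar>) \<le> C * rad_norm M \<epsilon> n v * rad_norm M \<epsilon> n x"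
    proof -
      let ?s = "\<lambda>k. if Re (w k) \<ge> 0 then 1 else - 1 :: real"
      have "(\<Sum>k=1..n. \<bar>Re (w k)\<bar>) = Re (\<Sum>k=1..n. ?s k *\<^sub>R w k)"
        by (simp add: if_distrib) (intro sum.cong; auto)
      also have "\<dots> \<le> cmod (\<Sum>k=1..n. ?s k *\<^sub>R w k)" by (rule complex_Re_le_cmod)
      also have "\<dots> \<le> C * rad_norm M \<epsilon> n v * rad_norm M \<epsilon> n x" by (rule *) auto
      finally show ?thesis .
    qed
    moreover have "(\<Sum>k=1..n. \<bar>Im (w k)\<bar>) \<le> C * rad_norm M \<epsilon> n v * rad_norm M \<epsilon> n x"
    proof -
      let ?s = "\<lambda>k. if Im (w k) \<ge> 0 then 1 else - 1 :: real"
      have "(\<Sum>k=1..n. \<bar>Im (w k)\<bar>) = Im (\<Sum>k=1..n. ?s k *\<^sub>R w k)"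
        by (simp add: if_distrib) (intro sum.cong; auto)
      also have "\<dots> \<le> cmod (\<Sum>k=1..n. ?s k *\<^sub>R w k)" using abs_Im_le_cmod[of "\<Sum>k=1..n. ?s k *\<^sub>R w k"] by linarith
      also have "\<dots> \<le> C * rad_norm M \<epsilon> n v * rad_norm M \<epsilon> n x" by (rule *) auto
      finally show ?thesis .
    qed
    moreover have "(\<Sum>k=1..n. cmod (w k)) \<le> (\<Sum>k=1..n. \<bar>Re (w k)\<bar>) + (\<Sum>k=1..n. \<bar>Im (w k)\<bar>)"
      unfolding sum.distrib[symmetric] by (intro sum_mono cmod_le)
    ultimately show ?thesis by (simp add: w_def)
  qed
  with \<open>C > 0\<close> show ?thesis by (intro that[of "2 * C"]) auto
qed

section \<open>Norming functionals\<close>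

definition sublinear_below :: "('a::real_vector \<Rightarrow> real) \<Rightarrow> ('a \<Rightarrow> real) \<Rightarrow> bool"
  where "sublinear_below N p \<longleftrightarrow> (\<forall>x y. p (x + y) \<le> p x + p y) \<and>
    (\<forall>c x. 0 < c \<longrightarrow> p (c *\<^sub>R x) = c * p x) \<and> (\<forall>x. p x \<le> N x)"

text \<open>Pushing a sublinear functional down along a direction \<open>v\<close> makes it no larger than
  \<open>- p v\<close> at \<open>- v\<close>. A minimal functional is therefore odd, hence linear.\<close>

definition push_down :: "('a::real_vector \<Rightarrow> real) \<Rightarrow> 'a \<Rightarrow> 'a \<Rightarrow> real"
  where "push_down p v x = (INF t\<in>{0..}. p (x + t *\<^sub>R v) - t * p v)"

lemma sublinear_below_zero:
  assumes "sublinear_below N p"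
  shows "p 0 = 0"
proof -
  have "p (2 *\<^sub>R 0) = 2 * p 0"
    using assms unfolding sublinear_below_def by (metis zero_less_numeral)
  then show ?thesis by simp
qed

text \<open>The bound that keeps the infimum over a chain of such functionals finite.\<close>

lemma sublinear_below_lower:
  assumes "sublinear_below N p"
  shows "- N (- x) \<le> p x"
proof -
  have "p (x + - x) \<le> p x + p (- x)" "p (- x) \<le> N (- x)"
    using assms unfolding sublinear_below_def by blast+
  then show ?thesis using sublinear_below_zero[OF assms] by simp
qed

lemma push_down_props:
  assumes "sublinear_below N p"
  shows "sublinear_below N (push_down p v)" and "push_down p v x \<le> p x"
    and "push_down p v (- v) \<le> - p v"
proof -
  have add: "p (x + y) \<le> p x + p y" and hom: "c \<ge> 0 \<Longrightarrow> p (c *\<^sub>R x) = c * p x" and le: "p x \<le> N x"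
    for x y c
  proof -
    show "p (x + y) \<le> p x + p y" "p x \<le> N x"
      using assms unfolding sublinear_below_def by blast+
    show "p (c *\<^sub>R x) = c * p x" if "c \<ge> 0"
      using assms sublinear_below_zero[OF assms] that unfolding sublinear_below_def
      by (cases "c = 0") auto
  qed
  \<comment> \<open>A bound free of \<open>t\<close>, so that the infimum over all t >= 0 is
    finite.\<close>
  have low: "- p (- x) \<le> p (x + t *\<^sub>R v) - t * p v" if "t \<ge> 0" for t x
  proof -
    have "p (t *\<^sub>R v) \<le> p (x + t *\<^sub>R v) + p (- x)"
      using add[of "x + t *\<^sub>R v" "- x"] by (simp add: algebra_simps)
    then show ?thesis using hom[OF that, of v] by simp
  qed
  have bdd: "bdd_below ((\<lambda>t. p (x + t *\<^sub>R v) - t * p v) ` {0..})" for x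
    by (rule bdd_belowI2[where m="- p (- x)"]) (use low in auto)
  have upper: "push_down p v x \<le> p (x + t *\<^sub>R v) - t * p v" if "t \<ge> 0" for t x
    unfolding push_down_def by (rule cINF_lower[OF bdd]) (use that in auto)
  have lower: "B \<le> push_down p v x" if "\<And>t. t \<ge> 0 \<Longrightarrow> B \<le> p (x + t *\<^sub>R v) - t * p v" for B x
    unfolding push_down_def by (rule cINF_greatest) (use that in auto)
  show le_p: "push_down p v x \<le> p x" for x using upper[of 0 x] by simp
  show "push_down p v (- v) \<le> - p v"
    using upper[of 1 "- v"] sublinear_below_zero[OF assms] by simp
  show "sublinear_below N (push_down p v)"
    unfolding sublinear_below_def
  proof (intro conjI allI impI)
    fix x y
    \<comment> \<open>A shift t used at x and a shift s used at y combine to the shift t + s at x +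
      y.\<close>
    have "push_down p v (x + y) - push_down p v x \<le> push_down p v y"
    proof (rule lower)
      fix s :: real assume s: "s \<ge> 0"
      have "push_down p v (x + y) - (p (y + s *\<^sub>R v) - s * p v) \<le> push_down p v x"
      proof (rule lower)
        fix t :: real assume t: "t \<ge> 0"
        have "push_down p v (x + y) \<le> p (x + y + (t + s) *\<^sub>R v) - (t + s) * p v"
          by (rule upper) (use s t in auto)
        also have "x + y + (t + s) *\<^sub>R v = (x + t *\<^sub>R v) + (y + s *\<^sub>R v)"
          by (simp add: algebra_simps)
        finally show "push_down p v (x + y) - (p (y + s *\<^sub>R v) - s * p v) \<le> p (x + t *\<^sub>R v) - t * p v"
          using add[of "x + t *\<^sub>R v" "y + s *\<^sub>R v"] by (simp add: algebra_simps)
      qed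
      then show "push_down p v (x + y) - push_down p v x \<le> p (y + s *\<^sub>R v) - s * p v" by simp
    qed
    then show "push_down p v (x + y) \<le> push_down p v x + push_down p v y" by simp
  next
    fix c :: real and x assume c: "c > 0"
    have scale: "push_down p v (c *\<^sub>R x) \<le> c * push_down p v x" if c: "c > 0" for c x
    proof -
      have "push_down p v (c *\<^sub>R x) / c \<le> push_down p v x"
      proof (rule lower)
        fix t :: real assume t: "t \<ge> 0"
        have "push_down p v (c *\<^sub>R x) \<le> p (c *\<^sub>R x + (c * t) *\<^sub>R v) - (c * t) * p v"
          by (rule upper) (use c t in auto)
        also have "p (c *\<^sub>R x + (c * t) *\<^sub>R v) = c * p (x + t *\<^sub>R v)"
          using hom[of c "x + t *\<^sub>R v"] c by (simp add: algebra_simps)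
        finally show "push_down p v (c *\<^sub>R x) / c \<le> p (x + t *\<^sub>R v) - t * p v"
          using c by (simp add: field_simps)
      qed
      then show ?thesis using c by (simp add: field_simps)
    qed
    \<comment> \<open>The reverse inequality is \<open>scale\<close> for the inverse factor.\<close>
    have "push_down p v (inverse c *\<^sub>R c *\<^sub>R x) \<le> inverse c * push_down p v (c *\<^sub>R x)"
      by (rule scale) (use c in simp)
    then have "c * push_down p v x \<le> push_down p v (c *\<^sub>R x)"
      using c by (simp add: field_simps)
    with scale[OF c] show "push_down p v (c *\<^sub>R x) = c * push_down p v x" by (simp add: order_antisym)
  next
    fix x show "push_down p v x \<le> N x" using le_p[of x] le[of x] by linarith
  qed
qed

text \<open>The chain condition yields subadditivity: if p is used at x and q at y, the smaller of
  the two serves at both points.\<close>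

lemma sublinear_below_chain_Inf:
  assumes chain: "\<And>p q. p \<in> C \<Longrightarrow> q \<in> C \<Longrightarrow> (\<forall>x. p x \<le> q x) \<or> (\<forall>x. q x \<le> p x)"
    and C: "\<And>p. p \<in> C \<Longrightarrow> sublinear_below N p" and "C \<noteq> {}"
  shows "sublinear_below N (\<lambda>x. INF p\<in>C. p x)" and "p \<in> C \<Longrightarrow> (INF p\<in>C. p x) \<le> p x"
proof -
  have bdd: "bdd_below ((\<lambda>p. p x) ` C)" for x
    by (rule bdd_belowI2[where m="- N (- x)"]) (use sublinear_below_lower C in blast)
  have lower: "(INF p\<in>C. p x) \<le> p x" if "p \<in> C" for p x
    by (rule cINF_lower[OF bdd that])
  have greatest: "B \<le> (INF p\<in>C. p x)" if "\<And>p. p \<in> C \<Longrightarrow> B \<le> p x" for B x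
    by (rule cINF_greatest[OF \<open>C \<noteq> {}\<close> that])
  have add: "p (x + y) \<le> p x + p y" and hom: "0 < c \<Longrightarrow> p (c *\<^sub>R x) = c * p x" and le: "p x \<le> N x"
    if "p \<in> C" for p x y c
    using C[OF that] unfolding sublinear_below_def by blast+
  show "(INF p\<in>C. p x) \<le> p x" if "p \<in> C" by (rule lower[OF that])
  show "sublinear_below N (\<lambda>x. INF p\<in>C. p x)"
    unfolding sublinear_below_def
  proof (intro conjI allI impI)
    fix x y
    have "(INF p\<in>C. p (x + y)) - (INF p\<in>C. p x) \<le> (INF p\<in>C. p y)"
    proof (rule greatest)
      fix q assume q: "q \<in> C"
      have "(INF p\<in>C. p (x + y)) - q y \<le> (INF p\<in>C. p x)"
      proof (rule greatest)
        fix p assume p: "p \<in> C"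
        from chain[OF p q] obtain m where m: "m \<in> C" "m x \<le> p x" "m y \<le> q y"
        proof
          assume "\<forall>x. p x \<le> q x" then show ?thesis using that[of p] p by simp
        next
          assume "\<forall>x. q x \<le> p x" then show ?thesis using that[of q] q by simp
        qed
        have "(INF p\<in>C. p (x + y)) \<le> m x + m y"
          using lower[OF m(1), of "x + y"] add[OF m(1), of x y] by linarith
        then show "(INF p\<in>C. p (x + y)) - q y \<le> p x" using m by linarith
      qed
      then show "(INF p\<in>C. p (x + y)) - (INF p\<in>C. p x) \<le> q y" by linarith
    qed
    then show "(INF p\<in>C. p (x + y)) \<le> (INF p\<in>C. p x) + (INF p\<in>C. p y)" by linarith
  next
    fix c :: real and x assume c: "0 < c"
    have "(INF p\<in>C. p (c *\<^sub>R x)) / c \<le> (INF p\<in>C. p x)"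
    proof (rule greatest)
      fix p assume p: "p \<in> C"
      show "(INF p\<in>C. p (c *\<^sub>R x)) / c \<le> p x"
        using lower[OF p, of "c *\<^sub>R x"] hom[OF p c, of x] c by (simp add: field_simps)
    qed
    moreover have "c * (INF p\<in>C. p x) \<le> (INF p\<in>C. p (c *\<^sub>R x))"
    proof (rule greatest)
      fix p assume p: "p \<in> C"
      show "c * (INF p\<in>C. p x) \<le> p (c *\<^sub>R x)"
        using mult_left_mono[OF lower[OF p, of x], of c] hom[OF p c, of x] c by simp
    qed
    ultimately show "(INF p\<in>C. p (c *\<^sub>R x)) = c * (INF p\<in>C. p x)"
      using c by (simp add: field_simps)
  next
    fix x
    obtain p where "p \<in> C" using \<open>C \<noteq> {}\<close> by blast
    then show "(INF p\<in>C. p x) \<le> N x" using lower[of p x] le[of p x] by linarith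
  qed
qed

lemma minimal_sublinear_linear:
  assumes p: "sublinear_below N p"
    and minimal: "\<And>q. sublinear_below N q \<Longrightarrow> (\<And>x. q x \<le> p x) \<Longrightarrow> q = p"
  shows "linear p"
proof -
  have add: "p (x + y) \<le> p x + p y" and hom: "0 < c \<Longrightarrow> p (c *\<^sub>R x) = c * p x" for x y c
    using p unfolding sublinear_below_def by blast+
  have odd: "p (- v) = - p v" for v
  proof -
    have "push_down p v = p" by (intro minimal push_down_props[OF p])
    then have "p (- v) \<le> - p v" using push_down_props(3)[OF p, of v] by simp
    moreover have "0 \<le> p v + p (- v)"
      using add[of v "- v"] sublinear_below_zero[OF p] by simp
    ultimately show ?thesis by linarith
  qed
  show ?thesis
  proof
    fix x y
    have "p (- x + - y) \<le> p (- x) + p (- y)" by (rule add)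
    then have "p (- (x + y)) \<le> p (- x) + p (- y)" by simp
    then show "p (x + y) = p x + p y" using add[of x y] unfolding odd by linarith
  next
    fix c :: real and x
    consider "c > 0" | "c = 0" | "c < 0" by linarith
    then show "p (c *\<^sub>R x) = c *\<^sub>R p x"
    proof cases
      case 3
      then have "p ((- c) *\<^sub>R x) = (- c) * p x" by (intro hom) simp
      then show ?thesis using odd[of "c *\<^sub>R x"] by simp
    qed (use hom sublinear_below_zero[OF p] in auto)
  qed
qed

text \<open>Pushing the norm down along v first makes every functional below \<open>p0\<close> at
  most \<open>- norm v\<close> at -v. A linear functional below \<open>p0\<close>, found as a
  minimal element, therefore attains the norm at v.\<close>

theorem real_Hahn_Banach_norming:
  fixes v :: "'a::real_normed_vector"
  obtains g :: "'a \<Rightarrow> real" where "linear g" "\<And>x. g x \<le> norm x" "g v = norm v"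
proof -
  define p0 where "p0 = push_down norm v"
  have N: "sublinear_below norm (norm :: 'a \<Rightarrow> real)"
    by (simp add: sublinear_below_def norm_triangle_ineq)
  have p0: "sublinear_below norm p0" "p0 (- v) \<le> - norm v"
    unfolding p0_def by (rule push_down_props[OF N])+
  have below: "sublinear_below norm q" if "sublinear_below p0 q" for q
    using that p0(1) unfolding sublinear_below_def by (meson order_trans)
  define A where "A = {q. sublinear_below p0 q}"
  have "\<exists>m\<in>A. \<forall>q\<in>A. (\<forall>x. q x \<le> m x) \<longrightarrow> q = m"
  proof -
    \<comment> \<open>The pointwise order is reversed, so that the maximal element supplied by
      Zorn's lemma is a minimal functional.\<close>
    define P where "P p q \<longleftrightarrow> (\<forall>x. q x \<le> p x)" for p q :: "'a \<Rightarrow> real"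
    have "\<exists>m\<in>A. \<forall>q\<in>A. P m q \<longrightarrow> q = m"
    proof (rule predicate_Zorn)
      show "partial_order_on A (relation_of P A)"
        by (rule partial_order_on_relation_ofI) (auto simp: P_def fun_eq_iff intro: order_trans order_antisym)
      fix C assume C: "C \<in> Chains (relation_of P A)"
      have CA: "q \<in> A" if "q \<in> C" for q
        using C that by (auto simp: Chains_def relation_of_def)
      have ch: "(\<forall>x. p x \<le> q x) \<or> (\<forall>x. q x \<le> p x)" if "p \<in> C" "q \<in> C" for p q
        using C that by (auto simp: Chains_def relation_of_def P_def)
      show "\<exists>u\<in>A. \<forall>q\<in>C. P q u"
      proof (cases "C = {}")
        case True
        then show ?thesis using p0(1) by (auto simp: A_def sublinear_below_def)
      next
        case False
        have sub: "sublinear_below p0 q" if "q \<in> C" for q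
          using CA[OF that] by (simp add: A_def)
        have "(\<lambda>x. INF p\<in>C. p x) \<in> A"
          unfolding A_def mem_Collect_eq by (rule sublinear_below_chain_Inf(1)[OF ch sub False])
        moreover have "P q (\<lambda>x. INF p\<in>C. p x)" if "q \<in> C" for q
          unfolding P_def using sublinear_below_chain_Inf(2)[OF ch sub False that] by blast
        ultimately show ?thesis by blast
      qed
    qed
    then show ?thesis unfolding P_def .
  qed
  then obtain g where g: "sublinear_below p0 g"
    and min: "\<And>q. sublinear_below p0 q \<Longrightarrow> (\<And>x. q x \<le> g x) \<Longrightarrow> q = g"
    unfolding A_def by blast
  have "linear g" by (rule minimal_sublinear_linear[OF g min])
  moreover have le: "g x \<le> norm x" for x
    using below[OF g] unfolding sublinear_below_def by blast
  moreover have "g v = norm v"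
  proof -
    have "g (- v) \<le> - norm v" using g p0(2) unfolding sublinear_below_def by (meson order_trans)
    then show ?thesis using le[of v] linear_neg[OF \<open>linear g\<close>, of v] by linarith
  qed
  ultimately show ?thesis by (rule that)
qed

lemma complex_Hahn_Banach_norming:
  fixes v :: "'a::complex_normed_vector"
  obtains y :: "'a cdual" where "norm y \<le> 1" "cblinfun_apply y v = norm v"
proof -
  obtain g where g: "linear g" "\<And>x. g x \<le> norm x" "g v = norm v"
    using real_Hahn_Banach_norming[of v] by blast
  note lin = linear_add[OF g(1)] linear_cmul[OF g(1)] linear_neg[OF g(1)] linear_diff[OF g(1)]
  \<comment> \<open>The complex-linear functional whose real part is \<open>g\<close>.\<close>
  define f where "f x = Complex (g x) (- g (\<i> *\<^sub>C x))" for x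
  have add: "f (x + z) = f x + f z" for x z
    by (simp add: f_def complex_eq_iff scaleC_add_right lin)
  have cmul: "f (c *\<^sub>C x) = c * f x" for c x
  proof -
    have c1: "c *\<^sub>C x = Re c *\<^sub>R x + Im c *\<^sub>R (\<i> *\<^sub>C x)"
      by (metis complex_eq scaleC_add_left scaleC_scaleC scaleR_scaleC mult.commute)
    have c2: "\<i> *\<^sub>C c *\<^sub>C x = Re c *\<^sub>R (\<i> *\<^sub>C x) + (- Im c) *\<^sub>R x"
      unfolding c1 scaleC_add_right scaleC_scaleR_commute scaleC_scaleC
      by (simp add: scaleR_scaleC scaleC_scaleC)
    have "g (c *\<^sub>C x) = Re c * g x + Im c * g (\<i> *\<^sub>C x)"
      unfolding c1 by (simp add: lin)
    moreover have "g (\<i> *\<^sub>C c *\<^sub>C x) = Re c * g (\<i> *\<^sub>C x) - Im c * g x"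
      unfolding c2 by (simp add: lin)
    ultimately show ?thesis by (simp add: f_def complex_eq_iff)
  qed
  have scaleR: "f (r *\<^sub>R x) = r *\<^sub>R f x" for r x
    using cmul[of "complex_of_real r" x] by (simp add: scaleR_scaleC scaleR_conv_of_real scaleC_complex_def)
  have bound: "cmod (f x) \<le> norm x" for x
  proof (cases "f x = 0")
    case False
    \<comment> \<open>Rotating x by the unimodular \<open>c\<close> makes the value of
      \<open>f\<close> real and nonnegative, where \<open>g\<close> controls it.\<close>
    define c where "c = cnj (f x) / cmod (f x)"
    have "cmod c = 1" using False by (simp add: c_def norm_divide)
    have "f (c *\<^sub>C x) = cmod (f x)"
      using False by (simp add: cmul c_def complex_norm_square[symmetric] mult.commute power2_eq_square)
    then have "cmod (f x) = g (c *\<^sub>C x)" by (simp add: f_def complex_eq_iff)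
    also have "\<dots> \<le> norm x" using g(2)[of "c *\<^sub>C x"] \<open>cmod c = 1\<close> by (simp add: norm_scaleC)
    finally show ?thesis .
  qed simp
  have "bounded_linear f"
    by (rule bounded_linear_intro[where K=1]) (simp_all add: add scaleR bound)
  moreover have "f (c *\<^sub>C x) = c *\<^sub>C f x" for c x by (simp add: cmul scaleC_complex_def)
  ultimately obtain y :: "'a cdual" where y: "cblinfun_apply y = f"
    using ex_cblinfun_apply[of f] by blast
  show ?thesis
  proof (rule that)
    show "norm y \<le> 1"
      unfolding norm_cblinfun.rep_eq
      by (rule norm_blinfun_bound) (use y bound in \<open>auto simp: cblinfun_apply.rep_eq\<close>)
    \<comment> \<open>The real part at v already exhausts the bound on the modulus, so the imaginary
      part vanishes.\<close>
    have "cmod (f v) \<le> norm v" "Re (f v) = norm v" using bound[of v] g(3) by (auto simp: f_def)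
    moreover have "(cmod (f v))\<^sup>2 = (Re (f v))\<^sup>2 + (Im (f v))\<^sup>2" by (rule cmod_power2)
    moreover have "(cmod (f v))\<^sup>2 \<le> (norm v)\<^sup>2" by (rule power_mono[OF bound]) simp
    ultimately have "Im (f v) = 0" by simp
    with \<open>Re (f v) = norm v\<close> show "cblinfun_apply y v = norm v"
      by (simp add: y complex_eq_iff)
  qed
qed

text \<open>The way back from scalar pairings to the operator norm; it allows all contour integrals
  to be scalar.\<close>

lemma cblinfun_norm_bound_weak:
  fixes H :: "('a::complex_normed_vector, 'a) cblinfun"
  assumes "\<And>x (y :: 'a cdual). cmod (cblinfun_apply y (cblinfun_apply H x)) \<le> K * norm x * norm y"
    and "0 \<le> K"
  shows "norm H \<le> K"
  unfolding norm_cblinfun.rep_eq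
proof (rule norm_blinfun_bound[OF \<open>0 \<le> K\<close>])
  fix x
  obtain y :: "'a cdual" where y: "norm y \<le> 1" "cblinfun_apply y (cblinfun_apply H x) = norm (cblinfun_apply H x)"
    by (rule complex_Hahn_Banach_norming[of "cblinfun_apply H x"])
  have "norm (cblinfun_apply H x) \<le> K * norm x * norm y"
    using assms(1)[of y x] y(2) by simp
  also have "\<dots> \<le> K * norm x" using mult_left_mono[OF y(1), of "K * norm x"] \<open>0 \<le> K\<close> by simp
  finally show "norm (blinfun_apply (blinfun_of_cblinfun H) x) \<le> K * norm x"
    by (simp add: cblinfun_apply.rep_eq)
qed

section \<open>The domains \<open>E\<^sub>u\<close> and their boundaries\<close>

text \<open>In a convex combination that involves two vertices, mass on both can be exchanged for
  mass on a point of B between them until one vertex is used up. Hence the hull is a union of cones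
  with a single vertex each.\<close>

lemma convex_hull_insert_finite_cover:
  fixes E :: "'a::real_vector set"
  assumes "finite E" "E \<noteq> {}" "convex B" "B \<noteq> {}"
    and "\<And>\<xi> \<eta>. \<xi> \<in> E \<Longrightarrow> \<eta> \<in> E \<Longrightarrow> \<xi> \<noteq> \<eta> \<Longrightarrow> closed_segment \<xi> \<eta> \<inter> B \<noteq> {}"
    and "z \<in> convex hull (E \<union> B)"
  shows "\<exists>\<xi>\<in>E. z \<in> convex hull (insert \<xi> B)"
  using assms(1,2,5,6)
proof (induction arbitrary: z rule: finite_ne_induct)
  case (singleton \<xi>)
  then show ?case by simp
next
  case (insert \<xi> E)
  have three: "a *\<^sub>R x + b *\<^sub>R y + c *\<^sub>R w \<in> convex hull S"
    if "x \<in> S" "y \<in> S" "w \<in> S" "0 \<le> a" "0 \<le> b" "0 \<le> c" "a + b + c = 1"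
    for a b c :: real and x y w :: 'a and S
  proof -
    have "a *\<^sub>R x + b *\<^sub>R y + c *\<^sub>R w \<in> convex hull {x, y, w}"
      unfolding convex_hull_3 using that by blast
    also have "\<dots> \<subseteq> convex hull S" using that by (intro hull_mono) auto
    finally show ?thesis .
  qed
  have "insert \<xi> E \<union> B = insert \<xi> (E \<union> B)" by auto
  then obtain a v w where z: "0 \<le> a" "0 \<le> v" "a + v = 1" "w \<in> convex hull (E \<union> B)"
      "z = a *\<^sub>R \<xi> + v *\<^sub>R w"
    using insert.prems(2) convex_hull_insert[of "E \<union> B" \<xi>] \<open>B \<noteq> {}\<close> by auto
  then obtain \<eta> where \<eta>: "\<eta> \<in> E" "w \<in> convex hull (insert \<eta> B)"
    using insert.IH[OF insert.prems(1)] by (meson insertI2)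
  then obtain p q b where w: "0 \<le> p" "0 \<le> q" "p + q = 1" "b \<in> B" "w = p *\<^sub>R \<eta> + q *\<^sub>R b"
    unfolding convex_hull_insert[OF \<open>B \<noteq> {}\<close>] hull_same[of convex, OF \<open>convex B\<close>] by blast
  have "\<xi> \<noteq> \<eta>" using \<eta>(1) insert.hyps by blast
  then have "closed_segment \<xi> \<eta> \<inter> B \<noteq> {}" using insert.prems(1) \<eta>(1) by blast
  then obtain c where c_seg: "c \<in> B" "c \<in> closed_segment \<xi> \<eta>" by blast
  then obtain t where c: "c \<in> B" "0 \<le> t" "t \<le> 1" "c = (1 - t) *\<^sub>R \<xi> + t *\<^sub>R \<eta>"
    unfolding in_segment by blast
  define d e where "d = v * p" and "e = v * q"
  have z': "z = a *\<^sub>R \<xi> + d *\<^sub>R \<eta> + e *\<^sub>R b" and de: "0 \<le> d" "0 \<le> e"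
    using z w by (simp_all add: d_def e_def algebra_simps)
  have "d + e = v * (p + q)" unfolding d_def e_def by algebra
  then have sum: "a + d + e = 1" using z(3) w(3) by simp
  show ?case
  \<comment> \<open>Putting mass \<open>f\<close> on \<open>c\<close> takes f (1 - t) from the
    weight of \<xi> and f t from that of \<eta>. The case distinction says which weight reaches 0
    first.\<close>
  proof (cases "(1 - t) * d \<le> t * a")
    case True
    have "z \<in> convex hull (insert \<xi> B)"
    proof (cases "t = 0")
      case True
      with \<open>(1 - t) * d \<le> t * a\<close> de have "d = 0" by simp
      then have "z = a *\<^sub>R \<xi> + 0 *\<^sub>R \<xi> + e *\<^sub>R b" using z' by simp
      then show ?thesis using three[of \<xi> "insert \<xi> B" \<xi> b a 0 e] z(1) de sum \<open>d = 0\<close> w(4) by simp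
    next
      case False
      define f where "f = d / t"
      have "0 \<le> f" using de c by (simp add: f_def)
      have d: "d = f * t" using False by (simp add: f_def)
      have pos: "0 \<le> a - f * (1 - t)"
        using True False c unfolding f_def by (simp add: field_simps)
      have "z = (a - f * (1 - t)) *\<^sub>R \<xi> + f *\<^sub>R c + e *\<^sub>R b"
        unfolding z' c(4) d by (simp add: algebra_simps)
      also have "\<dots> \<in> convex hull (insert \<xi> B)"
      proof (rule three)
        show "a - f * (1 - t) + f + e = 1" using sum d by (simp add: algebra_simps)
      qed (use pos \<open>0 \<le> f\<close> de c(1) w(4) in auto)
      finally show ?thesis .
    qed
    then show ?thesis by blast
  next
    case False
    then have "t * a < (1 - t) * d" by simp
    moreover have "0 \<le> t * a" using c z by simp
    ultimately have "t \<noteq> 1" by auto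
    define f where "f = a / (1 - t)"
    have "0 \<le> f" using z c by (simp add: f_def)
    have a: "a = f * (1 - t)" using \<open>t \<noteq> 1\<close> by (simp add: f_def)
    have pos: "0 \<le> d - f * t"
      using False c \<open>t \<noteq> 1\<close> unfolding f_def by (simp add: field_simps)
    have "z = (d - f * t) *\<^sub>R \<eta> + f *\<^sub>R c + e *\<^sub>R b"
      unfolding z' c(4) a by (simp add: algebra_simps)
    also have "\<dots> \<in> convex hull (insert \<eta> B)"
    proof (rule three)
      show "d - f * t + f + e = 1" using sum a by (simp add: algebra_simps)
    qed (use pos \<open>0 \<le> f\<close> de c(1) w(4) in auto)
    finally have "z \<in> convex hull (insert \<eta> B)" .
    then show ?thesis using \<eta>(1) by blast
  qed
qed

section \<open>Chords, angles and the boundary of a single cone\<close>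

text \<open>Up to \<pi>/3 the mean value theorem applies, as the cosine is at least 1/2 there;
  beyond, the sine is at least sqrt 3 / 2, which exceeds \<pi>/4.\<close>

lemma half_le_sin:
  assumes "0 \<le> x" "x \<le> pi / 2"
  shows "x / 2 \<le> sin (x::real)"
proof (cases "x \<le> pi / 3")
  case True
  show ?thesis
  proof (cases "x = 0")
    case False
    then have "0 < x" using assms by simp
    have "\<exists>c>0. c < x \<and> sin x - sin 0 = (x - 0) * cos c"
      by (rule MVT2) (use \<open>0 < x\<close> in \<open>auto intro!: derivative_eq_intros\<close>)
    then obtain c where c: "0 < c" "c < x" "sin x = x * cos c" by auto
    have "cos (pi / 3) \<le> cos c" by (rule cos_monotone_0_pi_le) (use c True pi_gt_zero in auto)
    then show ?thesis using c \<open>0 < x\<close> by (simp add: cos_60)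
  qed simp
next
  case False
  have "sin (pi / 3) \<le> sin x" by (rule sin_monotone_2pi_le) (use False assms pi_gt_zero in auto)
  moreover have "1.7 \<le> sqrt (3::real)" by (rule real_le_rsqrt) (simp add: power2_eq_square)
  moreover have "pi < 3.2" using pi_approx by simp
  ultimately show ?thesis using assms by (simp add: sin_60)
qed

lemma cmod_cis_diff: "cmod (cis a - cis b) = 2 * \<bar>sin ((a - b) / 2)\<bar>"
proof -
  have "(cmod (cis a - cis b))\<^sup>2 = (cos a - cos b)\<^sup>2 + (sin a - sin b)\<^sup>2"
    by (simp add: cmod_power2)
  also have "\<dots> = ((cos a)\<^sup>2 + (sin a)\<^sup>2) + ((cos b)\<^sup>2 + (sin b)\<^sup>2) - 2 * (cos a * cos b + sin a * sin b)"
    by (simp add: power2_eq_square algebra_simps)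
  also have "\<dots> = 2 - 2 * cos (a - b)"
    by (simp add: cos_diff)
  also have "cos (a - b) = 1 - 2 * (sin ((a - b) / 2))\<^sup>2"
  proof -
    have "2 * ((a - b) / 2) = a - b" by simp
    then show ?thesis using cos_double_sin[of "(a - b) / 2"] by (simp only:)
  qed
  also have "2 - 2 * (1 - 2 * (sin ((a - b) / 2))\<^sup>2) = (2 * \<bar>sin ((a - b) / 2)\<bar>)\<^sup>2"
    by (simp add: power_mult_distrib)
  finally show ?thesis by (rule power2_eq_imp_eq) auto
qed

text \<open>A chord controls the shorter arc. If the angles differ by more than \<pi>, that arc
  leads to a copy of \<open>a\<close> shifted by 2 \<pi>, hence the three candidates.\<close>

lemma angle_le_cis_dist:
  assumes "\<bar>a - b\<bar> \<le> 2 * pi"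
  shows "\<exists>p\<in>{a - 2 * pi, a, a + 2 * pi}. \<bar>b - p\<bar> \<le> 2 * cmod (cis a - cis b)"
proof -
  define \<phi> where "\<phi> = \<bar>a - b\<bar>"
  have "\<bar>sin ((a - b) / 2)\<bar> = \<bar>sin (\<phi> / 2)\<bar>"
  proof -
    have "(a - b) / 2 = \<phi> / 2 \<or> (a - b) / 2 = - (\<phi> / 2)" by (auto simp: \<phi>_def)
    then show ?thesis by (metis abs_minus_cancel sin_minus)
  qed
  also have "\<dots> = sin (\<phi> / 2)"
    using assms by (intro abs_of_nonneg sin_ge_zero) (auto simp: \<phi>_def)
  finally have n: "cmod (cis a - cis b) = 2 * sin (\<phi> / 2)" by (simp add: cmod_cis_diff)
  show ?thesis
  proof (cases "\<phi> \<le> pi")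
    case True
    then have "\<phi> / 2 / 2 \<le> sin (\<phi> / 2)" by (intro half_le_sin) (auto simp: \<phi>_def)
    then have "\<bar>b - a\<bar> \<le> 2 * cmod (cis a - cis b)" unfolding n by (simp add: \<phi>_def abs_minus_commute)
    then show ?thesis by simp
  next
    case False
    then have "(pi - \<phi> / 2) / 2 \<le> sin (pi - \<phi> / 2)" using assms by (intro half_le_sin) (auto simp: \<phi>_def)
    then have "2 * pi - \<phi> \<le> 2 * cmod (cis a - cis b)" unfolding n by simp
    then show ?thesis using assms by (cases "a \<ge> b") (auto simp: \<phi>_def)
  qed
qed

text \<open>Radius, in the direction \<open>cis \<theta>\<close>, of the convex hull of \<open>\<xi>\<close> and the disc of radius \<open>u\<close>,
  as a function of \<open>\<zeta> = cnj \<xi> * cis \<theta>\<close>: away from the disc the boundary is the tangent line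
  through \<open>\<xi>\<close>, with unit normal \<open>\<xi> * (u \<plusminus> \<i> sqrt (1 - u\<^sup>2))\<close>.\<close>

definition cone_radius :: "real \<Rightarrow> complex \<Rightarrow> real"
  where "cone_radius u \<zeta> =
    (if Re \<zeta> \<le> u then u else u / (u * Re \<zeta> + sqrt (1 - u\<^sup>2) * \<bar>Im \<zeta>\<bar>))"

text \<open>The denominator is the inner product of two unit vectors, \<zeta> (up to conjugation)
  and the tangent normal. Their squared distance is twice the gap between it and 1, which gives the
  upper bound.\<close>

lemma cone_radius_denom:
  assumes u: "0 < u" "u < 1" and "cmod \<zeta> = 1" "u \<le> Re \<zeta>"
  shows "u\<^sup>2 \<le> u * Re \<zeta> + sqrt (1 - u\<^sup>2) * \<bar>Im \<zeta>\<bar>"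
    and "u * Re \<zeta> + sqrt (1 - u\<^sup>2) * \<bar>Im \<zeta>\<bar> \<le> 1"
    and "\<bar>Im \<zeta>\<bar> \<le> sqrt (1 - u\<^sup>2)"
proof -
  have u2: "u\<^sup>2 \<le> 1" using u by (simp add: power_le_one)
  have z2: "(Re \<zeta>)\<^sup>2 + (Im \<zeta>)\<^sup>2 = 1" using assms(3) by (simp add: cmod_def)
  have "u * u \<le> u * Re \<zeta>" using u assms(4) by (intro mult_left_mono) auto
  moreover have "0 \<le> sqrt (1 - u\<^sup>2) * \<bar>Im \<zeta>\<bar>" using u2 by simp
  ultimately show "u\<^sup>2 \<le> u * Re \<zeta> + sqrt (1 - u\<^sup>2) * \<bar>Im \<zeta>\<bar>"
    unfolding power2_eq_square by linarith
  have "0 \<le> (u - Re \<zeta>)\<^sup>2 + (sqrt (1 - u\<^sup>2) - \<bar>Im \<zeta>\<bar>)\<^sup>2" by simp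
  also have "\<dots> = 2 - 2 * (u * Re \<zeta> + sqrt (1 - u\<^sup>2) * \<bar>Im \<zeta>\<bar>)"
    using z2 u2 by (simp add: power2_diff)
  finally show "u * Re \<zeta> + sqrt (1 - u\<^sup>2) * \<bar>Im \<zeta>\<bar> \<le> 1" by simp
  have "u\<^sup>2 \<le> (Re \<zeta>)\<^sup>2" using u assms(4) by (intro power_mono) auto
  then show "\<bar>Im \<zeta>\<bar> \<le> sqrt (1 - u\<^sup>2)" using z2 by (intro real_le_rsqrt) simp
qed

lemma cone_radius_ge:
  assumes "0 < u" "u < 1" "cmod \<zeta> = 1"
  shows "u \<le> cone_radius u \<zeta>"
proof (cases "Re \<zeta> \<le> u")
  case False
  then have "u \<le> Re \<zeta>" by simp
  note d = cone_radius_denom[OF assms this]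
  have "0 < u\<^sup>2" using assms by simp
  then have "0 < u * Re \<zeta> + sqrt (1 - u\<^sup>2) * \<bar>Im \<zeta>\<bar>" using d(1) by linarith
  then show ?thesis using False d(2) assms(1) mult_left_mono[OF d(2), of u]
    unfolding cone_radius_def by (simp add: pos_le_divide_eq)
qed (simp add: cone_radius_def)

text \<open>Half-planes bound the cone from outside: the projection on a unit vector \<nu> is
  largest at the vertex or on the disc. Away from the vertex \<nu> = \<zeta> suffices; near it \<nu>
  is the tangent normal.\<close>

lemma le_cone_radius:
  assumes u: "0 < u" "u < 1" and \<xi>: "cmod \<xi> = 1" and l: "0 \<le> l" "l \<le> 1" and b: "cmod b \<le> u"
    and eq: "of_real \<rho> * cis \<theta> = l *\<^sub>R \<xi> + (1 - l) *\<^sub>R b"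
  shows "\<rho> \<le> cone_radius u (cnj \<xi> * cis \<theta>)"
proof -
  define \<zeta> where "\<zeta> = cnj \<xi> * cis \<theta>"
  define b' where "b' = cnj \<xi> * b"
  have b': "cmod b' \<le> u" using b \<xi> by (simp add: b'_def norm_mult)
  have \<zeta>1: "cmod \<zeta> = 1" using \<xi> by (simp add: \<zeta>_def norm_mult)
  have "cnj \<xi> * \<xi> = 1" using \<xi> by (simp add: complex_norm_square[symmetric] mult.commute)
  have eq': "of_real \<rho> * \<zeta> = of_real l + of_real (1 - l) * b'"
  proof -
    have "of_real \<rho> * \<zeta> = cnj \<xi> * (of_real \<rho> * cis \<theta>)" by (simp add: \<zeta>_def)
    also have "\<dots> = of_real l * (cnj \<xi> * \<xi>) + of_real (1 - l) * b'"
      unfolding eq b'_def by (simp add: scaleR_conv_of_real algebra_simps)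
    finally show ?thesis using \<open>cnj \<xi> * \<xi> = 1\<close> by simp
  qed
  have support: "\<rho> * Re (cnj \<nu> * \<zeta>) \<le> l * Re \<nu> + (1 - l) * u" if "cmod \<nu> = 1" for \<nu>
  proof -
    have "\<rho> * Re (cnj \<nu> * \<zeta>) = Re (cnj \<nu> * (of_real \<rho> * \<zeta>))" by (simp add: algebra_simps)
    also have "\<dots> = l * Re \<nu> + (1 - l) * Re (cnj \<nu> * b')"
      unfolding eq' by (simp add: algebra_simps)
    also have "Re (cnj \<nu> * b') \<le> u"
      using complex_Re_le_cmod[of "cnj \<nu> * b'"] b' that by (simp add: norm_mult)
    then have "l * Re \<nu> + (1 - l) * Re (cnj \<nu> * b') \<le> l * Re \<nu> + (1 - l) * u"
      using l by (intro add_left_mono mult_left_mono) auto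
    finally show ?thesis .
  qed
  show ?thesis
  proof (cases "Re \<zeta> \<le> u")
    case True
    have "Re (cnj \<zeta> * \<zeta>) = 1"
      using \<zeta>1 by (simp add: cmod_def power2_eq_square)
    then have "\<rho> \<le> l * Re \<zeta> + (1 - l) * u" using support[OF \<zeta>1] by (simp only: mult_1_right)
    moreover have "l * Re \<zeta> \<le> l * u" using True l by (intro mult_left_mono) auto
    ultimately have "\<rho> \<le> u" by (simp add: algebra_simps)
    then show ?thesis using True by (simp add: cone_radius_def \<zeta>_def)
  next
    case False
    define w where "w = sqrt (1 - u\<^sup>2)"
    have w2: "u\<^sup>2 + w\<^sup>2 = 1" using u by (simp add: w_def power_le_one)
    \<comment> \<open>The tangent normal on the side of \<zeta>. Its real part is \<open>u\<close>,
      so the vertex 1 and the disc obey the same bound \<open>u\<close>.\<close>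
    define \<nu> where "\<nu> = Complex u (if Im \<zeta> \<ge> 0 then w else - w)"
    have "cmod \<nu> = 1" using w2 by (simp add: \<nu>_def cmod_def)
    from support[OF this] have "\<rho> * (u * Re \<zeta> + w * \<bar>Im \<zeta>\<bar>) \<le> u"
      by (auto simp: \<nu>_def algebra_simps split: if_splits)
    moreover have "0 < u * Re \<zeta> + w * \<bar>Im \<zeta>\<bar>"
    proof -
      have "u \<le> Re \<zeta>" "0 < u\<^sup>2" using False u by auto
      then show ?thesis using cone_radius_denom(1)[OF u \<zeta>1] unfolding w_def by linarith
    qed
    ultimately show ?thesis
      using False by (simp add: cone_radius_def pos_le_divide_eq flip: w_def \<zeta>_def)
  qed
qed

lemma cone_radius_attained:
  assumes u: "0 < u" "u < 1" and \<xi>: "cmod \<xi> = 1"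
  shows "of_real (cone_radius u (cnj \<xi> * cis \<theta>)) * cis \<theta> \<in> convex hull (insert \<xi> (cball 0 u))"
proof -
  define \<zeta> where "\<zeta> = cnj \<xi> * cis \<theta>"
  have \<zeta>1: "cmod \<zeta> = 1" using \<xi> by (simp add: \<zeta>_def norm_mult)
  have "\<xi> * cnj \<xi> = 1" using \<xi> by (simp add: complex_norm_square[symmetric])
  then have c: "cis \<theta> = \<xi> * \<zeta>" by (simp add: \<zeta>_def flip: mult.assoc)
  show ?thesis
  proof (cases "Re \<zeta> \<le> u")
    case True
    have "of_real u * cis \<theta> \<in> cball 0 u" using u by (simp add: norm_mult)
    then show ?thesis using True by (auto simp: cone_radius_def intro: hull_inc simp flip: \<zeta>_def)
  next
    case False
    then have uR: "u \<le> Re \<zeta>" by simp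
    define w where "w = sqrt (1 - u\<^sup>2)"
    have w2: "w\<^sup>2 = 1 - u\<^sup>2" using u by (simp add: w_def power_le_one)
    have "0 < w" using u by (simp add: w_def power_less_one_iff abs_square_less_1)
    define D where "D = u * Re \<zeta> + w * \<bar>Im \<zeta>\<bar>"
    note d = cone_radius_denom[OF u \<zeta>1 uR, folded w_def, folded D_def]
    have "0 < u\<^sup>2" using u by simp
    then have "0 < D" using d(1) by linarith
    \<comment> \<open>The weight of the point of contact \<open>u * \<nu>\<close> in its combination
      with the vertex 1, forced by comparing imaginary parts. That \<open>m\<close> is at most 1
      means that the ray meets the tangent between the vertex and the point of contact.\<close>
    define m where "m = \<bar>Im \<zeta>\<bar> / (D * w)"
    have "0 \<le> m" using \<open>0 < D\<close> \<open>0 < w\<close> by (simp add: m_def)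
    have "\<bar>Im \<zeta>\<bar> \<le> D * w"
    proof -
      have "u * \<bar>Im \<zeta>\<bar> \<le> w * Re \<zeta>" using uR d(3) \<open>0 < w\<close> u
        by (smt (verit, best) mult.commute mult_mono abs_ge_zero)
      then have "u * (u * \<bar>Im \<zeta>\<bar>) \<le> u * (w * Re \<zeta>)" using u by (intro mult_left_mono) auto
      moreover have "D * w = u * (w * Re \<zeta>) + (1 - u\<^sup>2) * \<bar>Im \<zeta>\<bar>"
        unfolding D_def by (simp add: algebra_simps flip: w2) (simp add: power2_eq_square)
      ultimately show ?thesis by (simp add: power2_eq_square algebra_simps)
    qed
    then have "m \<le> 1" using \<open>0 < D\<close> \<open>0 < w\<close> by (simp add: m_def)
    define \<nu> where "\<nu> = Complex u (if Im \<zeta> \<ge> 0 then w else - w)"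
    have "cmod \<nu> = 1" using w2 by (simp add: \<nu>_def cmod_def)
    have "of_real (u / D) * \<zeta> = of_real (1 - m) + of_real m * (of_real u * \<nu>)"
    proof (rule complex_eqI)
      have "u * Re \<zeta> = D - w * \<bar>Im \<zeta>\<bar>" by (simp add: D_def)
      then have "u / D * Re \<zeta> = 1 - w * \<bar>Im \<zeta>\<bar> / D"
        using \<open>0 < D\<close> by (simp add: field_simps)
      also have "\<dots> = 1 - m * w\<^sup>2" using \<open>0 < w\<close> by (simp add: m_def power2_eq_square)
      also have "\<dots> = 1 - m + m * (u * u)" unfolding w2 by (simp add: power2_eq_square algebra_simps)
      finally show "Re (of_real (u / D) * \<zeta>) = Re (of_real (1 - m) + of_real m * (of_real u * \<nu>))"
        by (simp add: \<nu>_def)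
      show "Im (of_real (u / D) * \<zeta>) = Im (of_real (1 - m) + of_real m * (of_real u * \<nu>))"
        using \<open>0 < w\<close> \<open>0 < D\<close> by (auto simp: \<nu>_def m_def field_simps)
    qed
    from arg_cong[OF this, of "times \<xi>"]
    have "of_real (u / D) * cis \<theta> = (1 - m) *\<^sub>R \<xi> + m *\<^sub>R (\<xi> * (of_real u * \<nu>))"
      unfolding c by (simp add: scaleR_conv_of_real algebra_simps)
    moreover have "\<xi> * (of_real u * \<nu>) \<in> cball 0 u"
      using \<xi> \<open>cmod \<nu> = 1\<close> u by (simp add: norm_mult)
    then have "\<xi> * (of_real u * \<nu>) \<in> convex hull (insert \<xi> (cball 0 u))"
      by (intro hull_inc) blast
    moreover have "\<xi> \<in> convex hull (insert \<xi> (cball 0 u))" by (intro hull_inc) blast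
    ultimately have "of_real (u / D) * cis \<theta> \<in> convex hull (insert \<xi> (cball 0 u))"
      using \<open>0 \<le> m\<close> \<open>m \<le> 1\<close> convexD[OF convex_convex_hull, of \<xi> "insert \<xi> (cball 0 u)" "\<xi> * (of_real u * \<nu>)" "1 - m" m]
      by simp
    then show ?thesis using False by (simp add: cone_radius_def D_def w_def flip: \<zeta>_def)
  qed
qed

section \<open>Geometry of \<open>E_dom\<close> and its boundary in polar coordinates\<close>

locale peripheral_set =
  fixes \<xi>s :: "complex list" and r :: real
  assumes nonempty: "\<xi>s \<noteq> []" and on_circle: "set \<xi>s \<subseteq> sphere 0 1"
    and r_pos: "0 < r" and r_less_1: "r < 1" and large: "E_large_enough \<xi>s r"
begin

lemma cmod_xi: "\<xi> \<in> set \<xi>s \<Longrightarrow> cmod \<xi> = 1"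
  using on_circle by auto

lemma xi_cnj: "\<xi> \<in> set \<xi>s \<Longrightarrow> \<xi> * cnj \<xi> = 1"
  using cmod_xi by (simp add: complex_norm_square[symmetric])

lemma open_E_dom: "open (E_dom \<xi>s u)"
  by (simp add: E_dom_def)

lemma convex_E_dom: "convex (E_dom \<xi>s u)"
  by (simp add: E_dom_def convex_interior)

lemma ball_subset_E_dom: "ball 0 u \<subseteq> E_dom \<xi>s u"
  unfolding E_dom_def by (rule interior_maximal) (auto intro: hull_inc)

lemma zero_in_E_dom: "0 < u \<Longrightarrow> 0 \<in> E_dom \<xi>s u"
  using ball_subset_E_dom[of u] by (simp add: subset_iff)

lemma E_dom_mono: "u \<le> s \<Longrightarrow> E_dom \<xi>s u \<subseteq> E_dom \<xi>s s"
  unfolding E_dom_def by (intro interior_mono hull_mono) auto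

lemma closure_E_dom: "0 < u \<Longrightarrow> closure (E_dom \<xi>s u) = closure (convex hull (set \<xi>s \<union> ball 0 u))"
  unfolding E_dom_def
  by (rule convex_closure_interior) (use zero_in_E_dom[of u] in \<open>auto simp: E_dom_def\<close>)

lemma E_dom_subset_ball: "s \<le> 1 \<Longrightarrow> E_dom \<xi>s s \<subseteq> ball 0 1"
proof -
  assume "s \<le> 1"
  then have "convex hull (set \<xi>s \<union> ball 0 s) \<subseteq> cball 0 1"
    using cmod_xi by (intro hull_minimal convex_cball) auto
  then have "interior (convex hull (set \<xi>s \<union> ball 0 s)) \<subseteq> interior (cball 0 1)"
    by (rule interior_mono)
  then show ?thesis by (simp add: E_dom_def)
qed

text \<open>0 is an interior point of a convex set, so moving a point of the closure toward 0 makes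
  it interior. All dilations of the contour rest on this.\<close>

lemma shrink_in_E_dom:
  assumes "0 < u" "z \<in> closure (E_dom \<xi>s u)" "0 \<le> t" "t < 1"
  shows "of_real t * z \<in> E_dom \<xi>s u"
proof -
  have "z - (1 - t) *\<^sub>R (z - 0) \<in> interior (convex hull (set \<xi>s \<union> ball 0 u))"
  proof (rule mem_interior_closure_convex_shrink)
    show "z \<in> closure (convex hull (set \<xi>s \<union> ball 0 u))"
      using assms(1,2) by (simp add: closure_E_dom)
    show "0 \<in> interior (convex hull (set \<xi>s \<union> ball 0 u))"
      using zero_in_E_dom[OF assms(1)] by (simp add: E_dom_def)
  qed (use assms in auto)
  moreover have "z - (1 - t) *\<^sub>R (z - 0) = of_real t * z"
    by (simp add: scaleR_conv_of_real algebra_simps)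
  ultimately show ?thesis by (simp add: E_dom_def)
qed

lemma cone_point_in_E_dom:
  assumes "\<xi> \<in> set \<xi>s" "0 \<le> l" "l < 1" "cmod b < s"
  shows "l *\<^sub>R \<xi> + (1 - l) *\<^sub>R b \<in> E_dom \<xi>s s"
proof -
  have "\<xi> - (1 - l) *\<^sub>R (\<xi> - b) \<in> interior (convex hull (set \<xi>s \<union> ball 0 s))"
  proof (rule mem_interior_closure_convex_shrink[OF convex_convex_hull])
    show "b \<in> interior (convex hull (set \<xi>s \<union> ball 0 s))"
      using ball_subset_E_dom[of s] assms(4) by (auto simp: E_dom_def)
    show "\<xi> \<in> closure (convex hull (set \<xi>s \<union> ball 0 s))"
      using assms(1) by (intro closure_subset[THEN subsetD] hull_inc) auto
  qed (use assms in auto)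
  moreover have "\<xi> - (1 - l) *\<^sub>R (\<xi> - b) = l *\<^sub>R \<xi> + (1 - l) *\<^sub>R b"
    by (simp add: algebra_simps)
  ultimately show ?thesis by (simp add: E_dom_def)
qed

text \<open>Largeness of \<open>r\<close> enters here, through
  \<open>convex_hull_insert_finite_cover\<close>: each point lies in one cone, and \<open>l\<close>
  alone measures its position between vertex and disc.\<close>

lemma closure_E_dom_cone:
  assumes "r \<le> u" "z \<in> closure (E_dom \<xi>s u)"
  obtains \<xi> l b where "\<xi> \<in> set \<xi>s" "0 \<le> l" "l \<le> 1" "cmod b \<le> u" "z = l *\<^sub>R \<xi> + (1 - l) *\<^sub>R b"
proof -
  have u: "0 < u" using assms(1) r_pos by simp
  have "compact (convex hull (set \<xi>s \<union> cball 0 u))"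
    by (simp add: compact_convex_hull compact_Un finite_imp_compact)
  then have "closure (convex hull (set \<xi>s \<union> ball 0 u)) \<subseteq> convex hull (set \<xi>s \<union> cball 0 u)"
    by (intro closure_minimal hull_mono compact_imp_closed) auto
  then have "z \<in> convex hull (set \<xi>s \<union> cball 0 u)"
    using assms(2) closure_E_dom[OF u] by blast
  then have "\<exists>\<xi>\<in>set \<xi>s. z \<in> convex hull (insert \<xi> (cball 0 u))"
  proof (rule convex_hull_insert_finite_cover[rotated -1])
    fix \<xi> \<eta> assume "\<xi> \<in> set \<xi>s" "\<eta> \<in> set \<xi>s" "\<xi> \<noteq> \<eta>"
    then have "closed_segment \<xi> \<eta> \<inter> ball 0 r \<noteq> {}"
      using large unfolding E_large_enough_def by blast
    moreover have "ball 0 r \<subseteq> cball (0::complex) u" using assms(1) by auto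
    ultimately show "closed_segment \<xi> \<eta> \<inter> cball 0 u \<noteq> {}" by blast
  qed (use nonempty u in auto)
  then obtain \<xi> where \<xi>: "\<xi> \<in> set \<xi>s" "z \<in> convex hull (insert \<xi> (cball 0 u))" by blast
  have ne: "cball (0::complex) u \<noteq> {}" using u by auto
  from \<xi>(2) obtain l v b where *: "0 \<le> l" "0 \<le> v" "l + v = 1" "b \<in> cball 0 u" "z = l *\<^sub>R \<xi> + v *\<^sub>R b"
    unfolding convex_hull_insert[OF ne] hull_same[of convex, OF convex_cball] by blast
  have "v = 1 - l" using *(3) by simp
  then show ?thesis using * \<xi>(1) by (intro that[of \<xi> l b]) auto
qed

text \<open>Enlarging the disc makes every point of a cone interior except the vertex itself, which
  is the case l = 1.\<close>

lemma closure_E_dom_subset: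
  assumes "r \<le> u" "u < s"
  shows "closure (E_dom \<xi>s u) \<subseteq> set \<xi>s \<union> E_dom \<xi>s s"
proof
  fix z assume "z \<in> closure (E_dom \<xi>s u)"
  then obtain \<xi> l b where *: "\<xi> \<in> set \<xi>s" "0 \<le> l" "l \<le> 1" "cmod b \<le> u" "z = l *\<^sub>R \<xi> + (1 - l) *\<^sub>R b"
    using closure_E_dom_cone[OF assms(1)] by blast
  show "z \<in> set \<xi>s \<union> E_dom \<xi>s s"
  proof (cases "l = 1")
    case False
    then show ?thesis using * assms cone_point_in_E_dom[of \<xi> l b s] by auto
  qed (use * in auto)
qed

text \<open>The Stolz angle condition: in a cone with parameter l the distance to the vertex is at
  most 2 (1 - l), whereas 1 - |z| is at least (1 - u) (1 - l).\<close>

lemma stolz: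
  assumes "r \<le> u" "u < 1" "z \<in> closure (E_dom \<xi>s u)"
  obtains \<xi> where "\<xi> \<in> set \<xi>s" "(1 - u) * cmod (\<xi> - z) \<le> 2 * (1 - cmod z)"
proof -
  obtain \<xi> l b where *: "\<xi> \<in> set \<xi>s" "0 \<le> l" "l \<le> 1" "cmod b \<le> u" "z = l *\<^sub>R \<xi> + (1 - l) *\<^sub>R b"
    using closure_E_dom_cone[OF assms(1,3)] by blast
  have "\<xi> - z = (1 - l) *\<^sub>R (\<xi> - b)" unfolding *(5) by (simp add: algebra_simps)
  then have "cmod (\<xi> - z) = (1 - l) * cmod (\<xi> - b)" using * by simp
  also have "\<dots> \<le> (1 - l) * 2"
    using * assms cmod_xi norm_triangle_ineq4[of \<xi> b] by (intro mult_left_mono) auto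
  finally have 1: "cmod (\<xi> - z) \<le> 2 * (1 - l)" by simp
  have "cmod z \<le> cmod (l *\<^sub>R \<xi>) + cmod ((1 - l) *\<^sub>R b)" unfolding *(5) by (rule norm_triangle_ineq)
  also have "\<dots> \<le> l + (1 - l) * u" using * cmod_xi by (auto intro: mult_left_mono)
  finally have 2: "(1 - u) * (1 - l) \<le> 1 - cmod z" by (simp add: algebra_simps)
  have "(1 - u) * cmod (\<xi> - z) \<le> (1 - u) * (2 * (1 - l))" using 1 assms by (intro mult_left_mono) auto
  also have "\<dots> = 2 * ((1 - u) * (1 - l))" by simp
  also have "\<dots> \<le> 2 * (1 - cmod z)" using 2 by (intro mult_left_mono) auto
  finally show ?thesis using that *(1) by blast
qed

text \<open>A sum of excesses stands for the maximum of the cone radii, so that continuity and the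
  derivative are obtained termwise.\<close>

definition bdry_radius :: "real \<Rightarrow> real \<Rightarrow> real"
  where "bdry_radius u \<theta> = u + (\<Sum>\<xi>\<in>set \<xi>s. cone_radius u (cnj \<xi> * cis \<theta>) - u)"

lemma cmod_cnj_cis: "\<xi> \<in> set \<xi>s \<Longrightarrow> cmod (cnj \<xi> * cis \<theta>) = 1"
  using cmod_xi by (simp add: norm_mult)

text \<open>Since each segment between two points of \<open>E\<close> meets the disc, the caps cut off by the discs
  around distinct points do not overlap; at most one summand of the boundary radius is
  nonzero.\<close>

lemma caps_disjoint:
  assumes "r \<le> u" and \<xi>: "\<xi> \<in> set \<xi>s" "\<eta> \<in> set \<xi>s" and R: "u \<le> Re (cnj \<xi> * cis \<theta>)" "u \<le> Re (cnj \<eta> * cis \<theta>)"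
  shows "\<xi> = \<eta>"
proof (rule ccontr)
  assume "\<xi> \<noteq> \<eta>"
  then have "closed_segment \<xi> \<eta> \<inter> ball 0 r \<noteq> {}"
    using large \<xi> unfolding E_large_enough_def by blast
  then obtain p where p: "p \<in> closed_segment \<xi> \<eta>" "cmod p < r" by auto
  then obtain t where t: "0 \<le> t" "t \<le> 1" "p = (1 - t) *\<^sub>R \<xi> + t *\<^sub>R \<eta>"
    unfolding in_segment by blast
  have "Re (cnj p * cis \<theta>) = (1 - t) * Re (cnj \<xi> * cis \<theta>) + t * Re (cnj \<eta> * cis \<theta>)"
    unfolding t(3) by (simp add: algebra_simps)
  also have "\<dots> \<ge> (1 - t) * u + t * u" using t R by (intro add_mono mult_left_mono) auto
  finally have "u \<le> Re (cnj p * cis \<theta>)" by (simp add: algebra_simps)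
  also have "\<dots> \<le> cmod p" using complex_Re_le_cmod[of "cnj p * cis \<theta>"] by (simp add: norm_mult)
  finally show False using p assms(1) by simp
qed

lemma bdry_radius_props:
  assumes u: "r \<le> u" "u < 1"
  shows "\<xi> \<in> set \<xi>s \<Longrightarrow> cone_radius u (cnj \<xi> * cis \<theta>) \<le> bdry_radius u \<theta>"
    and "\<exists>\<xi>\<in>set \<xi>s. bdry_radius u \<theta> = cone_radius u (cnj \<xi> * cis \<theta>)"
    and "u \<le> bdry_radius u \<theta>"
proof -
  have u0: "0 < u" using u r_pos by simp
  have nn: "0 \<le> cone_radius u (cnj \<xi> * cis \<theta>) - u" if "\<xi> \<in> set \<xi>s" for \<xi>
    using cone_radius_ge[OF u0 u(2) cmod_cnj_cis[OF that]] by simp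
  show "cone_radius u (cnj \<xi> * cis \<theta>) \<le> bdry_radius u \<theta>" if "\<xi> \<in> set \<xi>s" for \<xi>
    using member_le_sum[OF that, of "\<lambda>\<xi>. cone_radius u (cnj \<xi> * cis \<theta>) - u"] nn
    by (simp add: bdry_radius_def)
  show "u \<le> bdry_radius u \<theta>" unfolding bdry_radius_def using nn by (simp add: sum_nonneg)
  show "\<exists>\<xi>\<in>set \<xi>s. bdry_radius u \<theta> = cone_radius u (cnj \<xi> * cis \<theta>)"
  proof (cases "\<exists>\<xi>\<in>set \<xi>s. u < Re (cnj \<xi> * cis \<theta>)")
    case True
    then obtain \<xi> where \<xi>: "\<xi> \<in> set \<xi>s" "u < Re (cnj \<xi> * cis \<theta>)" by blast
    have "(\<Sum>\<eta>\<in>set \<xi>s. cone_radius u (cnj \<eta> * cis \<theta>) - u)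
        = (\<Sum>\<eta>\<in>set \<xi>s. if \<eta> = \<xi> then cone_radius u (cnj \<eta> * cis \<theta>) - u else 0)"
    proof (rule sum.cong[OF refl])
      fix \<eta> assume \<eta>: "\<eta> \<in> set \<xi>s"
      show "cone_radius u (cnj \<eta> * cis \<theta>) - u
          = (if \<eta> = \<xi> then cone_radius u (cnj \<eta> * cis \<theta>) - u else 0)"
        using caps_disjoint[OF u(1) \<eta> \<xi>(1), of \<theta>] \<xi>(2) by (cases "\<eta> = \<xi>") (auto simp: cone_radius_def)
    qed
    also have "\<dots> = cone_radius u (cnj \<xi> * cis \<theta>) - u" using \<xi>(1) by (simp add: sum.delta)
    finally show ?thesis using \<xi>(1) by (auto simp: bdry_radius_def)
  next
    case False
    then have "cone_radius u (cnj \<xi> * cis \<theta>) = u" if "\<xi> \<in> set \<xi>s" for \<xi>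
      using that unfolding cone_radius_def by (metis not_le)
    then show ?thesis using nonempty by (intro bexI[of _ "hd \<xi>s"]) (simp_all add: bdry_radius_def)
  qed
qed

lemma bdry_in_closure:
  assumes u: "r \<le> u" "u < 1"
  shows "of_real (bdry_radius u \<theta>) * cis \<theta> \<in> closure (E_dom \<xi>s u)"
proof -
  have u0: "0 < u" using u r_pos by simp
  obtain \<xi> where \<xi>: "\<xi> \<in> set \<xi>s" "bdry_radius u \<theta> = cone_radius u (cnj \<xi> * cis \<theta>)"
    using bdry_radius_props(2)[OF u] by blast
  have "of_real (bdry_radius u \<theta>) * cis \<theta> \<in> convex hull (insert \<xi> (cball 0 u))"
    unfolding \<xi>(2) by (rule cone_radius_attained[OF u0 u(2) cmod_xi[OF \<xi>(1)]])
  also have "\<dots> \<subseteq> closure (E_dom \<xi>s u)"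
  proof (rule hull_minimal)
    have "cball 0 u = closure (ball (0::complex) u)" using u0 by simp
    also have "\<dots> \<subseteq> closure (E_dom \<xi>s u)" by (intro closure_mono ball_subset_E_dom)
    finally have "cball 0 u \<subseteq> closure (E_dom \<xi>s u)" .
    moreover have "\<xi> \<in> closure (E_dom \<xi>s u)"
      unfolding closure_E_dom[OF u0] using \<xi>(1) by (intro closure_subset[THEN subsetD] hull_inc) auto
    ultimately show "insert \<xi> (cball 0 u) \<subseteq> closure (E_dom \<xi>s u)" by blast
  qed (intro convex_closure convex_E_dom)
  finally show ?thesis .
qed

lemma le_bdry_radius:
  assumes u: "r \<le> u" "u < 1" and "of_real \<rho> * cis \<theta> \<in> closure (E_dom \<xi>s u)"
  shows "\<rho> \<le> bdry_radius u \<theta>"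
proof -
  have u0: "0 < u" using u r_pos by simp
  obtain \<xi> l b where *: "\<xi> \<in> set \<xi>s" "0 \<le> l" "l \<le> 1" "cmod b \<le> u"
      "of_real \<rho> * cis \<theta> = l *\<^sub>R \<xi> + (1 - l) *\<^sub>R b"
    using closure_E_dom_cone[OF u(1) assms(3)] by blast
  have "\<rho> \<le> cone_radius u (cnj \<xi> * cis \<theta>)"
    by (rule le_cone_radius[OF u0 u(2) cmod_xi[OF *(1)] *(2-5)])
  then show ?thesis using bdry_radius_props(1)[OF u *(1), of \<theta>] by linarith
qed

lemma E_bdry_eq:
  assumes u: "r \<le> u" "u < 1"
  shows "E_bdry \<xi>s u \<theta> = of_real (bdry_radius u \<theta>) * cis \<theta>"
proof -
  have u0: "0 < u" using u r_pos by simp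
  have R0: "0 < bdry_radius u \<theta>" using bdry_radius_props(3)[OF u, of \<theta>] u0 by linarith
  have "Sup {\<rho>. 0 \<le> \<rho> \<and> of_real \<rho> * cis \<theta> \<in> E_dom \<xi>s u} = bdry_radius u \<theta>"
  proof (rule cSup_eq)
    fix \<rho> assume "\<rho> \<in> {\<rho>. 0 \<le> \<rho> \<and> of_real \<rho> * cis \<theta> \<in> E_dom \<xi>s u}"
    then show "\<rho> \<le> bdry_radius u \<theta>"
      using le_bdry_radius[OF u, of \<rho> \<theta>] closure_subset by blast
  next
    fix y assume y: "\<And>\<rho>. \<rho> \<in> {\<rho>. 0 \<le> \<rho> \<and> of_real \<rho> * cis \<theta> \<in> E_dom \<xi>s u} \<Longrightarrow> \<rho> \<le> y"
    show "bdry_radius u \<theta> \<le> y"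
    \<comment> \<open>\<open>E_dom\<close> is open, so the radius is not attained; its multiples
      with factor t < 1 approach it.\<close>
    proof (rule field_le_mult_one_interval)
      fix t :: real assume t: "0 < t" "t < 1"
      have "of_real t * (of_real (bdry_radius u \<theta>) * cis \<theta>) \<in> E_dom \<xi>s u"
        by (rule shrink_in_E_dom[OF u0 bdry_in_closure[OF u]]) (use t in auto)
      then show "t * bdry_radius u \<theta> \<le> y"
        using t R0 by (intro y) (simp add: mult.assoc)
    qed
  qed
  then show ?thesis by (simp add: E_bdry_def)
qed

lemma E_bdry_in_closure:
  assumes "r \<le> u" "u < 1"
  shows "E_bdry \<xi>s u \<theta> \<in> closure (E_dom \<xi>s u)"
  using bdry_in_closure[OF assms] E_bdry_eq[OF assms] by simp

lemma cmod_E_bdry: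
  assumes "r \<le> u" "u < 1"
  shows "cmod (E_bdry \<xi>s u \<theta>) = bdry_radius u \<theta>"
  using bdry_radius_props(3)[OF assms, of \<theta>] assms r_pos
  by (simp add: E_bdry_eq[OF assms] norm_mult)

lemma cmod_E_bdry_le_1:
  assumes "r \<le> u" "u < 1"
  shows "cmod (E_bdry \<xi>s u \<theta>) \<le> 1"
proof -
  have "closure (E_dom \<xi>s u) \<subseteq> closure (ball 0 1)"
    by (intro closure_mono E_dom_subset_ball) (use assms in simp)
  then show ?thesis using E_bdry_in_closure[OF assms, of \<theta>] by auto
qed

lemma E_bdry_scaled_notin_closure:
  assumes u: "r \<le> u" "u < 1" and "0 < \<tau>" "\<tau> < 1"
  shows "E_bdry \<xi>s u \<theta> / of_real \<tau> \<notin> closure (E_dom \<xi>s u)"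
proof
  have R0: "0 < bdry_radius u \<theta>" using bdry_radius_props(3)[OF u, of \<theta>] u r_pos by linarith
  assume "E_bdry \<xi>s u \<theta> / of_real \<tau> \<in> closure (E_dom \<xi>s u)"
  then have "bdry_radius u \<theta> / \<tau> \<le> bdry_radius u \<theta>"
    by (intro le_bdry_radius[OF u]) (simp add: E_bdry_eq[OF u])
  then show False using R0 assms(3,4) by (simp add: field_simps)
qed

lemma E_bdry_notin_E_dom:
  assumes u: "r \<le> u" "u < 1"
  shows "E_bdry \<xi>s u \<theta> \<notin> E_dom \<xi>s u"
proof
  assume "E_bdry \<xi>s u \<theta> \<in> E_dom \<xi>s u"
  then obtain e where "0 < e" and e: "ball (E_bdry \<xi>s u \<theta>) e \<subseteq> E_dom \<xi>s u"
    using open_E_dom open_contains_ball by blast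
  have "of_real (bdry_radius u \<theta> + e / 2) * cis \<theta> \<in> ball (E_bdry \<xi>s u \<theta>) e"
    using \<open>0 < e\<close> by (simp add: E_bdry_eq[OF u] dist_norm norm_mult algebra_simps)
  then have "of_real (bdry_radius u \<theta> + e / 2) * cis \<theta> \<in> closure (E_dom \<xi>s u)"
    using e closure_subset by blast
  then show False using le_bdry_radius[OF u] \<open>0 < e\<close> by fastforce
qed

lemma E_bdry_notin_closure_smaller:
  assumes "r \<le> s" "s < u" "u < 1" "E_bdry \<xi>s u \<theta> \<notin> set \<xi>s"
  shows "E_bdry \<xi>s u \<theta> \<notin> closure (E_dom \<xi>s s)"
  using closure_E_dom_subset[OF assms(1,2)] E_bdry_notin_E_dom[of u \<theta>] assms by auto

lemma E_bdry_corner: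
  assumes u: "r \<le> u" "u < 1" and "E_bdry \<xi>s u \<theta> \<in> set \<xi>s"
  shows "cis \<theta> \<in> set \<xi>s"
proof -
  have "bdry_radius u \<theta> = 1"
    using cmod_E_bdry[OF u, of \<theta>] cmod_xi[OF assms(3)] by simp
  then show ?thesis using assms(3) by (simp add: E_bdry_eq[OF u])
qed

text \<open>Distance to the circle is compared with angular distance, so that later majorants are
  functions of one real variable. Each point of E contributes three angles because the parameter
  interval wraps around.\<close>

lemma bdry_distance:
  assumes u: "r \<le> u" "u < 1"
  obtains P c where "finite P" "0 < c" "\<And>p. p \<in> P \<Longrightarrow> cis p \<in> set \<xi>s"
    "\<And>\<theta>. \<theta> \<in> {0..2*pi} \<Longrightarrow> \<exists>p\<in>P. c * \<bar>\<theta> - p\<bar> \<le> 1 - cmod (E_bdry \<xi>s u \<theta>)"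
proof -
  define P where "P = (\<Union>\<xi>\<in>set \<xi>s. {Arg2pi \<xi> - 2 * pi, Arg2pi \<xi>, Arg2pi \<xi> + 2 * pi})"
  \<comment> \<open>6 = 3 * 2: the triangle inequality through z turns the 2 of \<open>stolz\<close>
    into 3, and the passage from chords to angles doubles it.\<close>
  define c where "c = (1 - u) / 6"
  have cis_Arg2pi: "cis (Arg2pi \<xi>) = \<xi>" if "\<xi> \<in> set \<xi>s" for \<xi>
    using Arg2pi_eq[of \<xi>] cmod_xi[OF that] by (simp add: cis_conv_exp)
  have "finite P" by (simp add: P_def)
  moreover have "0 < c" using u by (simp add: c_def)
  moreover have "cis p \<in> set \<xi>s" if "p \<in> P" for p
  proof -
    from that obtain \<xi> where \<xi>: "\<xi> \<in> set \<xi>s" "p \<in> {Arg2pi \<xi> - 2 * pi, Arg2pi \<xi>, Arg2pi \<xi> + 2 * pi}"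
      unfolding P_def by blast
    then have "cis p = cis (Arg2pi \<xi>)" by (auto simp: complex_eq_iff cos_diff sin_diff)
    then show ?thesis using cis_Arg2pi[OF \<xi>(1)] \<xi>(1) by simp
  qed
  moreover have "\<exists>p\<in>P. c * \<bar>\<theta> - p\<bar> \<le> 1 - cmod (E_bdry \<xi>s u \<theta>)" if \<theta>: "\<theta> \<in> {0..2*pi}" for \<theta>
  proof -
    define z where "z = E_bdry \<xi>s u \<theta>"
    obtain \<xi> where \<xi>: "\<xi> \<in> set \<xi>s" "(1 - u) * cmod (\<xi> - z) \<le> 2 * (1 - cmod z)"
      unfolding z_def using stolz[OF u E_bdry_in_closure[OF u, of \<theta>]] by blast
    have "z - cis \<theta> = of_real (bdry_radius u \<theta> - 1) * cis \<theta>"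
      by (simp add: z_def E_bdry_eq[OF u] algebra_simps)
    then have "cmod (z - cis \<theta>) = 1 - cmod z"
      using cmod_E_bdry[OF u, of \<theta>] cmod_E_bdry_le_1[OF u, of \<theta>]
      by (simp add: z_def norm_mult del: of_real_diff)
    moreover have "cmod (\<xi> - cis \<theta>) \<le> cmod (\<xi> - z) + cmod (z - cis \<theta>)"
      using norm_triangle_ineq[of "\<xi> - z" "z - cis \<theta>"] by simp
    ultimately have "(1 - u) * cmod (\<xi> - cis \<theta>) \<le> (1 - u) * cmod (\<xi> - z) + (1 - u) * (1 - cmod z)"
      using u by (simp flip: distrib_left)
    also have "\<dots> \<le> 2 * (1 - cmod z) + 1 * (1 - cmod z)"
      using \<xi>(2) u r_pos cmod_E_bdry_le_1[OF u, of \<theta>]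
      by (intro add_mono mult_right_mono) (auto simp: z_def)
    finally have *: "(1 - u) * cmod (\<xi> - cis \<theta>) \<le> 3 * (1 - cmod z)" by simp
    have "\<xi> = cis (Arg2pi \<xi>)"
      using cis_Arg2pi[OF \<xi>(1)] by simp
    moreover have "\<bar>Arg2pi \<xi> - \<theta>\<bar> \<le> 2 * pi"
      using \<theta> Arg2pi_ge_0[of \<xi>] Arg2pi_lt_2pi[of \<xi>] by (simp add: abs_le_iff)
    then obtain p where p: "p \<in> {Arg2pi \<xi> - 2 * pi, Arg2pi \<xi>, Arg2pi \<xi> + 2 * pi}"
      "\<bar>\<theta> - p\<bar> \<le> 2 * cmod (cis (Arg2pi \<xi>) - cis \<theta>)"
      using angle_le_cis_dist by blast
    ultimately have "\<bar>\<theta> - p\<bar> \<le> 2 * cmod (\<xi> - cis \<theta>)" by simp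
    then have "c * \<bar>\<theta> - p\<bar> \<le> (1 - u) / 6 * (2 * cmod (\<xi> - cis \<theta>))"
      unfolding c_def using u by (intro mult_left_mono) auto
    also have "\<dots> \<le> 1 - cmod z" using * by (simp add: field_simps)
    finally show ?thesis using p \<xi>(1) unfolding z_def P_def by blast
  qed
  ultimately show ?thesis by (rule that)
qed

end

section \<open>Differentiability of the boundary parametrisation\<close>

definition cone_radius_deriv :: "real \<Rightarrow> real \<Rightarrow> real"
  where "cone_radius_deriv u \<alpha> = (if cos \<alpha> < u then 0 else
     - (u * (- u * sin \<alpha> + sqrt (1 - u\<^sup>2) * (sgn (sin \<alpha>) * cos \<alpha>)))
        / (u * cos \<alpha> + sqrt (1 - u\<^sup>2) * \<bar>sin \<alpha>\<bar>)\<^sup>2)"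

context
  fixes u :: real
  assumes u: "0 < u" "u < 1"
begin

lemma cone_radius_cis_denom:
  assumes "u \<le> cos \<alpha>"
  shows "u\<^sup>2 \<le> u * cos \<alpha> + sqrt (1 - u\<^sup>2) * \<bar>sin \<alpha>\<bar>"
    and "0 < u * cos \<alpha> + sqrt (1 - u\<^sup>2) * \<bar>sin \<alpha>\<bar>"
proof -
  show *: "u\<^sup>2 \<le> u * cos \<alpha> + sqrt (1 - u\<^sup>2) * \<bar>sin \<alpha>\<bar>"
    using cone_radius_denom(1)[OF u, of "cis \<alpha>"] assms by simp
  have "0 < u\<^sup>2" using u by simp
  with * show "0 < u * cos \<alpha> + sqrt (1 - u\<^sup>2) * \<bar>sin \<alpha>\<bar>" by linarith
qed

lemma continuous_on_cone_radius_cis: "continuous_on UNIV (\<lambda>\<alpha>. cone_radius u (cis \<alpha>))"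
  unfolding cone_radius_def cis.sel
proof (rule continuous_on_cases_le)
  show "continuous_on {t \<in> UNIV. u \<le> cos t} (\<lambda>t. u / (u * cos t + sqrt (1 - u\<^sup>2) * \<bar>sin t\<bar>))"
    by (intro continuous_intros) (use cone_radius_cis_denom(2) in fastforce)
  \<comment> \<open>At the point of contact the denominator is u^2 + (1 - u^2) = 1, so the two
    branches agree.\<close>
  fix t assume t: "cos t = u"
  have "\<bar>sin t\<bar> = sqrt (1 - u\<^sup>2)"
    by (rule real_sqrt_unique[symmetric]) (simp_all add: t[symmetric] sin_squared_eq)
  then show "u = u / (u * cos t + sqrt (1 - u\<^sup>2) * \<bar>sin t\<bar>)"
    using t u by (simp add: power_le_one power2_eq_square[symmetric])
qed (intro continuous_intros)+

lemma has_derivative_cone_radius_cis: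
  assumes "cos \<alpha> \<noteq> u" "sin \<alpha> \<noteq> 0"
  shows "((\<lambda>\<alpha>. cone_radius u (cis \<alpha>)) has_real_derivative cone_radius_deriv u \<alpha>) (at \<alpha>)"
proof (cases "cos \<alpha> < u")
  case True
  have op: "open {\<beta>. cos \<beta> < u}" by (intro open_Collect_less continuous_intros)
  have "((\<lambda>_. u) has_real_derivative 0) (at \<alpha>)" by simp
  from has_field_derivative_transform_within_open[OF this op]
  have "((\<lambda>\<alpha>. cone_radius u (cis \<alpha>)) has_real_derivative 0) (at \<alpha>)"
    using True by (simp add: cone_radius_def)
  then show ?thesis using True by (simp add: cone_radius_deriv_def)
next
  case False
  then have c: "u < cos \<alpha>" using assms by simp
  have op: "open {\<beta>. u < cos \<beta>}" by (intro open_Collect_less continuous_intros)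
  have "((\<lambda>\<beta>. u / (u * cos \<beta> + sqrt (1 - u\<^sup>2) * \<bar>sin \<beta>\<bar>)) has_real_derivative cone_radius_deriv u \<alpha>) (at \<alpha>)"
  proof -
    \<comment> \<open>Near \<alpha> the sine keeps its sign, so |sin| is locally the smooth function
      s * sin.\<close>
    define s where "s = sgn (sin \<alpha>)"
    have op: "open {\<beta>. 0 < s * sin \<beta>}" by (intro open_Collect_less continuous_intros)
    have "((\<lambda>\<beta>. u / (u * cos \<beta> + sqrt (1 - u\<^sup>2) * (s * sin \<beta>)))
        has_real_derivative cone_radius_deriv u \<alpha>) (at \<alpha>)"
    proof -
      have s: "s * sin \<alpha> = \<bar>sin \<alpha>\<bar>" by (simp add: s_def abs_sgn mult.commute)
      have D: "u * cos \<alpha> + sqrt (1 - u\<^sup>2) * (s * sin \<alpha>) \<noteq> 0"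
        unfolding s using cone_radius_cis_denom(2)[of \<alpha>] c by simp
      show ?thesis
        by (rule derivative_eq_intros refl D)+
           (use False in \<open>simp add: cone_radius_deriv_def s[symmetric] power2_eq_square, simp add: s_def\<close>)
    qed
    then show ?thesis
    proof (rule has_field_derivative_transform_within_open[OF _ op])
      show "\<alpha> \<in> {\<beta>. 0 < s * sin \<beta>}"
        using assms(2) by (simp add: s_def sgn_if)
      show "u / (u * cos \<beta> + sqrt (1 - u\<^sup>2) * (s * sin \<beta>)) = u / (u * cos \<beta> + sqrt (1 - u\<^sup>2) * \<bar>sin \<beta>\<bar>)"
        if "\<beta> \<in> {\<beta>. 0 < s * sin \<beta>}" for \<beta>
      proof -
        have "s * sin \<beta> = \<bar>sin \<beta>\<bar>" using that by (auto simp: s_def sgn_if split: if_splits)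
        then show ?thesis by (simp only:)
      qed
    qed
  qed
  from has_field_derivative_transform_within_open[OF this op]
  show ?thesis using c by (simp add: cone_radius_def)
qed

lemma continuous_on_cone_radius_deriv:
  "continuous_on {\<alpha>. cos \<alpha> \<noteq> u \<and> sin \<alpha> \<noteq> 0} (cone_radius_deriv u)"
proof -
  let ?A = "{\<alpha>. cos \<alpha> < u}" and ?B = "{\<alpha>. u < cos \<alpha> \<and> sin \<alpha> \<noteq> 0}"
  have "continuous_on ?A (cone_radius_deriv u)"
    by (rule continuous_on_eq[of _ "\<lambda>_. 0"]) (auto simp: cone_radius_deriv_def)
  moreover have "continuous_on ?B (cone_radius_deriv u)"
  proof (rule continuous_on_eq)
    have "u * cos x + sqrt (1 - u\<^sup>2) * \<bar>sin x\<bar> \<noteq> 0" if "u < cos x" for x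
      using cone_radius_cis_denom(2)[of x] that by simp
    then show "continuous_on ?B (\<lambda>\<alpha>. - (u * (- u * sin \<alpha> + sqrt (1 - u\<^sup>2) * (sgn (sin \<alpha>) * cos \<alpha>)))
        / (u * cos \<alpha> + sqrt (1 - u\<^sup>2) * \<bar>sin \<alpha>\<bar>)\<^sup>2)"
      by (intro continuous_intros) auto
  qed (auto simp: cone_radius_deriv_def)
  moreover have "open ?A" "open ?B"
    by (intro open_Collect_less open_Collect_conj open_Collect_neq continuous_intros)+
  ultimately have "continuous_on (?A \<union> ?B) (cone_radius_deriv u)"
    by (intro continuous_on_open_Un)
  then show ?thesis by (rule continuous_on_subset) auto
qed

text \<open>The numerator is at most 2 u and the denominator at least u^4.\<close>

lemma cone_radius_deriv_bound: "\<bar>cone_radius_deriv u \<alpha>\<bar> \<le> 2 / u ^ 3"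
proof (cases "cos \<alpha> < u")
  case False
  define D where "D = u * cos \<alpha> + sqrt (1 - u\<^sup>2) * \<bar>sin \<alpha>\<bar>"
  define N where "N = u * (- u * sin \<alpha> + sqrt (1 - u\<^sup>2) * (sgn (sin \<alpha>) * cos \<alpha>))"
  have u2: "0 \<le> 1 - u\<^sup>2" using u by (simp add: power_le_one)
  have "u\<^sup>2 \<le> D" using cone_radius_cis_denom(1)[of \<alpha>] False by (simp add: D_def)
  then have D: "(u\<^sup>2)\<^sup>2 \<le> D\<^sup>2" by (intro power_mono) auto
  have "\<bar>- u * sin \<alpha> + sqrt (1 - u\<^sup>2) * (sgn (sin \<alpha>) * cos \<alpha>)\<bar> \<le> 1 * 1 + 1 * (1 * 1)"
    using u u2 by (intro order_trans[OF abs_triangle_ineq] add_mono)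
      (auto simp: abs_mult intro!: mult_mono mult_le_one simp: abs_sgn_eq)
  then have "\<bar>N\<bar> \<le> u * 2" unfolding N_def abs_mult using u by (auto intro!: mult_mono)
  then have "\<bar>N\<bar> / D\<^sup>2 \<le> u * 2 / (u\<^sup>2)\<^sup>2" using D u by (intro frac_le) auto
  also have "\<dots> = 2 / u ^ 3" using u by (simp add: power2_eq_square power3_eq_cube)
  finally show ?thesis using False by (simp add: cone_radius_deriv_def N_def D_def)
qed (use u in \<open>simp add: cone_radius_deriv_def\<close>)

end

lemma finite_cis_vimage:
  assumes "finite W"
  shows "finite {\<theta> \<in> {0..2*pi}. cis \<theta> \<in> W}"
proof (rule finite_subset)
  show "{\<theta> \<in> {0..2*pi}. cis \<theta> \<in> W} \<subseteq> insert (2*pi) (Arg2pi ` W)"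
  proof
    fix \<theta> assume \<theta>: "\<theta> \<in> {\<theta> \<in> {0..2*pi}. cis \<theta> \<in> W}"
    show "\<theta> \<in> insert (2*pi) (Arg2pi ` W)"
    proof (cases "\<theta> = 2 * pi")
      case False
      then have "Arg2pi (cis \<theta>) = \<theta>"
        using \<theta> by (intro Arg2pi_unique[of 1]) (auto simp: cis_conv_exp)
      then show ?thesis using \<theta> by (auto intro: rev_image_eqI)
    qed simp
  qed
qed (use assms in simp)

context peripheral_set
begin

text \<open>The kinks of the boundary radius: points of contact (real part \<open>u\<close>) and
  vertices (imaginary part 0, which also takes in the opposite directions). Outside them the contour
  avoids E.\<close>

definition singular_angles :: "real \<Rightarrow> real set"
  where "singular_angles u =
    {\<theta> \<in> {0..2*pi}. \<exists>\<xi>\<in>set \<xi>s. Re (cnj \<xi> * cis \<theta>) = u \<or> Im (cnj \<xi> * cis \<theta>) = 0}"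

definition E_bdry_deriv :: "real \<Rightarrow> real \<Rightarrow> complex"
  where "E_bdry_deriv u \<theta> =
    of_real (\<Sum>\<xi>\<in>set \<xi>s. cone_radius_deriv u (\<theta> - Arg \<xi>)) * cis \<theta>
      + of_real (bdry_radius u \<theta>) * (\<i> * cis \<theta>)"

lemma cnj_mult_cis: "\<xi> \<in> set \<xi>s \<Longrightarrow> cnj \<xi> * cis \<theta> = cis (\<theta> - Arg \<xi>)"
proof -
  assume \<xi>: "\<xi> \<in> set \<xi>s"
  then have "\<xi> \<noteq> 0" using cmod_xi by fastforce
  then have "\<xi> = cis (Arg \<xi>)" using cis_Arg[of \<xi>] cmod_xi[OF \<xi>] by (simp add: sgn_div_norm)
  then have "cnj \<xi> = cis (- Arg \<xi>)" by (metis cis_cnj)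
  then show ?thesis by (simp add: cis_mult)
qed

lemma finite_singular_angles: "finite (singular_angles u)"
proof -
  define W where "W = (\<Union>\<xi>\<in>set \<xi>s. times \<xi> ` {Complex u (sqrt (1 - u\<^sup>2)), Complex u (- sqrt (1 - u\<^sup>2)), 1, - 1})"
  have "singular_angles u \<subseteq> {\<theta> \<in> {0..2*pi}. cis \<theta> \<in> W}"
  proof
    fix \<theta> assume \<theta>: "\<theta> \<in> singular_angles u"
    then obtain \<xi> where \<xi>: "\<xi> \<in> set \<xi>s" "Re (cnj \<xi> * cis \<theta>) = u \<or> Im (cnj \<xi> * cis \<theta>) = 0"
      unfolding singular_angles_def by blast
    define \<zeta> where "\<zeta> = cnj \<xi> * cis \<theta>"
    have c: "cis \<theta> = \<xi> * \<zeta>" using xi_cnj[OF \<xi>(1)] by (simp add: \<zeta>_def flip: mult.assoc)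
    have n: "(Re \<zeta>)\<^sup>2 + (Im \<zeta>)\<^sup>2 = 1"
      using cmod_cnj_cis[OF \<xi>(1), of \<theta>] by (simp add: \<zeta>_def[symmetric] cmod_def)
    have "\<zeta> \<in> {Complex u (sqrt (1 - u\<^sup>2)), Complex u (- sqrt (1 - u\<^sup>2)), 1, - 1}"
    proof (cases "Re \<zeta> = u")
      case True
      then have "(Im \<zeta>)\<^sup>2 = 1 - u\<^sup>2" using n by simp
      then have "sqrt (1 - u\<^sup>2) = \<bar>Im \<zeta>\<bar>" by (metis real_sqrt_abs)
      then show ?thesis using True by (auto simp: complex_eq_iff abs_if)
    next
      case False
      then have "Im \<zeta> = 0" using \<xi>(2) by (simp add: \<zeta>_def)
      then have "Re \<zeta> = 1 \<or> Re \<zeta> = - 1" using n by (simp add: power2_eq_1_iff)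
      then show ?thesis using \<open>Im \<zeta> = 0\<close> by (auto simp: complex_eq_iff)
    qed
    then have "cis \<theta> \<in> W" unfolding W_def c using \<xi>(1) by blast
    then show "\<theta> \<in> {\<theta> \<in> {0..2*pi}. cis \<theta> \<in> W}" using \<theta> by (simp add: singular_angles_def)
  qed
  moreover have "finite W" by (simp add: W_def)
  ultimately show ?thesis using finite_cis_vimage finite_subset by blast
qed

lemma regular_angle:
  assumes "\<theta> \<in> {0..2*pi} - singular_angles u" "\<xi> \<in> set \<xi>s"
  shows "cos (\<theta> - Arg \<xi>) \<noteq> u" "sin (\<theta> - Arg \<xi>) \<noteq> 0"
  using assms by (auto simp: singular_angles_def cnj_mult_cis)

lemma regular_angle_not_corner:
  assumes "r \<le> u" "u < 1" and "\<theta> \<in> {0..2*pi} - singular_angles u"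
  shows "E_bdry \<xi>s u \<theta> \<notin> set \<xi>s"
proof
  assume "E_bdry \<xi>s u \<theta> \<in> set \<xi>s"
  then have \<xi>: "cis \<theta> \<in> set \<xi>s" by (rule E_bdry_corner[OF assms(1,2)])
  have "Im (cnj (cis \<theta>) * cis \<theta>) = 0" by simp
  then show False using \<xi> assms(3) unfolding singular_angles_def by blast
qed

lemma bdry_radius_cis:
  "bdry_radius u \<theta> = u + (\<Sum>\<xi>\<in>set \<xi>s. cone_radius u (cis (\<theta> - Arg \<xi>)) - u)"
  unfolding bdry_radius_def by (simp add: cnj_mult_cis cong: sum.cong)

lemma continuous_on_bdry_radius:
  assumes "0 < u" "u < 1"
  shows "continuous_on UNIV (bdry_radius u)"
  unfolding bdry_radius_cis
  by (intro continuous_intros continuous_on_compose2[OF continuous_on_cone_radius_cis[OF assms]]) auto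

lemma continuous_on_E_bdry:
  assumes "r \<le> u" "u < 1"
  shows "continuous_on UNIV (E_bdry \<xi>s u)"
proof -
  have u: "0 < u" using assms r_pos by simp
  have "E_bdry \<xi>s u = (\<lambda>\<theta>. of_real (bdry_radius u \<theta>) * cis \<theta>)"
    by (rule ext) (rule E_bdry_eq[OF assms])
  then show ?thesis
    using continuous_on_bdry_radius[OF u assms(2)] by (auto intro!: continuous_intros)
qed

lemma E_bdry_has_vector_derivative:
  assumes u: "r \<le> u" "u < 1" and \<theta>: "\<theta> \<in> {0..2*pi} - singular_angles u"
  shows "(E_bdry \<xi>s u has_vector_derivative E_bdry_deriv u \<theta>) (at \<theta>)"
proof -
  have u0: "0 < u" using u r_pos by simp
  have eq: "E_bdry \<xi>s u = (\<lambda>\<theta>. of_real (bdry_radius u \<theta>) * cis \<theta>)"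
    by (rule ext) (rule E_bdry_eq[OF u])
  have cone: "((\<lambda>\<theta>. cone_radius u (cis (\<theta> - Arg \<xi>))) has_real_derivative
      cone_radius_deriv u (\<theta> - Arg \<xi>)) (at \<theta>)" if "\<xi> \<in> set \<xi>s" for \<xi>
  proof -
    have "((\<lambda>\<theta>. \<theta> - Arg \<xi>) has_real_derivative 1) (at \<theta>)"
      by (auto intro!: derivative_eq_intros)
    from DERIV_chain2[OF has_derivative_cone_radius_cis[OF u0 u(2) regular_angle[OF \<theta> that]] this]
    show ?thesis by simp
  qed
  have "((\<lambda>\<theta>. u + (\<Sum>\<xi>\<in>set \<xi>s. cone_radius u (cis (\<theta> - Arg \<xi>)) - u)) has_real_derivative
      0 + (\<Sum>\<xi>\<in>set \<xi>s. cone_radius_deriv u (\<theta> - Arg \<xi>) - 0)) (at \<theta>)"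
    by (intro DERIV_add DERIV_const DERIV_sum DERIV_diff cone)
  then have "(bdry_radius u has_real_derivative (\<Sum>\<xi>\<in>set \<xi>s. cone_radius_deriv u (\<theta> - Arg \<xi>))) (at \<theta>)"
    unfolding bdry_radius_cis by simp
  then have "((\<lambda>\<theta>. complex_of_real (bdry_radius u \<theta>)) has_vector_derivative
      of_real (\<Sum>\<xi>\<in>set \<xi>s. cone_radius_deriv u (\<theta> - Arg \<xi>))) (at \<theta>)"
    by (intro has_vector_derivative_of_real) (simp add: has_real_derivative_iff_has_vector_derivative)
  moreover have "(cis has_vector_derivative \<i> * cis \<theta>) (at \<theta>)"
    unfolding has_vector_derivative_def
    by (auto intro!: derivative_eq_intros simp: scaleR_conv_of_real)
  ultimately show ?thesis
    unfolding eq E_bdry_deriv_def by (auto dest: has_vector_derivative_mult simp: add.commute)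
qed

lemma continuous_on_E_bdry_deriv:
  assumes "r \<le> u" "u < 1"
  shows "continuous_on ({0..2*pi} - singular_angles u) (E_bdry_deriv u)"
proof -
  have u0: "0 < u" using assms r_pos by simp
  have "continuous_on ({0..2*pi} - singular_angles u) (\<lambda>\<theta>. cone_radius_deriv u (\<theta> - Arg \<xi>))"
    if "\<xi> \<in> set \<xi>s" for \<xi>
  proof (rule continuous_on_compose2[OF continuous_on_cone_radius_deriv[OF u0 assms(2)]])
    show "(\<lambda>\<theta>. \<theta> - Arg \<xi>) ` ({0..2*pi} - singular_angles u) \<subseteq> {\<alpha>. cos \<alpha> \<noteq> u \<and> sin \<alpha> \<noteq> 0}"
      using regular_angle[OF _ that] by blast
  qed (intro continuous_intros)
  then show ?thesis
    unfolding E_bdry_deriv_def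
    by (intro continuous_intros continuous_on_subset[OF continuous_on_bdry_radius[OF u0 assms(2)]]) auto
qed

lemma E_bdry_deriv_bound:
  assumes "r \<le> u" "u < 1"
  shows "cmod (E_bdry_deriv u \<theta>) \<le> card (set \<xi>s) * (2 / u ^ 3) + 1"
proof -
  have u0: "0 < u" using assms r_pos by simp
  have "\<bar>\<Sum>\<xi>\<in>set \<xi>s. cone_radius_deriv u (\<theta> - Arg \<xi>)\<bar> \<le> card (set \<xi>s) * (2 / u ^ 3)"
    using sum_norm_bound[of "set \<xi>s" "\<lambda>\<xi>. cone_radius_deriv u (\<theta> - Arg \<xi>)" "2 / u ^ 3"]
      cone_radius_deriv_bound[OF u0 assms(2)] by simp
  moreover have "\<bar>bdry_radius u \<theta>\<bar> \<le> 1"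
    using cmod_E_bdry[OF assms, of \<theta>] cmod_E_bdry_le_1[OF assms, of \<theta>] norm_ge_zero[of "E_bdry \<xi>s u \<theta>"] by linarith
  ultimately show ?thesis
    unfolding E_bdry_deriv_def
    by (intro order_trans[OF norm_triangle_ineq] add_mono) (simp_all add: norm_mult del: of_real_sum)
qed

lemma E_bdry_periodic: "E_bdry \<xi>s u (2 * pi) = E_bdry \<xi>s u 0"
  by (simp add: E_bdry_def)

end

section \<open>Power series coefficients\<close>

text \<open>The poles are distinct, hence simple, and lie on the circle; expanding the fractions
  gives Taylor coefficients of 1/A that stay bounded.\<close>

lemma partial_fractions_reciprocal:
  assumes "finite S" "S \<noteq> {}" "S \<subseteq> sphere 0 1"
  shows "\<exists>b :: complex \<Rightarrow> complex. \<forall>w. cmod w < 1 \<longrightarrow>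
    1 / (\<Prod>\<xi>\<in>S. 1 - cnj \<xi> * w) = (\<Sum>\<xi>\<in>S. b \<xi> / (1 - cnj \<xi> * w))"
  using assms
proof (induction rule: finite_ne_induct)
  case (singleton \<xi>)
  then show ?case by (intro exI[of _ "\<lambda>_. 1"]) simp
next
  case (insert \<eta> S)
  then obtain b where b: "\<And>w. cmod w < 1 \<Longrightarrow>
      1 / (\<Prod>\<xi>\<in>S. 1 - cnj \<xi> * w) = (\<Sum>\<xi>\<in>S. b \<xi> / (1 - cnj \<xi> * w))"
    by auto
  \<comment> \<open>From 1 / ((1 - x w) (1 - y w)) = (x / (1 - x w) - y / (1 - y w)) / (x - y) with
    x = cnj \<xi> and y = cnj \<eta>.\<close>
  define b' where "b' \<xi> = (if \<xi> = \<eta> then - (\<Sum>\<xi>\<in>S. b \<xi> * cnj \<eta> / (cnj \<xi> - cnj \<eta>))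
      else b \<xi> * cnj \<xi> / (cnj \<xi> - cnj \<eta>))" for \<xi>
  have "1 / (\<Prod>\<xi>\<in>insert \<eta> S. 1 - cnj \<xi> * w) = (\<Sum>\<xi>\<in>insert \<eta> S. b' \<xi> / (1 - cnj \<xi> * w))"
    if w: "cmod w < 1" for w
  proof -
    have nz: "1 - cnj \<xi> * w \<noteq> 0" if "\<xi> \<in> insert \<eta> S" for \<xi>
    proof
      assume "1 - cnj \<xi> * w = 0"
      then have "cmod (cnj \<xi> * w) = 1" by simp
      moreover have "cmod \<xi> = 1" using insert.prems that by auto
      ultimately show False using w by (simp add: norm_mult)
    qed
    have split: "b \<xi> / (1 - cnj \<xi> * w) * (1 / (1 - cnj \<eta> * w))
        = b \<xi> * cnj \<xi> / (cnj \<xi> - cnj \<eta>) / (1 - cnj \<xi> * w)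
          - b \<xi> * cnj \<eta> / (cnj \<xi> - cnj \<eta>) / (1 - cnj \<eta> * w)" if "\<xi> \<in> S" for \<xi>
    proof -
      have ne: "cnj \<xi> - cnj \<eta> \<noteq> 0" using that insert.hyps by (metis complex_cnj_cancel_iff right_minus_eq)
      have alg: "B / p * (1 / q) = B * x / e / p - B * y / e / q"
        if "e \<noteq> 0" "p \<noteq> 0" "q \<noteq> 0" "e = x * q - y * p" for B p q x y e :: complex
        using that(1-3) by (simp add: field_simps) (simp add: that(4) algebra_simps)
      show ?thesis
        by (rule alg) (use ne nz that in \<open>auto simp: algebra_simps\<close>)
    qed
    have "1 / (\<Prod>\<xi>\<in>insert \<eta> S. 1 - cnj \<xi> * w) = (1 / (\<Prod>\<xi>\<in>S. 1 - cnj \<xi> * w)) * (1 / (1 - cnj \<eta> * w))"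
      using insert.hyps by simp
    also have "\<dots> = (\<Sum>\<xi>\<in>S. b \<xi> / (1 - cnj \<xi> * w) * (1 / (1 - cnj \<eta> * w)))"
      unfolding b[OF w] by (rule sum_distrib_right)
    also have "\<dots> = (\<Sum>\<xi>\<in>S. b \<xi> * cnj \<xi> / (cnj \<xi> - cnj \<eta>) / (1 - cnj \<xi> * w))
          - (\<Sum>\<xi>\<in>S. b \<xi> * cnj \<eta> / (cnj \<xi> - cnj \<eta>)) / (1 - cnj \<eta> * w)"
      by (simp only: split sum_subtractf sum_divide_distrib cong: sum.cong)
    also have "(\<Sum>\<xi>\<in>S. b \<xi> * cnj \<xi> / (cnj \<xi> - cnj \<eta>) / (1 - cnj \<xi> * w)) = (\<Sum>\<xi>\<in>S. b' \<xi> / (1 - cnj \<xi> * w))"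
      by (intro sum.cong) (use insert.hyps in \<open>auto simp: b'_def\<close>)
    finally show ?thesis using insert.hyps by (simp add: b'_def)
  qed
  then show ?case by blast
qed

lemma powser_disc_norm_summable:
  fixes a :: "nat \<Rightarrow> complex"
  assumes "\<And>w. cmod w < 1 \<Longrightarrow> summable (\<lambda>k. a k * w ^ k)" and "cmod w < 1"
  shows "summable (\<lambda>k. cmod (a k * w ^ k))"
proof (rule powser_insidea)
  let ?x = "of_real ((1 + cmod w) / 2) :: complex"
  have n: "cmod ?x = (1 + cmod w) / 2" by (simp only: norm_of_real) simp
  show "summable (\<lambda>k. a k * ?x ^ k)" by (rule assms(1)) (use n assms(2) in simp)
  show "norm w < norm ?x" using n assms(2) by simp
qed

lemma powser_disc_mult_sums:
  fixes a b :: "nat \<Rightarrow> complex"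
  assumes a: "\<And>w. cmod w < 1 \<Longrightarrow> (\<lambda>k. a k * w ^ k) sums f w"
    and b: "\<And>w. cmod w < 1 \<Longrightarrow> (\<lambda>k. b k * w ^ k) sums g w" and w: "cmod w < 1"
  shows "(\<lambda>k. (\<Sum>i\<le>k. a i * b (k - i)) * w ^ k) sums (f w * g w)"
proof -
  have "(\<lambda>k. \<Sum>i\<le>k. (a i * w ^ i) * (b (k - i) * w ^ (k - i))) sums
      ((\<Sum>k. a k * w ^ k) * (\<Sum>k. b k * w ^ k))"
    by (rule Cauchy_product_sums) (intro powser_disc_norm_summable w sums_summable[OF a] sums_summable[OF b]; assumption)+
  moreover have "(\<Sum>k. a k * w ^ k) = f w" "(\<Sum>k. b k * w ^ k) = g w"
    using a[OF w] b[OF w] by (simp_all add: sums_unique[symmetric])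
  moreover have "(\<Sum>i\<le>k. (a i * w ^ i) * (b (k - i) * w ^ (k - i))) = (\<Sum>i\<le>k. a i * b (k - i)) * w ^ k" for k
    unfolding sum_distrib_right
  proof (rule sum.cong[OF refl])
    fix i assume "i \<in> {..k}"
    then have "w ^ k = w ^ i * w ^ (k - i)" by (simp flip: power_add)
    then show "(a i * w ^ i) * (b (k - i) * w ^ (k - i)) = a i * b (k - i) * w ^ k"
      by (simp add: mult_ac)
  qed
  ultimately show ?thesis by simp
qed

text \<open>Convolution with a bounded sequence adds k + 1 terms and so costs one power of k +
  1.\<close>

lemma conv_bound:
  fixes a b :: "nat \<Rightarrow> complex"
  assumes "\<And>k. cmod (a k) \<le> \<alpha> * real (Suc k) ^ p" "\<And>k. cmod (b k) \<le> \<beta>"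
  shows "cmod (\<Sum>i\<le>k. a i * b (k - i)) \<le> \<alpha> * \<beta> * real (Suc k) ^ Suc p"
proof -
  have "0 \<le> \<alpha>" using order_trans[OF norm_ge_zero assms(1)[of 0]] by simp
  have "0 \<le> \<beta>" using order_trans[OF norm_ge_zero assms(2)[of 0]] by simp
  have "cmod (\<Sum>i\<le>k. a i * b (k - i)) \<le> (\<Sum>i\<le>k. \<alpha> * real (Suc k) ^ p * \<beta>)"
  proof (rule order_trans[OF norm_sum], rule sum_mono)
    fix i assume i: "i \<in> {..k}"
    have "cmod (a i) \<le> \<alpha> * real (Suc k) ^ p"
      by (rule order_trans[OF assms(1)]) (use i \<open>0 \<le> \<alpha>\<close> in \<open>auto intro!: mult_left_mono power_mono\<close>)
    then show "cmod (a i * b (k - i)) \<le> \<alpha> * real (Suc k) ^ p * \<beta>"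
      unfolding norm_mult using assms(2) \<open>0 \<le> \<alpha>\<close> by (intro mult_mono) auto
  qed
  then show ?thesis by (simp add: mult_ac)
qed

text \<open>Bounded coefficients of 1/A, convolved with themselves twice, give growth of order
  2.\<close>

lemma reciprocal_cube_coefficients:
  assumes "finite S" "S \<noteq> {}" "S \<subseteq> sphere 0 1"
  shows "\<exists>(c :: nat \<Rightarrow> complex) C. 0 < C \<and> (\<forall>k. cmod (c k) \<le> C * real (Suc k) ^ 2) \<and>
    (\<forall>w. cmod w < 1 \<longrightarrow> (\<lambda>k. c k * w ^ k) sums (1 / (\<Prod>\<xi>\<in>S. 1 - cnj \<xi> * w) ^ 3))"
proof -
  define A where "A w = (\<Prod>\<xi>\<in>S. 1 - cnj \<xi> * w)" for w
  obtain b where b: "\<And>w. cmod w < 1 \<Longrightarrow> 1 / A w = (\<Sum>\<xi>\<in>S. b \<xi> / (1 - cnj \<xi> * w))"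
    using partial_fractions_reciprocal[OF assms] unfolding A_def by blast
  define a where "a k = (\<Sum>\<xi>\<in>S. b \<xi> * cnj \<xi> ^ k)" for k :: nat
  define \<beta> where "\<beta> = (\<Sum>\<xi>\<in>S. cmod (b \<xi>)) + 1"
  have a1: "cmod (a k) \<le> \<beta>" for k
  proof -
    have "cmod (a k) \<le> (\<Sum>\<xi>\<in>S. cmod (b \<xi> * cnj \<xi> ^ k))" unfolding a_def by (rule norm_sum)
    also have "\<dots> = (\<Sum>\<xi>\<in>S. cmod (b \<xi>))"
      by (intro sum.cong) (use assms in \<open>auto simp: norm_mult norm_power\<close>)
    finally show ?thesis by (simp add: \<beta>_def)
  qed
  have "0 < \<beta>" unfolding \<beta>_def by (rule add_nonneg_pos) (auto intro: sum_nonneg)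
  have s1: "(\<lambda>k. a k * w ^ k) sums (1 / A w)" if w: "cmod w < 1" for w
  proof -
    have "(\<lambda>k. \<Sum>\<xi>\<in>S. b \<xi> * (cnj \<xi> * w) ^ k) sums (\<Sum>\<xi>\<in>S. b \<xi> * (1 / (1 - cnj \<xi> * w)))"
    proof (intro sums_sum sums_mult geometric_sums)
      fix \<xi> assume "\<xi> \<in> S"
      then have "cmod \<xi> = 1" using assms(3) by auto
      then show "norm (cnj \<xi> * w) < 1" using w by (simp add: norm_mult)
    qed
    then show ?thesis unfolding b[OF w] a_def by (simp add: sum_distrib_right power_mult_distrib mult.assoc)
  qed
  define a2 where "a2 k = (\<Sum>i\<le>k. a i * a (k - i))" for k
  define c where "c k = (\<Sum>i\<le>k. a2 i * a (k - i))" for k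
  have s2: "(\<lambda>k. a2 k * w ^ k) sums (1 / A w * (1 / A w))" if "cmod w < 1" for w
    unfolding a2_def by (rule powser_disc_mult_sums[OF s1 s1 that])
  have s3: "(\<lambda>k. c k * w ^ k) sums (1 / A w * (1 / A w) * (1 / A w))" if "cmod w < 1" for w
    unfolding c_def by (rule powser_disc_mult_sums[OF s2 s1 that])
  have "cmod (a2 k) \<le> \<beta> * \<beta> * real (Suc k) ^ Suc 0" for k
    unfolding a2_def by (rule conv_bound) (use a1 in auto)
  then have "cmod (c k) \<le> \<beta> * \<beta> * \<beta> * real (Suc k) ^ Suc (Suc 0)" for k
    unfolding c_def by (rule conv_bound) (use a1 in auto)
  then show ?thesis
    using s3 \<open>0 < \<beta>\<close> unfolding A_def
    by (intro exI[of _ c] exI[of _ "\<beta> * \<beta> * \<beta>"]) (simp_all add: power3_eq_cube numeral_2_eq_2)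
qed

text \<open>At most one point of a finite set is close to a given point.\<close>

lemma prod_dist_ge_min:
  fixes S :: "complex set"
  assumes "finite S" "S \<noteq> {}"
  obtains c where "0 < c" "\<And>z. \<exists>\<xi>\<in>S. c * cmod (\<xi> - z) \<le> (\<Prod>\<eta>\<in>S. cmod (\<eta> - z))"
proof -
  have "\<exists>c>0. \<forall>z. \<exists>\<xi>\<in>S. c * cmod (\<xi> - z) \<le> (\<Prod>\<eta>\<in>S. cmod (\<eta> - z))"
    using assms
  proof (induction rule: finite_ne_induct)
    case (singleton \<xi>)
    then show ?case by (intro exI[of _ 1]) simp
  next
    case (insert \<eta> S)
    then obtain c where c: "0 < c" "\<And>z. \<exists>\<xi>\<in>S. c * cmod (\<xi> - z) \<le> (\<Prod>\<eta>\<in>S. cmod (\<eta> - z))" by blast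
    define d where "d = Min ((\<lambda>\<xi>. cmod (\<xi> - \<eta>)) ` S)"
    have "0 < d" unfolding d_def using insert.hyps by (subst Min_gr_iff) auto
    have d: "d \<le> cmod (\<xi> - \<eta>)" if "\<xi> \<in> S" for \<xi>
      unfolding d_def using insert.hyps that by (intro Min_le) auto
    have "\<exists>\<xi>\<in>insert \<eta> S. c * d / 2 * cmod (\<xi> - z) \<le> (\<Prod>\<eta>\<in>insert \<eta> S. cmod (\<eta> - z))" for z
    proof -
      obtain \<xi> where \<xi>: "\<xi> \<in> S" "c * cmod (\<xi> - z) \<le> (\<Prod>\<eta>\<in>S. cmod (\<eta> - z))" using c(2) by blast
      have prod: "cmod (\<eta> - z) * (c * cmod (\<xi> - z)) \<le> (\<Prod>\<eta>\<in>insert \<eta> S. cmod (\<eta> - z))"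
        using insert.hyps \<xi>(2) by (simp add: mult_left_mono)
      have "d \<le> cmod (\<xi> - z) + cmod (\<eta> - z)"
        using d[OF \<xi>(1)] norm_triangle_ineq4[of "\<xi> - z" "\<eta> - z"] by simp
      \<comment> \<open>z cannot be closer than d/2 to both \<xi> and \<eta>; the far factor is
        bounded below, the other one is kept.\<close>
      then consider "d / 2 \<le> cmod (\<xi> - z)" | "d / 2 \<le> cmod (\<eta> - z)" by linarith
      then show ?thesis
      proof cases
        case 1
        have "c * d / 2 * cmod (\<eta> - z) = cmod (\<eta> - z) * (c * (d / 2))" by simp
        also have "\<dots> \<le> cmod (\<eta> - z) * (c * cmod (\<xi> - z))"
          using 1 c(1) by (intro mult_left_mono) auto
        finally show ?thesis using prod by (meson insertI1 order_trans)
      next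
        case 2
        have "c * d / 2 * cmod (\<xi> - z) = (d / 2) * (c * cmod (\<xi> - z))" by simp
        also have "\<dots> \<le> cmod (\<eta> - z) * (c * cmod (\<xi> - z))"
          using 2 c(1) by (intro mult_right_mono) auto
        finally show ?thesis using prod \<xi>(1) by (meson insertI2 order_trans)
      qed
    qed
    moreover have "0 < c * d / 2" using \<open>0 < c\<close> \<open>0 < d\<close> by simp
    ultimately show ?case by blast
  qed
  then show ?thesis using that by blast
qed

section \<open>Resolvents\<close>

lemma cblinfun_inverse_of_unique:
  assumes "cblinfun_inverse_of S B" "cblinfun_inverse_of S B'"
  shows "B = B'"
proof (rule cblinfun_eqI)
  fix x
  have "cblinfun_apply B x = cblinfun_apply B (cblinfun_apply (S o\<^sub>C B') x)"
    using assms(2) by (simp add: cblinfun_inverse_of_def cblinfun_apply_id)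
  also have "\<dots> = cblinfun_apply (B o\<^sub>C S) (cblinfun_apply B' x)"
    by (simp add: cblinfun_apply_compose)
  also have "\<dots> = cblinfun_apply B' x"
    using assms(1) by (simp add: cblinfun_inverse_of_def cblinfun_apply_id)
  finally show "cblinfun_apply B x = cblinfun_apply B' x" .
qed

lemma resolvent_inverse:
  assumes "z \<notin> spectrum T"
  shows "z *\<^sub>C cblinfun_apply (resolvent z T) x - cblinfun_apply T (cblinfun_apply (resolvent z T) x) = x"
    and "z *\<^sub>C cblinfun_apply (resolvent z T) x - cblinfun_apply (resolvent z T) (cblinfun_apply T x) = x"
proof -
  obtain B where B: "cblinfun_inverse_of (z *\<^sub>C cblinfun_id - T) B"
    using assms by (auto simp: spectrum_def)
  have inv: "cblinfun_inverse_of (z *\<^sub>C cblinfun_id - T) (resolvent z T)"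
    unfolding resolvent_def by (rule theI) (rule B cblinfun_inverse_of_unique[OF _ B])+
  have "cblinfun_apply ((z *\<^sub>C cblinfun_id - T) o\<^sub>C resolvent z T) x = x"
    "cblinfun_apply (resolvent z T o\<^sub>C (z *\<^sub>C cblinfun_id - T)) x = x"
    using inv by (simp_all add: cblinfun_inverse_of_def cblinfun_apply_id)
  then show "z *\<^sub>C cblinfun_apply (resolvent z T) x - cblinfun_apply T (cblinfun_apply (resolvent z T) x) = x"
    "z *\<^sub>C cblinfun_apply (resolvent z T) x - cblinfun_apply (resolvent z T) (cblinfun_apply T x) = x"
    by (simp_all add: cblinfun_apply_compose cblinfun_apply_diff_left cblinfun_apply_scaleC_left
        cblinfun_apply_id cblinfun_apply_diff cblinfun_apply_scaleC)
qed

lemma resolvent_commute: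
  fixes T :: "('a::complex_normed_vector, 'a) cblinfun"
  assumes "z \<notin> spectrum T"
  shows "cblinfun_apply (resolvent z T) (cblinfun_apply T x) = cblinfun_apply T (cblinfun_apply (resolvent z T) x)"
proof -
  have "a - t = x \<Longrightarrow> a - t' = x \<Longrightarrow> t' = t" for a t t' x :: 'a by auto
  then show ?thesis using resolvent_inverse[OF assms, of x] .
qed

lemma scaleC_diff_left: "(a - b) *\<^sub>C (x :: 'a::complex_normed_vector) = a *\<^sub>C x - b *\<^sub>C x"
  using scaleC_add_left[of "a - b" b x] by simp

lemma resolvent_identity:
  fixes T :: "('a::complex_normed_vector, 'a) cblinfun"
  assumes z: "z \<notin> spectrum T" and w: "w \<notin> spectrum T"
  shows "cblinfun_apply (resolvent w T) x - cblinfun_apply (resolvent z T) x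
    = (z - w) *\<^sub>C cblinfun_apply (resolvent w T) (cblinfun_apply (resolvent z T) x)"
proof -
  have eliminate: "p = a - t \<Longrightarrow> v = b - t \<Longrightarrow> p - v = a - b" for p v a b t :: 'a by simp
  define v where "v = cblinfun_apply (resolvent z T) x"
  have x: "x = z *\<^sub>C v - cblinfun_apply T v"
    using resolvent_inverse(1)[OF z, of x] by (simp add: v_def)
  have "cblinfun_apply (resolvent w T) x
      = z *\<^sub>C cblinfun_apply (resolvent w T) v - cblinfun_apply (resolvent w T) (cblinfun_apply T v)"
    unfolding x by (simp add: cblinfun_apply_diff cblinfun_apply_scaleC)
  moreover have "v = w *\<^sub>C cblinfun_apply (resolvent w T) v - cblinfun_apply (resolvent w T) (cblinfun_apply T v)"
    using resolvent_inverse(2)[OF w, of v] by simp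
  ultimately have "cblinfun_apply (resolvent w T) x - v
      = z *\<^sub>C cblinfun_apply (resolvent w T) v - w *\<^sub>C cblinfun_apply (resolvent w T) v"
    by (rule eliminate)
  then show ?thesis by (simp add: v_def scaleC_diff_left)
qed

text \<open>A scalar stand-in for the resolvent, to which complex analysis and dominated convergence
  apply directly.\<close>

definition resolvent_form ::
  "('a::complex_normed_vector, 'a) cblinfun \<Rightarrow> 'a cdual \<Rightarrow> 'a \<Rightarrow> complex \<Rightarrow> complex"
  where "resolvent_form T y x z = cblinfun_apply y (cblinfun_apply (resolvent z T) x)"

text \<open>Under the resolvent, T acts as multiplication by z up to a term free of the resolvent,
  which contour integration will remove.\<close>

lemma resolvent_form_T:
  assumes "z \<notin> spectrum T"
  shows "resolvent_form T y (cblinfun_apply T x) z = z * resolvent_form T y x z - cblinfun_apply y x"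
proof -
  have "cblinfun_apply (resolvent z T) (cblinfun_apply T x) = z *\<^sub>C cblinfun_apply (resolvent z T) x - x"
    using resolvent_inverse(2)[OF assms, of x] by (simp add: algebra_simps)
  then show ?thesis
    by (simp add: resolvent_form_def cblinfun_apply_diff cblinfun_apply_scaleC scaleC_complex_def)
qed

text \<open>Norm bounds on vectors suffice for holomorphy and for deforming contours. R-boundedness
  comes in later, through the hypothesis \<open>D\<close> of
  \<open>series_calculus_bound\<close>.\<close>

locale peripheral_operator = peripheral_set +
  fixes T :: "('a::complex_banach, 'a) cblinfun"
  assumes spectrum_subset: "spectrum T \<subseteq> closure (E_dom \<xi>s r)"
    and resolvent_bound: "\<And>s. r < s \<Longrightarrow> s < 1 \<Longrightarrow> \<exists>C>0. \<forall>z\<in>ball 0 2 - closure (E_dom \<xi>s s). \<forall>x.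
      norm ((\<Prod>\<xi>\<in>set \<xi>s. \<xi> - z) *\<^sub>C cblinfun_apply (resolvent z T) x) \<le> C * norm x"
begin

definition EP :: "complex \<Rightarrow> complex"
  where "EP z = (\<Prod>\<xi>\<in>set \<xi>s. 1 - cnj \<xi> * z)"

text \<open>The factors differ by the unimodular cnj \<xi>, so the resolvent bounds of
  \<open>R_type\<close>, stated with \<xi> - z, carry over to \<open>EP\<close>, which matches
  \<open>E_prod\<close>.\<close>

lemma cmod_EP: "cmod (EP z) = (\<Prod>\<xi>\<in>set \<xi>s. cmod (\<xi> - z))"
  unfolding EP_def prod_norm[symmetric]
proof (rule prod.cong[OF refl])
  fix \<xi> assume \<xi>: "\<xi> \<in> set \<xi>s"
  have "1 - cnj \<xi> * z = cnj \<xi> * (\<xi> - z)"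
    using xi_cnj[OF \<xi>] by (simp add: right_diff_distrib mult.commute)
  then show "cmod (1 - cnj \<xi> * z) = cmod (\<xi> - z)" using cmod_xi[OF \<xi>] by (simp add: norm_mult)
qed

lemma EP_eq_0_iff: "EP z = 0 \<longleftrightarrow> z \<in> set \<xi>s"
  using arg_cong[OF cmod_EP, of "\<lambda>x. x = 0"] by (auto simp: prod_zero_iff)

lemma holomorphic_EP [holomorphic_intros]: "f holomorphic_on S \<Longrightarrow> (\<lambda>z. EP (f z)) holomorphic_on S"
  unfolding EP_def by (intro holomorphic_intros)

lemma continuous_on_EP [continuous_intros]:
  fixes f :: "'t::topological_space \<Rightarrow> complex"
  shows "continuous_on S f \<Longrightarrow> continuous_on S (\<lambda>z. EP (f z))"
  unfolding EP_def by (intro continuous_intros)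

definition W :: "real \<Rightarrow> complex set"
  where "W s = ball 0 2 - closure (E_dom \<xi>s s)"

lemma open_W: "open (W s)"
  by (simp add: W_def open_Diff)

lemma W_not_spectrum:
  assumes "r \<le> s" "z \<in> W s"
  shows "z \<notin> spectrum T"
proof
  assume "z \<in> spectrum T"
  then have "z \<in> closure (E_dom \<xi>s s)"
    using spectrum_subset closure_mono[OF E_dom_mono[OF assms(1)]] by blast
  then show False using assms(2) by (simp add: W_def)
qed

lemma xi_in_closure: "0 < s \<Longrightarrow> set \<xi>s \<subseteq> closure (E_dom \<xi>s s)"
  unfolding closure_E_dom by (intro subsetI closure_subset[THEN subsetD] hull_inc) auto

lemma W_EP_nonzero:
  assumes "r \<le> s" "z \<in> W s"
  shows "EP z \<noteq> 0"
  using xi_in_closure[of s] assms r_pos by (auto simp: EP_eq_0_iff W_def)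

lemma resolvent_form_bound:
  assumes "r < s" "s < 1"
  obtains C where "0 < C"
    "\<And>z x y. z \<in> W s \<Longrightarrow> cmod (EP z * resolvent_form T y x z) \<le> C * norm x * norm y"
proof -
  obtain C where "0 < C" and C: "\<And>z x. z \<in> W s \<Longrightarrow>
      norm ((\<Prod>\<xi>\<in>set \<xi>s. \<xi> - z) *\<^sub>C cblinfun_apply (resolvent z T) x) \<le> C * norm x"
    using resolvent_bound[OF assms] unfolding W_def by blast
  have "cmod (EP z * resolvent_form T y x z) \<le> C * norm x * norm y" if "z \<in> W s" for z x and y :: "'a cdual"
  proof -
    have "cmod (EP z * resolvent_form T y x z) = cmod (\<Prod>\<xi>\<in>set \<xi>s. \<xi> - z) * cmod (resolvent_form T y x z)"
      by (simp add: norm_mult cmod_EP prod_norm)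
    also have "\<dots> \<le> cmod (\<Prod>\<xi>\<in>set \<xi>s. \<xi> - z) * (norm y * norm (cblinfun_apply (resolvent z T) x))"
      unfolding resolvent_form_def by (intro mult_left_mono cblinfun_norm_apply) simp
    also have "\<dots> = norm y * norm ((\<Prod>\<xi>\<in>set \<xi>s. \<xi> - z) *\<^sub>C cblinfun_apply (resolvent z T) x)"
      by (simp add: norm_scaleC)
    also have "\<dots> \<le> norm y * (C * norm x)" by (intro mult_left_mono C that) simp
    finally show ?thesis by (simp add: mult_ac)
  qed
  with \<open>0 < C\<close> show ?thesis by (rule that)
qed

lemma resolvent_form_diff:
  assumes "r \<le> s" "z \<in> W s" "w \<in> W s"
  shows "resolvent_form T y x w - resolvent_form T y x z
    = - (w - z) * resolvent_form T y (cblinfun_apply (resolvent z T) x) w"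
proof -
  have "cblinfun_apply y (cblinfun_apply (resolvent w T) x - cblinfun_apply (resolvent z T) x)
      = cblinfun_apply y ((z - w) *\<^sub>C cblinfun_apply (resolvent w T) (cblinfun_apply (resolvent z T) x))"
    by (simp add: resolvent_identity W_not_spectrum[OF assms(1)] assms)
  then show ?thesis
    by (simp add: resolvent_form_def cblinfun_apply_diff cblinfun_apply_scaleC scaleC_complex_def)
qed

text \<open>By the resolvent identity the increment is w - z times a resolvent, and this stays
  bounded near z because \<open>EP\<close> does not vanish there.\<close>

lemma resolvent_form_tendsto:
  assumes s: "r < s" "s < 1" and z: "z \<in> W s"
  shows "(resolvent_form T y x \<longlongrightarrow> resolvent_form T y x z) (at z)"
proof -
  obtain C where "0 < C" and C: "\<And>z x y. z \<in> W s \<Longrightarrow>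
      cmod (EP z * resolvent_form T y x z) \<le> C * norm x * norm y"
    using resolvent_form_bound[OF s] by blast
  define B where "B = C * norm (cblinfun_apply (resolvent z T) x) * norm y"
  have "isCont EP z"
    using continuous_on_EP[OF continuous_on_id, of UNIV] by (simp add: continuous_on_eq_continuous_at)
  then have EP: "(EP \<longlongrightarrow> EP z) (at z)" by (simp add: isCont_def)
  have "((\<lambda>w. cmod (w - z) * B / cmod (EP w)) \<longlongrightarrow> cmod (z - z) * B / cmod (EP z)) (at z)"
    using W_EP_nonzero[of s z] s z by (intro tendsto_intros EP) auto
  then have lim: "((\<lambda>w. cmod (w - z) * B / cmod (EP w)) \<longlongrightarrow> 0) (at z)" by simp
  have "eventually (\<lambda>w. w \<in> W s) (at z)"
    using open_W z by (auto simp: eventually_at_topological)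
  then have "eventually (\<lambda>w. cmod (resolvent_form T y x w - resolvent_form T y x z)
      \<le> cmod (w - z) * B / cmod (EP w)) (at z)"
  proof eventually_elim
    case (elim w)
    have nz: "EP w \<noteq> 0" by (rule W_EP_nonzero[OF _ elim]) (use s in simp)
    have "cmod (resolvent_form T y (cblinfun_apply (resolvent z T) x) w) \<le> B / cmod (EP w)"
      using C[OF elim, of y "cblinfun_apply (resolvent z T) x"] nz by (simp add: B_def norm_mult field_simps)
    then have "cmod (w - z) * cmod (resolvent_form T y (cblinfun_apply (resolvent z T) x) w)
        \<le> cmod (w - z) * (B / cmod (EP w))" by (intro mult_left_mono) auto
    then show ?case
      unfolding resolvent_form_diff[OF less_imp_le[OF s(1)] z elim] norm_mult norm_minus_cancel by simp
  qed
  from Lim_null_comparison[OF this lim] show ?thesis by (simp add: LIM_zero_iff)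
qed

text \<open>The resolvent identity turns the difference quotient at z into the negative form of the
  vector \<open>v\<close>, which is already known to converge.\<close>

lemma holomorphic_resolvent_form:
  assumes s: "r < s" "s < 1"
  shows "resolvent_form T y x holomorphic_on W s"
  unfolding holomorphic_on_open[OF open_W]
proof
  fix z assume z: "z \<in> W s"
  define v where "v = cblinfun_apply (resolvent z T) x"
  have "((\<lambda>w. - resolvent_form T y v w) \<longlongrightarrow> - resolvent_form T y v z) (at z)"
    by (intro tendsto_minus resolvent_form_tendsto[OF s z])
  moreover have "eventually (\<lambda>w. w \<in> W s \<and> w \<noteq> z) (at z)"
    using open_W z by (auto simp: eventually_at_topological)
  then have "eventually (\<lambda>w. - resolvent_form T y v w
      = (resolvent_form T y x w - resolvent_form T y x z) / (w - z)) (at z)"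
    by eventually_elim (use resolvent_form_diff[OF less_imp_le[OF s(1)] z] in \<open>simp add: v_def field_simps\<close>)
  ultimately have "((\<lambda>w. (resolvent_form T y x w - resolvent_form T y x z) / (w - z))
      \<longlongrightarrow> - resolvent_form T y v z) (at z)"
    by (rule Lim_transform_eventually)
  then show "\<exists>f'. (resolvent_form T y x has_field_derivative f') (at z)"
    unfolding has_field_derivative_iff by blast
qed

end

section \<open>Contour integrals over the boundaries\<close>

text \<open>The offset 2 starts the sequence at the midpoint of t and 1, so all its values lie
  strictly between them.\<close>

definition toward_1 :: "real \<Rightarrow> nat \<Rightarrow> real"
  where "toward_1 t n = 1 - (1 - t) / real (n + 2)"

lemma toward_1:
  assumes "t < 1"
  shows "t < toward_1 t n" "toward_1 t n < 1" "toward_1 t 0 \<le> toward_1 t n"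
proof -
  have "(1 - t) / real (n + 2) < (1 - t) / 1" using assms by (intro divide_strict_left_mono) auto
  then show "t < toward_1 t n" by (simp add: toward_1_def)
  show "toward_1 t n < 1" using assms by (simp add: toward_1_def)
  have "(1 - t) / real (n + 2) \<le> (1 - t) / real (0 + 2)" using assms by (intro divide_left_mono) auto
  then show "toward_1 t 0 \<le> toward_1 t n" by (simp add: toward_1_def)
qed

lemma toward_1_tendsto: "toward_1 t \<longlonglongrightarrow> 1"
proof -
  have "(\<lambda>n. (1 - t) / real (n + 2)) \<longlonglongrightarrow> 0"
    using LIMSEQ_ignore_initial_segment[OF lim_const_over_n[of "1 - t"], of 2] by simp
  from tendsto_diff[OF tendsto_const[of 1] this] show ?thesis by (simp add: toward_1_def[abs_def])
qed

lemma continuous_dominated_integrable: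
  fixes f :: "real \<Rightarrow> 'b::euclidean_space"
  assumes "finite Q" "continuous_on ({a..b} - Q) f" "g integrable_on ({a..b} - Q)"
    and "\<And>x. x \<in> {a..b} - Q \<Longrightarrow> norm (f x) \<le> g x"
  shows "f integrable_on ({a..b} - Q)"
proof (rule measurable_bounded_by_integrable_imp_integrable)
  have "Q \<in> sets borel" using assms(1) by (simp add: finite_imp_closed)
  then have "{a..b} - Q \<in> sets borel" by simp
  then show S: "{a..b} - Q \<in> sets lebesgue" by (simp add: sets_completionI_sets)
  show "f \<in> borel_measurable (lebesgue_on ({a..b} - Q))"
    by (rule continuous_imp_measurable_on_sets_lebesgue[OF assms(2) S])
qed (use assms in auto)

lemma integrable_on_diff_finite:
  fixes f :: "real \<Rightarrow> 'b::euclidean_space"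
  assumes "finite Q" "f integrable_on S"
  shows "f integrable_on (S - Q)"
  by (rule integrable_spike_set[OF assms(2)]) (auto intro: negligible_subset[OF negligible_finite[OF assms(1)]])

lemma has_integral_diff_finite_iff:
  fixes f :: "real \<Rightarrow> 'b::euclidean_space"
  assumes "finite Q"
  shows "(f has_integral I) (S - Q) \<longleftrightarrow> (f has_integral I) S"
  by (rule has_integral_spike_set_eq) (auto intro: negligible_subset[OF negligible_finite[OF assms]])

section \<open>The boundaries as closed paths, and Cauchy's theorem on them\<close>

context peripheral_set
begin

definition regular :: "real \<Rightarrow> real set"
  where "regular u = {0..2*pi} - singular_angles u"

text \<open>Parametrised by [0, 1], as paths are; \<tau> = 1 gives the boundary itself, 0 < \<tau> <
  1 a dilated copy outside it.\<close>

definition bdry_path :: "real \<Rightarrow> real \<Rightarrow> real \<Rightarrow> complex"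
  where "bdry_path u \<tau> x = E_bdry \<xi>s u (2 * pi * x) / of_real \<tau>"

lemma bdry_path_deriv:
  assumes "r \<le> u" "u < 1" "2 * pi * x \<in> regular u"
  shows "(bdry_path u \<tau> has_vector_derivative (2 * pi) *\<^sub>R (E_bdry_deriv u (2 * pi * x) / of_real \<tau>)) (at x)"
proof -
  have "((\<lambda>x. 2 * pi * x) has_vector_derivative 2 * pi) (at x)"
    unfolding has_real_derivative_iff_has_vector_derivative[symmetric] by (auto intro!: derivative_eq_intros)
  moreover have "(E_bdry \<xi>s u has_vector_derivative E_bdry_deriv u (2 * pi * x)) (at (2 * pi * x))"
    by (rule E_bdry_has_vector_derivative[OF assms(1,2)]) (use assms(3) in \<open>simp add: regular_def\<close>)
  ultimately have "((E_bdry \<xi>s u \<circ> (\<lambda>x. 2 * pi * x)) has_vector_derivative (2 * pi) *\<^sub>R E_bdry_deriv u (2 * pi * x)) (at x)"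
    by (rule vector_diff_chain_at)
  from bounded_linear.has_vector_derivative[OF bounded_linear_divide this, of "of_real \<tau>"]
  moreover have "(\<lambda>x. (E_bdry \<xi>s u \<circ> (\<lambda>x. 2 * pi * x)) x / of_real \<tau>) = bdry_path u \<tau>"
    by (simp add: fun_eq_iff bdry_path_def)
  ultimately show ?thesis by (simp only: scaleR_conv_of_real times_divide_eq_right)
qed

lemma bdry_path_valid:
  assumes u: "r \<le> u" "u < 1"
  shows "valid_path (bdry_path u \<tau>)" "pathfinish (bdry_path u \<tau>) = pathstart (bdry_path u \<tau>)"
proof -
  show "pathfinish (bdry_path u \<tau>) = pathstart (bdry_path u \<tau>)"
    by (simp add: pathfinish_def pathstart_def bdry_path_def E_bdry_periodic)
  define Q where "Q = (\<lambda>\<theta>. \<theta> / (2 * pi)) ` singular_angles u"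
  have "finite Q" by (simp add: Q_def finite_singular_angles)
  have reg: "2 * pi * x \<in> regular u" if "x \<in> {0..1} - Q" for x
  proof -
    have "2 * pi * x \<notin> singular_angles u"
    proof
      assume "2 * pi * x \<in> singular_angles u"
      then have "2 * pi * x / (2 * pi) \<in> Q" unfolding Q_def by blast
      then show False using that by simp
    qed
    then show ?thesis using that by (simp add: regular_def)
  qed
  have "continuous_on {0..1} (bdry_path u \<tau>)"
    unfolding bdry_path_def[abs_def] divide_inverse
    by (intro continuous_intros continuous_on_compose2[OF continuous_on_E_bdry[OF u]]) auto
  moreover have "bdry_path u \<tau> C1_differentiable_on ({0..1} - Q)"
    unfolding C1_differentiable_on_def
  proof (intro exI conjI ballI)
    show "(bdry_path u \<tau> has_vector_derivative (2 * pi) *\<^sub>R (E_bdry_deriv u (2 * pi * x) / of_real \<tau>)) (at x)"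
      if "x \<in> {0..1} - Q" for x by (rule bdry_path_deriv[OF u reg[OF that]])
    show "continuous_on ({0..1} - Q) (\<lambda>x. (2 * pi) *\<^sub>R (E_bdry_deriv u (2 * pi * x) / of_real \<tau>))"
      unfolding divide_inverse
      by (intro continuous_intros continuous_on_compose2[OF continuous_on_E_bdry_deriv[OF u]])
         (use reg in \<open>auto simp: regular_def\<close>)
  qed
  ultimately show "valid_path (bdry_path u \<tau>)"
    unfolding valid_path_def piecewise_C1_differentiable_on_def using \<open>finite Q\<close> by blast
qed

lemma path_image_bdry_path_subset:
  assumes "\<And>\<theta>. E_bdry \<xi>s u \<theta> / of_real \<tau> \<in> S"
  shows "path_image (bdry_path u \<tau>) \<subseteq> S"
  using assms by (auto simp: path_image_def bdry_path_def)

lemma has_contour_integral_bdry_path: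
  assumes u: "r \<le> u" "u < 1" and f: "(f has_contour_integral I) (bdry_path u \<tau>)"
  shows "((\<lambda>\<theta>. f (E_bdry \<xi>s u \<theta> / of_real \<tau>) * (E_bdry_deriv u \<theta> / of_real \<tau>)) has_integral I) (regular u)"
proof -
  define k where "k x = f (bdry_path u \<tau> x) * vector_derivative (bdry_path u \<tau>) (at x within {0..1})" for x
  have "(k has_integral I) {0..1}" using f unfolding has_contour_integral_def k_def .
  from has_integral_stretch_real[OF this, of "1 / (2 * pi)"]
  have "((\<lambda>\<theta>. k (1 / (2 * pi) * \<theta>)) has_integral (2 * pi) *\<^sub>R I) ((\<lambda>x. x / (1 / (2 * pi))) ` {0..1})"
    by simp
  moreover have "(\<lambda>x. x / (1 / (2 * pi))) ` {0..1} = {0..2 * pi}"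
    using image_mult_atLeastAtMost[of "2 * pi" 0 1] by (simp add: mult.commute)
  ultimately have "((\<lambda>\<theta>. k (\<theta> / (2 * pi))) has_integral (2 * pi) *\<^sub>R I) {0..2 * pi}"
    by simp
  from has_integral_cmul[OF this, of "inverse (2 * pi)"]
  have "((\<lambda>\<theta>. inverse (2 * pi) *\<^sub>R k (\<theta> / (2 * pi))) has_integral I) {0..2 * pi}"
    by simp
  then have "((\<lambda>\<theta>. inverse (2 * pi) *\<^sub>R k (\<theta> / (2 * pi))) has_integral I) (regular u)"
    unfolding regular_def has_integral_diff_finite_iff[OF finite_singular_angles] .
  moreover have "inverse (2 * pi) *\<^sub>R k (\<theta> / (2 * pi))
      = f (E_bdry \<xi>s u \<theta> / of_real \<tau>) * (E_bdry_deriv u \<theta> / of_real \<tau>)" if \<theta>: "\<theta> \<in> regular u" for \<theta>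
  proof -
    define x where "x = \<theta> / (2 * pi)"
    have x: "2 * pi * x = \<theta>" "0 \<le> x" "x \<le> 1" using \<theta> by (auto simp: x_def regular_def field_simps)
    have "vector_derivative (bdry_path u \<tau>) (at x within {0..1}) = (2 * pi) *\<^sub>R (E_bdry_deriv u \<theta> / of_real \<tau>)"
      using vector_derivative_at_within_ivl[OF bdry_path_deriv[OF u, of x \<tau>], of 0 1] x \<theta> by simp
    then show ?thesis
      unfolding x_def[symmetric] k_def by (simp add: bdry_path_def x(1) scaleR_conv_of_real)
  qed
  ultimately show ?thesis by (rule has_integral_eq[rotated])
qed

text \<open>The set on which z -> \<phi>(t z) is defined. For 0 <= t < 1 it is a convex
  neighbourhood of the whole contour, corners included.\<close>

definition V :: "real \<Rightarrow> real \<Rightarrow> complex set"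
  where "V s t = {z. of_real t * z \<in> E_dom \<xi>s s}"

lemma open_V: "open (V s t)"
proof -
  have "V s t = (\<lambda>z. of_real t * z) -` E_dom \<xi>s s" by (auto simp: V_def)
  then show ?thesis by (simp add: open_vimage open_E_dom continuous_intros)
qed

lemma convex_V: "convex (V s t)"
proof -
  have "V s t = (\<lambda>z. t *\<^sub>R z) -` E_dom \<xi>s s" by (auto simp: V_def scaleR_conv_of_real)
  moreover have "linear (\<lambda>z :: complex. t *\<^sub>R z)" by (rule linear_scaleR)
  ultimately show ?thesis using convex_linear_vimage[OF _ convex_E_dom] by metis
qed

text \<open>Type r bounds the resolvent inside the disc of radius 2 only; t > 1/2 keeps the dilated
  contours in it.\<close>

lemma V_subset_ball:
  assumes "s \<le> 1" "1/2 < t"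
  shows "V s t \<subseteq> ball 0 2"
proof
  fix z assume "z \<in> V s t"
  then have "cmod (of_real t * z) < 1" using E_dom_subset_ball[OF assms(1)] by (auto simp: V_def)
  then have "t * cmod z < 1" using assms(2) by (simp add: norm_mult)
  moreover have "1/2 * cmod z \<le> t * cmod z" using assms(2) by (intro mult_right_mono) auto
  ultimately show "z \<in> ball 0 2" by simp
qed

lemma scaled_closure_in_V:
  assumes "0 < u" "u \<le> s" "0 \<le> t" "t < \<tau>" "z \<in> closure (E_dom \<xi>s u)"
  shows "z / of_real \<tau> \<in> V s t"
proof -
  have "of_real (t / \<tau>) * z \<in> E_dom \<xi>s u"
    by (rule shrink_in_E_dom) (use assms in auto)
  then show ?thesis using E_dom_mono[OF assms(2)] by (auto simp: V_def)
qed

definition bint :: "real \<Rightarrow> (complex \<Rightarrow> complex) \<Rightarrow> complex"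
  where "bint u f = integral (regular u) (\<lambda>\<theta>. f (E_bdry \<xi>s u \<theta>) * E_bdry_deriv u \<theta>)"

definition bintegrable :: "real \<Rightarrow> (complex \<Rightarrow> complex) \<Rightarrow> bool"
  where "bintegrable u f \<longleftrightarrow> (\<lambda>\<theta>. f (E_bdry \<xi>s u \<theta>) * E_bdry_deriv u \<theta>) integrable_on regular u"

text \<open>V is convex and contains the contour, so integrands without a resolvent integrate to
  0.\<close>

lemma Cauchy_bdry:
  assumes u: "r \<le> u" "u < 1" "u \<le> s" and t: "0 \<le> t" "t < 1" and h: "h holomorphic_on V s t"
  shows "bintegrable u h" "bint u h = 0"
proof -
  have "(h has_contour_integral 0) (bdry_path u 1)"
  proof (rule Cauchy_theorem_convex_simple[OF h convex_V])
    show "path_image (bdry_path u 1) \<subseteq> V s t"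
      using scaled_closure_in_V[OF _ u(3) t E_bdry_in_closure[OF u(1,2)]] u r_pos
      by (intro path_image_bdry_path_subset) auto
  qed (intro bdry_path_valid u)+
  from has_contour_integral_bdry_path[OF u(1,2) this]
  have "((\<lambda>\<theta>. h (E_bdry \<xi>s u \<theta>) * E_bdry_deriv u \<theta>) has_integral 0) (regular u)" by simp
  then show "bintegrable u h" "bint u h = 0"
    by (auto simp: bintegrable_def bint_def has_integral_iff)
qed

lemma integrable_const_regular: "(\<lambda>_. c :: real) integrable_on regular u"
  unfolding regular_def by (intro integrable_on_diff_finite finite_singular_angles integrable_const_ivl)

end

section \<open>Approximation by dilated contours, and independence of \<open>u\<close>\<close>

context peripheral_operator
begin

text \<open>The contours \<open>E_bdry u\<close> all pass through the points of \<open>E\<close>, where the resolvent is singular.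
  Dilating them by \<open>1 / \<tau>\<close> moves them into the open set where the integrand is holomorphic.\<close>

lemma scaled_bdry_in_domain:
  assumes "r \<le> u" "u < s" "s < 1" "s' \<le> u" "1/2 < t" "t < \<tau>" "\<tau> < 1"
  shows "E_bdry \<xi>s u \<theta> / of_real \<tau> \<in> V s t \<inter> W s'"
proof -
  have u: "r \<le> u" "u < 1" using assms by auto
  have V: "E_bdry \<xi>s u \<theta> / of_real \<tau> \<in> V s t"
    by (rule scaled_closure_in_V[OF _ _ _ _ E_bdry_in_closure[OF u]]) (use assms r_pos in auto)
  moreover have "E_bdry \<xi>s u \<theta> / of_real \<tau> \<notin> closure (E_dom \<xi>s u)"
    by (rule E_bdry_scaled_notin_closure[OF u]) (use assms in auto)
  ultimately show ?thesis
    using V_subset_ball[of s t] closure_mono[OF E_dom_mono[OF assms(4)]] assms by (auto simp: W_def)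
qed

text \<open>Both end points lie on one ray at radius at least
  \<open>bdry_radius u \<theta> / \<tau>\<close>, so the segment stays on that ray beyond the
  boundary for \<open>u\<close>.\<close>

lemma scaled_segment_in_domain:
  assumes u: "r \<le> u" "u \<le> u'" "u' < s" "s < 1" and "s' \<le> u" and t: "1/2 < t" "t < \<tau>" "\<tau> < 1"
  shows "closed_segment (E_bdry \<xi>s u \<theta> / of_real \<tau>) (E_bdry \<xi>s u' \<theta> / of_real \<tau>) \<subseteq> V s t \<inter> W s'"
proof
  fix z assume z: "z \<in> closed_segment (E_bdry \<xi>s u \<theta> / of_real \<tau>) (E_bdry \<xi>s u' \<theta> / of_real \<tau>)"
  have u1: "r \<le> u" "u < 1" "r \<le> u'" "u' < 1" using u by auto
  have "E_bdry \<xi>s u \<theta> / of_real \<tau> \<in> V s t" "E_bdry \<xi>s u' \<theta> / of_real \<tau> \<in> V s t"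
    using scaled_bdry_in_domain[of u s u t \<tau> \<theta>] scaled_bdry_in_domain[of u' s u' t \<tau> \<theta>] u t by auto
  then have V: "z \<in> V s t" using z closed_segment_subset[OF _ _ convex_V] by blast
  obtain l where l: "0 \<le> l" "l \<le> 1"
    "z = (1 - l) *\<^sub>R (E_bdry \<xi>s u \<theta> / of_real \<tau>) + l *\<^sub>R (E_bdry \<xi>s u' \<theta> / of_real \<tau>)"
    using z unfolding in_segment by blast
  define \<rho> where "\<rho> = ((1 - l) * bdry_radius u \<theta> + l * bdry_radius u' \<theta>) / \<tau>"
  have z\<rho>: "z = of_real \<rho> * cis \<theta>"
  proof -
    have "a *\<^sub>R (of_real R * cis \<theta> / of_real \<tau>) = of_real (a * R / \<tau>) * cis \<theta>" for a R :: real
      by (simp add: scaleR_conv_of_real)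
    then show ?thesis
      unfolding l(3) \<rho>_def E_bdry_eq[OF u1(1,2)] E_bdry_eq[OF u1(3,4)]
      by (simp only: add_divide_distrib of_real_add distrib_right)
  qed
  have le: "bdry_radius u \<theta> \<le> bdry_radius u' \<theta>"
    using le_bdry_radius[OF u1(3,4), of "bdry_radius u \<theta>" \<theta>] bdry_in_closure[OF u1(1,2), of \<theta>]
      closure_mono[OF E_dom_mono[OF u(2)]] by blast
  have pos: "0 < bdry_radius u \<theta>" using bdry_radius_props(3)[OF u1(1,2), of \<theta>] u r_pos by linarith
  have "(1 - l) * bdry_radius u \<theta> + l * bdry_radius u \<theta> \<le> (1 - l) * bdry_radius u \<theta> + l * bdry_radius u' \<theta>"
    using le l by (intro add_left_mono mult_left_mono) auto
  moreover have "\<rho> * \<tau> = (1 - l) * bdry_radius u \<theta> + l * bdry_radius u' \<theta>"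
    using t by (simp add: \<rho>_def)
  ultimately have "bdry_radius u \<theta> \<le> \<rho> * \<tau>" by (simp add: algebra_simps)
  moreover have "\<rho> \<le> bdry_radius u \<theta>" if "z \<in> closure (E_dom \<xi>s u)"
    using le_bdry_radius[OF u1(1,2)] that z\<rho> by simp
  moreover have "bdry_radius u \<theta> * \<tau> < bdry_radius u \<theta> * 1"
    using pos t by (intro mult_strict_left_mono) auto
  moreover have "\<rho> * \<tau> \<le> bdry_radius u \<theta> * \<tau>" if "\<rho> \<le> bdry_radius u \<theta>"
    using that t by (intro mult_right_mono) auto
  ultimately have "z \<notin> closure (E_dom \<xi>s u)" by fastforce
  then have "z \<notin> closure (E_dom \<xi>s s')"
    using closure_mono[OF E_dom_mono[OF assms(5)]] by blast
  then show "z \<in> V s t \<inter> W s'"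
    using V V_subset_ball[of s t] u t by (auto simp: W_def)
qed

text \<open>At the corners \<open>f\<close> need not be defined, but it is bounded on the dilated
  contours. By dominated convergence the integral over the contour is a limit of ordinary contour
  integrals.\<close>

lemma scaled_bdry_integral_tendsto:
  assumes u: "r \<le> u" "u < s" "s < 1" and s': "s' < u" "r \<le> s'" and t: "1/2 < t" "t < 1"
    and f: "f holomorphic_on V s t \<inter> W s'"
    and bounded: "\<And>K. compact K \<Longrightarrow> K \<subseteq> V s t \<Longrightarrow> \<exists>B. \<forall>z\<in>K \<inter> W s'. cmod (f z) \<le> B"
  defines "\<tau> \<equiv> toward_1 t"
  shows "bintegrable u f"
    and "(\<lambda>n. integral (regular u) (\<lambda>\<theta>. f (E_bdry \<xi>s u \<theta> / of_real (\<tau> n)) * (E_bdry_deriv u \<theta> / of_real (\<tau> n))))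
      \<longlonglongrightarrow> bint u f"
proof -
  have u1: "r \<le> u" "u < 1" using u by auto
  note \<tau> = toward_1[OF t(2), folded \<tau>_def]
  note \<tau>_lim = toward_1_tendsto[of t, folded \<tau>_def]
  \<comment> \<open>The first factor \<tau> 0 is the smallest, so this compact set contains all the
    dilated contours.\<close>
  define K where "K = (\<lambda>z. z / of_real (\<tau> 0)) ` closure (E_dom \<xi>s u)"
  have "bounded (E_dom \<xi>s u)"
    using E_dom_subset_ball[of u] u by (intro bounded_subset[OF bounded_ball]) auto
  then have "compact K"
    unfolding K_def divide_inverse by (intro compact_continuous_image continuous_intros) (simp add: compact_closure)
  moreover have "K \<subseteq> V s t"
    unfolding K_def using scaled_closure_in_V[of u s t "\<tau> 0"] \<tau>(1)[of 0] u t r_pos by auto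
  ultimately have "\<exists>B. \<forall>z\<in>K \<inter> W s'. cmod (f z) \<le> B" by (rule bounded)
  then obtain B where B: "\<And>z. z \<in> K \<Longrightarrow> z \<in> W s' \<Longrightarrow> cmod (f z) \<le> B" by blast
  define L where "L = card (set \<xi>s) * (2 / u ^ 3) + 1"
  have L: "cmod (E_bdry_deriv u \<theta>) \<le> L" for \<theta>
    unfolding L_def by (rule E_bdry_deriv_bound[OF u1])
  have "0 \<le> L" using order_trans[OF norm_ge_zero L[of 0]] .
  have dom: "E_bdry \<xi>s u \<theta> / of_real (\<tau> n) \<in> V s t \<inter> W s'" for \<theta> n
    by (rule scaled_bdry_in_domain) (use u s' t \<tau> in auto)
  have inK: "E_bdry \<xi>s u \<theta> / of_real (\<tau> n) \<in> K" for \<theta> n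
  proof -
    have "of_real (\<tau> 0 / \<tau> n) * E_bdry \<xi>s u \<theta> \<in> closure (E_dom \<xi>s u)"
    proof (cases "\<tau> 0 = \<tau> n")
      case True
      then show ?thesis using E_bdry_in_closure[OF u1] \<tau>(1)[of n] t by simp
    next
      case False
      then have "\<tau> 0 / \<tau> n < 1" using \<tau>[of n] t by simp
      then have "of_real (\<tau> 0 / \<tau> n) * E_bdry \<xi>s u \<theta> \<in> E_dom \<xi>s u"
        using \<tau>[of n] \<tau>[of 0] t u r_pos by (intro shrink_in_E_dom E_bdry_in_closure[OF u1]) auto
      then show ?thesis using closure_subset by blast
    qed
    moreover have "E_bdry \<xi>s u \<theta> / of_real (\<tau> n) = (of_real (\<tau> 0 / \<tau> n) * E_bdry \<xi>s u \<theta>) / of_real (\<tau> 0)"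
      using \<tau>[of 0] t by simp
    ultimately show ?thesis unfolding K_def by blast
  qed
  have int: "(\<lambda>\<theta>. f (E_bdry \<xi>s u \<theta> / of_real (\<tau> n)) * (E_bdry_deriv u \<theta> / of_real (\<tau> n))) integrable_on regular u" for n
  proof -
    have "f contour_integrable_on bdry_path u (\<tau> n)"
      by (rule contour_integrable_holomorphic_simple[OF f _ bdry_path_valid(1)[OF u1]])
         (use dom open_V open_W in \<open>auto intro!: path_image_bdry_path_subset\<close>)
    then show ?thesis
      using has_contour_integral_bdry_path[OF u1] unfolding contour_integrable_on_def by blast
  qed
  have bound: "cmod (f (E_bdry \<xi>s u \<theta> / of_real (\<tau> n)) * (E_bdry_deriv u \<theta> / of_real (\<tau> n))) \<le> B * (L * 2)" for \<theta> n
  proof -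
    have fB: "cmod (f (E_bdry \<xi>s u \<theta> / of_real (\<tau> n))) \<le> B" using B[OF inK] dom by blast
    have "cmod (E_bdry_deriv u \<theta> / of_real (\<tau> n)) = cmod (E_bdry_deriv u \<theta>) * (1 / \<tau> n)"
      using \<tau>[of n] t by (simp add: norm_divide)
    also have "\<dots> \<le> L * 2"
      using \<tau>[of n] t L \<open>0 \<le> L\<close> by (intro mult_mono) (auto simp: field_simps)
    finally show ?thesis
      unfolding norm_mult using fB order_trans[OF norm_ge_zero fB] by (intro mult_mono) auto
  qed
  have conv: "(\<lambda>n. f (E_bdry \<xi>s u \<theta> / of_real (\<tau> n)) * (E_bdry_deriv u \<theta> / of_real (\<tau> n)))
      \<longlonglongrightarrow> f (E_bdry \<xi>s u \<theta>) * E_bdry_deriv u \<theta>" if \<theta>: "\<theta> \<in> regular u" for \<theta>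
  proof -
    have "E_bdry \<xi>s u \<theta> \<notin> closure (E_dom \<xi>s s')"
      by (rule E_bdry_notin_closure_smaller)
         (use u s' regular_angle_not_corner[OF u1] \<theta> in \<open>auto simp: regular_def\<close>)
    moreover have "E_bdry \<xi>s u \<theta> / of_real 1 \<in> V s t"
      by (rule scaled_closure_in_V[OF _ _ _ _ E_bdry_in_closure[OF u1]]) (use u t r_pos in auto)
    ultimately have "E_bdry \<xi>s u \<theta> \<in> V s t \<inter> W s'"
      using V_subset_ball[of s t] u t by (auto simp: W_def)
    then have cont: "isCont f (E_bdry \<xi>s u \<theta>)"
      using holomorphic_on_imp_continuous_on[OF f] open_V open_W
      by (simp add: continuous_on_eq_continuous_at open_Int)
    have "(\<lambda>n. E_bdry \<xi>s u \<theta> / of_real (\<tau> n)) \<longlonglongrightarrow> E_bdry \<xi>s u \<theta> / of_real 1"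
      by (intro tendsto_intros \<tau>_lim) auto
    then have "(\<lambda>n. f (E_bdry \<xi>s u \<theta> / of_real (\<tau> n))) \<longlonglongrightarrow> f (E_bdry \<xi>s u \<theta>)"
      by (intro isCont_tendsto_compose[OF cont]) simp
    moreover have "(\<lambda>n. E_bdry_deriv u \<theta> / of_real (\<tau> n)) \<longlonglongrightarrow> E_bdry_deriv u \<theta> / of_real 1"
      by (intro tendsto_intros \<tau>_lim) auto
    ultimately have "(\<lambda>n. f (E_bdry \<xi>s u \<theta> / of_real (\<tau> n)) * (E_bdry_deriv u \<theta> / of_real (\<tau> n)))
        \<longlonglongrightarrow> f (E_bdry \<xi>s u \<theta>) * (E_bdry_deriv u \<theta> / of_real 1)" by (rule tendsto_mult)
    then show ?thesis by simp
  qed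
  show "bintegrable u f" unfolding bintegrable_def
    by (rule dominated_convergence(1)[OF int integrable_const_regular bound conv])
  show "(\<lambda>n. integral (regular u) (\<lambda>\<theta>. f (E_bdry \<xi>s u \<theta> / of_real (\<tau> n)) * (E_bdry_deriv u \<theta> / of_real (\<tau> n))))
      \<longlonglongrightarrow> bint u f" unfolding bint_def
    by (rule dominated_convergence(2)[OF int integrable_const_regular bound conv])
qed

text \<open>The dilated contours for \<open>u\<close> and \<open>u'\<close> are homotopic along rays
  inside the domain of \<open>f\<close>; then the dilation tends to 1.\<close>

lemma bint_independent:
  assumes u: "r < u" "u \<le> u'" "u' < s" "s < 1" and s': "s' < u" "r \<le> s'" and t: "1/2 < t" "t < 1"
    and f: "f holomorphic_on V s t \<inter> W s'"
    and bounded: "\<And>K. compact K \<Longrightarrow> K \<subseteq> V s t \<Longrightarrow> \<exists>B. \<forall>z\<in>K \<inter> W s'. cmod (f z) \<le> B"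
  shows "bint u f = bint u' f"
proof -
  define \<tau> where "\<tau> = toward_1 t"
  note \<tau> = toward_1(1,2)[OF t(2), folded \<tau>_def]
  have u1: "r \<le> u" "u < 1" "r \<le> u'" "u' < 1" using u by auto
  have op: "open (V s t \<inter> W s')" by (intro open_Int open_V open_W)
  have dom: "E_bdry \<xi>s v \<theta> / of_real (\<tau> n) \<in> V s t \<inter> W s'" if "v = u \<or> v = u'" for v \<theta> n
    by (rule scaled_bdry_in_domain) (use that u s' t \<tau> in auto)
  have eq: "integral (regular u) (\<lambda>\<theta>. f (E_bdry \<xi>s u \<theta> / of_real (\<tau> n)) * (E_bdry_deriv u \<theta> / of_real (\<tau> n)))
    = integral (regular u') (\<lambda>\<theta>. f (E_bdry \<xi>s u' \<theta> / of_real (\<tau> n)) * (E_bdry_deriv u' \<theta> / of_real (\<tau> n)))" for n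
  proof -
    have hom: "homotopic_loops (V s t \<inter> W s') (bdry_path u (\<tau> n)) (bdry_path u' (\<tau> n))"
    proof (rule homotopic_loops_linear)
      show "closed_segment (bdry_path u (\<tau> n) x) (bdry_path u' (\<tau> n) x) \<subseteq> V s t \<inter> W s'" for x
        unfolding bdry_path_def by (rule scaled_segment_in_domain) (use u s' t \<tau> in auto)
    qed (intro valid_path_imp_path bdry_path_valid u1)+
    have same: "contour_integral (bdry_path u (\<tau> n)) f = contour_integral (bdry_path u' (\<tau> n)) f"
      by (rule Cauchy_theorem_homotopic_loops[OF hom op f]) (intro bdry_path_valid u1)+
    have "(f has_contour_integral contour_integral (bdry_path u (\<tau> n)) f) (bdry_path u (\<tau> n))"
      by (intro has_contour_integral_integral contour_integrable_holomorphic_simple[OF f op bdry_path_valid(1)]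
          path_image_bdry_path_subset dom u1 disjI1 disjI2 refl)
    note I1 = integral_unique[OF has_contour_integral_bdry_path[OF u1(1,2) this]]
    have "(f has_contour_integral contour_integral (bdry_path u' (\<tau> n)) f) (bdry_path u' (\<tau> n))"
      by (intro has_contour_integral_integral contour_integrable_holomorphic_simple[OF f op bdry_path_valid(1)]
          path_image_bdry_path_subset dom u1 disjI1 disjI2 refl)
    note I2 = integral_unique[OF has_contour_integral_bdry_path[OF u1(3,4) this]]
    show ?thesis unfolding I1 I2 same ..
  qed
  have "(\<lambda>n. integral (regular u) (\<lambda>\<theta>. f (E_bdry \<xi>s u \<theta> / of_real (\<tau> n)) * (E_bdry_deriv u \<theta> / of_real (\<tau> n)))) \<longlonglongrightarrow> bint u f"
    unfolding \<tau>_def by (rule scaled_bdry_integral_tendsto(2)[OF _ _ _ _ _ t f bounded]) (use u s' in auto)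
  moreover have "(\<lambda>n. integral (regular u') (\<lambda>\<theta>. f (E_bdry \<xi>s u' \<theta> / of_real (\<tau> n)) * (E_bdry_deriv u' \<theta> / of_real (\<tau> n)))) \<longlonglongrightarrow> bint u' f"
    unfolding \<tau>_def by (rule scaled_bdry_integral_tendsto(2)[OF _ _ _ _ _ t f bounded]) (use u s' in auto)
  ultimately show ?thesis unfolding eq by (rule LIMSEQ_unique)
qed

end

section \<open>The series expansion\<close>

text \<open>The antiderivative is sgn (x - p) * (\<psi>(|x - p|) - \<psi>(0)); the maxima write it
  as one formula that is continuous across p.\<close>

lemma has_integral_abs_shift:
  fixes \<psi> :: "real \<Rightarrow> real"
  assumes cont: "continuous_on {0..} \<psi>" and deriv: "\<And>x. 0 < x \<Longrightarrow> (\<psi> has_real_derivative \<psi>' x) (at x)"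
    and "a \<le> b"
  shows "((\<lambda>x. \<psi>' \<bar>x - p\<bar>) has_integral
    (\<psi> (max (b - p) 0) - \<psi> (max (p - b) 0)) - (\<psi> (max (a - p) 0) - \<psi> (max (p - a) 0))) {a..b}"
proof (rule fundamental_theorem_of_calculus_interior_strong[of "{p}"])
  show "continuous_on {a..b} (\<lambda>x. \<psi> (max (x - p) 0) - \<psi> (max (p - x) 0))"
    by (intro continuous_intros continuous_on_compose2[OF cont]) auto
  fix x assume "x \<in> {a<..<b} - {p}"
  then consider "x < p" | "p < x" by force
  then have "((\<lambda>x. \<psi> (max (x - p) 0) - \<psi> (max (p - x) 0)) has_real_derivative \<psi>' \<bar>x - p\<bar>) (at x)"
  proof cases
    case 1
    have "((\<lambda>x. \<psi> 0 - \<psi> (p - x)) has_real_derivative 0 - \<psi>' (p - x) * (0 - 1)) (at x)"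
      by (intro DERIV_diff DERIV_const DERIV_chain2[OF deriv] DERIV_ident) (use 1 in auto)
    then have "((\<lambda>x. \<psi> 0 - \<psi> (p - x)) has_real_derivative \<psi>' \<bar>x - p\<bar>) (at x)"
      using 1 by (simp add: abs_if)
    then show ?thesis
      by (rule has_field_derivative_transform_within_open[of _ _ _ "{..<p}"]) (use 1 in \<open>auto simp: max_def\<close>)
  next
    case 2
    have "((\<lambda>x. \<psi> (x - p) - \<psi> 0) has_real_derivative \<psi>' (x - p) * (1 - 0) - 0) (at x)"
      by (intro DERIV_diff DERIV_const DERIV_chain2[OF deriv] DERIV_ident) (use 2 in auto)
    then have "((\<lambda>x. \<psi> (x - p) - \<psi> 0) has_real_derivative \<psi>' \<bar>x - p\<bar>) (at x)"
      using 2 by (simp add: abs_if)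
    then show ?thesis
      by (rule has_field_derivative_transform_within_open[of _ _ _ "{p<..}"]) (use 2 in \<open>auto simp: max_def\<close>)
  qed
  then show "((\<lambda>x. \<psi> (max (x - p) 0) - \<psi> (max (p - x) 0)) has_vector_derivative \<psi>' \<bar>x - p\<bar>) (at x)"
    by (simp add: has_real_derivative_iff_has_vector_derivative)
qed (use assms in auto)

text \<open>The bound does not depend on p or on the interval. With c proportional to m + 1 it
  bounds the integrals of (m + 1) |z|^m uniformly in m.\<close>

lemma exp_abs_shift_integral:
  fixes a b c p :: real
  assumes "0 < c" "a \<le> b"
  shows "(\<lambda>x. exp (- c * \<bar>x - p\<bar>)) integrable_on {a..b}"
    and "integral {a..b} (\<lambda>x. exp (- c * \<bar>x - p\<bar>)) \<le> 2 / c"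
proof -
  define \<psi> where "\<psi> x = (1 - exp (- c * x)) / c" for x
  have cont: "continuous_on {0..} \<psi>"
    unfolding \<psi>_def using assms by (intro continuous_intros) auto
  have "(\<psi> has_real_derivative exp (- c * x)) (at x)" for x
    unfolding \<psi>_def using assms by (auto intro!: derivative_eq_intros)
  from has_integral_abs_shift[where \<psi>'="\<lambda>x. exp (- c * x)" and p=p, OF cont this assms(2)]
  have "((\<lambda>x. exp (- c * \<bar>x - p\<bar>)) has_integral
      (\<psi> (max (b - p) 0) - \<psi> (max (p - b) 0)) - (\<psi> (max (a - p) 0) - \<psi> (max (p - a) 0))) {a..b}" .
  moreover have "0 \<le> \<psi> x \<and> \<psi> x \<le> 1 / c" if "0 \<le> x" for x
    using that assms by (simp add: \<psi>_def divide_right_mono)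
  then have "(\<psi> (max (b - p) 0) - \<psi> (max (p - b) 0)) - (\<psi> (max (a - p) 0) - \<psi> (max (p - a) 0)) \<le> (1 / c - 0) - (0 - 1 / c)"
    by (intro diff_mono) auto
  ultimately show "(\<lambda>x. exp (- c * \<bar>x - p\<bar>)) integrable_on {a..b}"
    "integral {a..b} (\<lambda>x. exp (- c * \<bar>x - p\<bar>)) \<le> 2 / c"
    by (auto simp: has_integral_iff)
qed

text \<open>The exponent exceeds -1. This is the majorant at the corners, where only the decay of
  \<phi> weakens the singularity of the resolvent.\<close>

lemma powr_abs_shift_integrable:
  fixes a b p \<alpha> :: real
  assumes "0 < \<alpha>" "a \<le> b"
  shows "(\<lambda>x. \<bar>x - p\<bar> powr (\<alpha> - 1)) integrable_on {a..b}"
proof -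
  define \<psi> where "\<psi> x = x powr \<alpha> / \<alpha>" for x
  have cont: "continuous_on {0..} \<psi>" unfolding \<psi>_def using assms
    by (intro continuous_intros continuous_on_powr') auto
  have "(\<psi> has_real_derivative x powr (\<alpha> - 1)) (at x)" if "0 < x" for x
    unfolding \<psi>_def using assms that by (auto intro!: derivative_eq_intros)
  then show ?thesis
    by (rule has_integral_integrable[OF has_integral_abs_shift[where \<psi>'="\<lambda>x. x powr (\<alpha> - 1)", OF cont _ assms(2)]])
qed

text \<open>Near-maximisers can be chosen in each summand separately, so a bound valid for every
  choice of points also bounds the sum of the suprema.\<close>

lemma sum_SUP_le:
  fixes a :: "'k \<Rightarrow> 'i \<Rightarrow> real"
  assumes "finite I" "S \<noteq> {}" and bdd: "\<And>k. k \<in> I \<Longrightarrow> bdd_above (a k ` S)"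
    and le: "\<And>\<theta>. (\<And>k. k \<in> I \<Longrightarrow> \<theta> k \<in> S) \<Longrightarrow> (\<Sum>k\<in>I. a k (\<theta> k)) \<le> B"
  shows "(\<Sum>k\<in>I. SUP x\<in>S. a k x) \<le> B"
proof (rule field_le_epsilon)
  fix e :: real assume "0 < e"
  \<comment> \<open>The added 1 covers the empty index set.\<close>
  define d where "d = e / (real (card I) + 1)"
  have "0 < d" using \<open>0 < e\<close> by (simp add: d_def)
  have "\<exists>x\<in>S. (SUP x\<in>S. a k x) - d < a k x" if "k \<in> I" for k
    using less_cSUP_iff[OF \<open>S \<noteq> {}\<close> bdd[OF that], of "(SUP x\<in>S. a k x) - d"] \<open>0 < d\<close> by simp
  then obtain \<theta> where \<theta>: "\<And>k. k \<in> I \<Longrightarrow> \<theta> k \<in> S \<and> (SUP x\<in>S. a k x) - d < a k (\<theta> k)" by metis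
  have "(\<Sum>k\<in>I. SUP x\<in>S. a k x) \<le> (\<Sum>k\<in>I. a k (\<theta> k) + d)"
    by (intro sum_mono) (use \<theta> in fastforce)
  also have "\<dots> = (\<Sum>k\<in>I. a k (\<theta> k)) + real (card I) * d" by (simp add: sum.distrib)
  also have "\<dots> \<le> B + e"
    using le[of \<theta>] \<theta> \<open>0 < e\<close> by (intro add_mono) (auto simp: d_def field_simps)
  finally show "(\<Sum>k\<in>I. SUP x\<in>S. a k x) \<le> B + e" .
qed

section \<open>The vectors of the square function and their adjoint counterparts\<close>

lemma E_prod_Nil [simp]: "cblinfun_apply (E_prod [] S) x = x"
  by (simp add: E_prod_def cblinfun_apply_id)

lemma E_prod_Cons [simp]:
  "cblinfun_apply (E_prod (\<xi> # l) S) x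
    = cblinfun_apply (E_prod l S) x - cnj \<xi> *\<^sub>C cblinfun_apply S (cblinfun_apply (E_prod l S) x)"
  by (simp add: E_prod_def cblinfun_apply_compose cblinfun_apply_diff_left cblinfun_apply_scaleC_left
      cblinfun_apply_id)

lemma E_prod_commute:
  assumes "\<And>x. cblinfun_apply B (cblinfun_apply S x) = cblinfun_apply S (cblinfun_apply B x)"
  shows "cblinfun_apply B (cblinfun_apply (E_prod l S) x) = cblinfun_apply (E_prod l S) (cblinfun_apply B x)"
  by (induction l arbitrary: x) (simp_all add: cblinfun_apply_diff cblinfun_apply_scaleC assms)

lemma funpow_cblinfun_commute:
  assumes "\<And>x. cblinfun_apply B (cblinfun_apply S x) = cblinfun_apply S (cblinfun_apply B x)"
  shows "cblinfun_apply B ((cblinfun_apply S ^^ m) x) = (cblinfun_apply S ^^ m) (cblinfun_apply B x)"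
  by (induction m) (simp_all add: assms)

lemma cadjoint_funpow_apply:
  fixes S :: "('a::complex_normed_vector, 'a) cblinfun"
  shows "cblinfun_apply ((cblinfun_apply (cadjoint S) ^^ m) y) x = cblinfun_apply y ((cblinfun_apply S ^^ m) x)"
proof -
  define A where "A = cblinfun_apply (cadjoint S)"
  have A: "cblinfun_apply (A f) x = cblinfun_apply f (cblinfun_apply S x)" for f x
    by (simp add: A_def cadjoint_apply cblinfun_apply_compose)
  have "cblinfun_apply ((A ^^ m) y) x = cblinfun_apply y ((cblinfun_apply S ^^ m) x)"
  proof (induction m arbitrary: x)
    case (Suc m)
    have "(cblinfun_apply S ^^ Suc m) x = (cblinfun_apply S ^^ m) (cblinfun_apply S x)"
      by (simp only: funpow_Suc_right o_apply)
    then show ?case by (simp only: funpow.simps(2)[of m A] o_apply A Suc.IH)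
  qed simp
  then show ?thesis by (simp only: A_def)
qed

text \<open>The adjoint is the complex-linear transpose, so the coefficients cnj \<xi> are not
  conjugated.\<close>

lemma E_prod_cadjoint_apply:
  "cblinfun_apply (cblinfun_apply (E_prod l (cadjoint S)) y) x = cblinfun_apply y (cblinfun_apply (E_prod l S) x)"
proof (induction l arbitrary: x)
  case (Cons \<xi> l)
  have "cblinfun_apply (E_prod l S) (cblinfun_apply S x) = cblinfun_apply S (cblinfun_apply (E_prod l S) x)"
    by (rule E_prod_commute[symmetric]) simp
  then show ?case
    by (simp add: cblinfun_apply_diff_left cblinfun_apply_scaleC_left cadjoint_apply cblinfun_apply_compose
        Cons.IH cblinfun_apply_diff cblinfun_apply_scaleC scaleC_complex_def)
qed simp

text \<open>The terms of the square function without their weights, indexed from 0: \<open>m\<close>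
  is \<open>k - 1\<close> there.\<close>

definition ritt_orbit :: "complex list \<Rightarrow> ('a::complex_normed_vector, 'a) cblinfun \<Rightarrow> nat \<Rightarrow> 'a \<Rightarrow> 'a"
  where "ritt_orbit \<xi>s S m x = (cblinfun_apply S ^^ m) (cblinfun_apply (E_prod \<xi>s S) x)"

lemma ritt_orbit_cadjoint:
  "cblinfun_apply (ritt_orbit \<xi>s (cadjoint S) m y) x = cblinfun_apply y (ritt_orbit \<xi>s S m x)"
proof -
  have "cblinfun_apply (E_prod \<xi>s S) ((cblinfun_apply S ^^ m) x) = (cblinfun_apply S ^^ m) (cblinfun_apply (E_prod \<xi>s S) x)"
    by (rule funpow_cblinfun_commute) (rule E_prod_commute[OF refl, symmetric])
  then show ?thesis
    by (simp add: ritt_orbit_def cadjoint_funpow_apply E_prod_cadjoint_apply)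
qed

lemma resolvent_ritt_orbit:
  assumes "z \<notin> spectrum T"
  shows "cblinfun_apply (resolvent z T) (ritt_orbit \<xi>s T m x) = ritt_orbit \<xi>s T m (cblinfun_apply (resolvent z T) x)"
  unfolding ritt_orbit_def
  by (simp only: funpow_cblinfun_commute[OF resolvent_commute[OF assms]] E_prod_commute[OF resolvent_commute[OF assms]])

text \<open>The resolvent commutes with T, so the orbit can pass through it from the vector to the
  functional.\<close>

lemma resolvent_form_ritt_orbit:
  assumes "z \<notin> spectrum T"
  shows "resolvent_form T y (ritt_orbit \<xi>s T m x) z = resolvent_form T (ritt_orbit \<xi>s (cadjoint T) m y) x z"
  by (simp add: resolvent_form_def ritt_orbit_cadjoint resolvent_ritt_orbit[OF assms])

context peripheral_set
begin

lemma bint_cong: "(\<And>\<theta>. \<theta> \<in> regular u \<Longrightarrow> f (E_bdry \<xi>s u \<theta>) = g (E_bdry \<xi>s u \<theta>)) \<Longrightarrow> bint u f = bint u g"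
  unfolding bint_def by (intro integral_cong) simp

lemma bint_diff:
  "bintegrable u f \<Longrightarrow> bintegrable u g \<Longrightarrow> bint u (\<lambda>z. f z - g z) = bint u f - bint u g"
  unfolding bint_def bintegrable_def by (subst integral_diff[symmetric]) (auto simp: left_diff_distrib)

lemma bint_cmult: "bint u (\<lambda>z. c * f z) = c * bint u f"
  unfolding bint_def by (simp add: mult.assoc)

lemma bintegrable_cmult: "bintegrable u f \<Longrightarrow> bintegrable u (\<lambda>z. c * f z)"
  unfolding bintegrable_def by (simp add: mult.assoc integrable_on_mult_right)

lemma bint_sum:
  assumes "finite I" "\<And>i. i \<in> I \<Longrightarrow> bintegrable u (f i)"
  shows "bint u (\<lambda>z. \<Sum>i\<in>I. f i z) = (\<Sum>i\<in>I. bint u (f i))"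
  using assms unfolding bint_def bintegrable_def
  by (simp add: sum_distrib_right integral_sum)

end

section \<open>Exchanging powers of T for powers of z under the integral\<close>

context peripheral_operator
begin

lemma regular_bdry_in_W:
  assumes "r \<le> s'" "s' < u" "u < 1" "\<theta> \<in> regular u"
  shows "E_bdry \<xi>s u \<theta> \<in> W s'"
proof -
  have u: "r \<le> u" "u < 1" using assms by auto
  have "E_bdry \<xi>s u \<theta> \<notin> closure (E_dom \<xi>s s')"
    by (rule E_bdry_notin_closure_smaller)
       (use assms regular_angle_not_corner[OF u] in \<open>auto simp: regular_def\<close>)
  then show ?thesis using cmod_E_bdry_le_1[OF u, of \<theta>] by (simp add: W_def)
qed

text \<open>The factor \<open>EP z\<close> compensates the resolvent at the corners, so the
  integrand is bounded on compact sets although it is not continuous there.\<close>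

lemma resolvent_integrand:
  assumes "r < s'" "s' < 1" and h: "h holomorphic_on V s t"
  shows "(\<lambda>z. EP z * h z * resolvent_form T y x z) holomorphic_on V s t \<inter> W s'"
    and "\<And>K. compact K \<Longrightarrow> K \<subseteq> V s t \<Longrightarrow>
      \<exists>B. \<forall>z\<in>K \<inter> W s'. cmod (EP z * h z * resolvent_form T y x z) \<le> B"
proof -
  show "(\<lambda>z. EP z * h z * resolvent_form T y x z) holomorphic_on V s t \<inter> W s'"
    by (intro holomorphic_intros holomorphic_on_subset[OF h]
        holomorphic_on_subset[OF holomorphic_resolvent_form[OF assms(1,2)]]) auto
next
  fix K assume K: "compact K" "K \<subseteq> V s t"
  have "compact (h ` K)"
    by (intro compact_continuous_image K continuous_on_subset[OF holomorphic_on_imp_continuous_on[OF h]])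
  then obtain B where B: "\<And>z. z \<in> K \<Longrightarrow> cmod (h z) \<le> B"
    using compact_imp_bounded bounded_iff by (metis imageI)
  obtain C where "0 < C" and C: "\<And>z x y. z \<in> W s' \<Longrightarrow> cmod (EP z * resolvent_form T y x z) \<le> C * norm x * norm y"
    using resolvent_form_bound[OF assms(1,2)] by blast
  have "cmod (EP z * h z * resolvent_form T y x z) \<le> B * (C * norm x * norm y)" if "z \<in> K \<inter> W s'" for z
  proof -
    have "cmod (EP z * h z * resolvent_form T y x z) = cmod (h z) * cmod (EP z * resolvent_form T y x z)"
      by (simp add: norm_mult)
    also have "\<dots> \<le> B * (C * norm x * norm y)"
      using B[of z] C[of z y x] that order_trans[OF norm_ge_zero B[of z]] by (intro mult_mono) auto
    finally show ?thesis .
  qed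
  then show "\<exists>B. \<forall>z\<in>K \<inter> W s'. cmod (EP z * h z * resolvent_form T y x z) \<le> B" by blast
qed

context
  fixes u s t :: real
  assumes u: "r < u" "u < s" "s < 1" and t: "1/2 < t" "t < 1"
begin

lemma bint_resolvent_integrable:
  assumes h: "h holomorphic_on V s t"
  shows "bintegrable u (\<lambda>z. EP z * h z * resolvent_form T y x z)"
proof -
  define s' where "s' = (r + u) / 2"
  have s': "r < s'" "s' < u" using u by (auto simp: s'_def)
  show ?thesis
    by (rule scaled_bdry_integral_tendsto(1)[OF _ u(2,3) s'(2) _ t resolvent_integrand(1)[OF s'(1) _ h]
          resolvent_integrand(2)[OF s'(1) _ h]])
       (use u s' in auto)
qed

text \<open>The resolvent-free term of \<open>resolvent_form_T\<close> has integral 0 by Cauchy's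
  theorem.\<close>

lemma bint_T:
  assumes h: "h holomorphic_on V s t"
  shows "bint u (\<lambda>z. EP z * h z * resolvent_form T y (cblinfun_apply T x) z)
    = bint u (\<lambda>z. EP z * (z * h z) * resolvent_form T y x z)"
proof -
  have "bint u (\<lambda>z. EP z * h z * resolvent_form T y (cblinfun_apply T x) z)
    = bint u (\<lambda>z. EP z * (z * h z) * resolvent_form T y x z - cblinfun_apply y x * (EP z * h z))"
  proof (rule bint_cong)
    fix \<theta> assume "\<theta> \<in> regular u"
    then have "E_bdry \<xi>s u \<theta> \<in> W r" using u by (intro regular_bdry_in_W) auto
    then have "E_bdry \<xi>s u \<theta> \<notin> spectrum T" by (rule W_not_spectrum[rotated]) simp
    then show "EP (E_bdry \<xi>s u \<theta>) * h (E_bdry \<xi>s u \<theta>) * resolvent_form T y (cblinfun_apply T x) (E_bdry \<xi>s u \<theta>)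
      = EP (E_bdry \<xi>s u \<theta>) * (E_bdry \<xi>s u \<theta> * h (E_bdry \<xi>s u \<theta>)) * resolvent_form T y x (E_bdry \<xi>s u \<theta>)
        - cblinfun_apply y x * (EP (E_bdry \<xi>s u \<theta>) * h (E_bdry \<xi>s u \<theta>))"
      by (simp add: resolvent_form_T algebra_simps)
  qed
  also have "\<dots> = bint u (\<lambda>z. EP z * (z * h z) * resolvent_form T y x z) - bint u (\<lambda>z. cblinfun_apply y x * (EP z * h z))"
  proof (rule bint_diff)
    have hol: "(\<lambda>z. EP z * h z) holomorphic_on V s t" by (intro holomorphic_intros h)
    show "bintegrable u (\<lambda>z. cblinfun_apply y x * (EP z * h z))"
      by (intro bintegrable_cmult Cauchy_bdry(1)[OF _ _ _ _ _ hol]) (use u t in auto)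
    show "bintegrable u (\<lambda>z. EP z * (z * h z) * resolvent_form T y x z)"
      by (intro bint_resolvent_integrable holomorphic_intros h)
  qed
  also have "bint u (\<lambda>z. cblinfun_apply y x * (EP z * h z)) = 0"
  proof -
    have "(\<lambda>z. EP z * h z) holomorphic_on V s t" by (intro holomorphic_intros h)
    then have "bint u (\<lambda>z. EP z * h z) = 0" by (rule Cauchy_bdry(2)[rotated -1]) (use u t in auto)
    then show ?thesis by (simp add: bint_cmult)
  qed
  finally show ?thesis by simp
qed

lemma bint_funpow_T:
  assumes h: "h holomorphic_on V s t"
  shows "bint u (\<lambda>z. EP z * h z * resolvent_form T y ((cblinfun_apply T ^^ m) x) z)
    = bint u (\<lambda>z. EP z * (z ^ m * h z) * resolvent_form T y x z)"
  using h
proof (induction m arbitrary: h)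
  case (Suc m)
  have "bint u (\<lambda>z. EP z * h z * resolvent_form T y ((cblinfun_apply T ^^ Suc m) x) z)
    = bint u (\<lambda>z. EP z * (z * h z) * resolvent_form T y ((cblinfun_apply T ^^ m) x) z)"
    by (simp add: bint_T[OF Suc.prems])
  also have "\<dots> = bint u (\<lambda>z. EP z * (z ^ m * (z * h z)) * resolvent_form T y x z)"
    by (intro Suc.IH holomorphic_intros Suc.prems)
  finally show ?case by (simp add: mult_ac)
qed simp

lemma bint_E_prod:
  assumes h: "h holomorphic_on V s t"
  shows "bint u (\<lambda>z. EP z * h z * resolvent_form T y (cblinfun_apply (E_prod l T) x) z)
    = bint u (\<lambda>z. EP z * (prod_list (map (\<lambda>\<xi>. 1 - cnj \<xi> * z) l) * h z) * resolvent_form T y x z)"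
  using h
proof (induction l arbitrary: h)
  case (Cons \<xi> l)
  let ?x = "cblinfun_apply (E_prod l T) x"
  have "bint u (\<lambda>z. EP z * h z * resolvent_form T y (cblinfun_apply (E_prod (\<xi> # l) T) x) z)
    = bint u (\<lambda>z. EP z * h z * resolvent_form T y ?x z
        - cnj \<xi> * (EP z * h z * resolvent_form T y (cblinfun_apply T ?x) z))"
    by (simp add: resolvent_form_def cblinfun_apply_diff cblinfun_apply_scaleC scaleC_complex_def algebra_simps)
  also have "\<dots> = bint u (\<lambda>z. EP z * h z * resolvent_form T y ?x z)
      - cnj \<xi> * bint u (\<lambda>z. EP z * (z * h z) * resolvent_form T y ?x z)"
    unfolding bint_T[OF Cons.prems, symmetric] bint_cmult[symmetric]
    by (intro bint_diff bintegrable_cmult bint_resolvent_integrable Cons.prems)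
  also have "\<dots> = bint u (\<lambda>z. EP z * h z * resolvent_form T y ?x z
      - cnj \<xi> * (EP z * (z * h z) * resolvent_form T y ?x z))"
    unfolding bint_cmult[symmetric]
    by (intro bint_diff[symmetric] bintegrable_cmult bint_resolvent_integrable Cons.prems holomorphic_intros)
  also have "\<dots> = bint u (\<lambda>z. EP z * ((1 - cnj \<xi> * z) * h z) * resolvent_form T y ?x z)"
    by (simp add: algebra_simps)
  also have "\<dots> = bint u (\<lambda>z. EP z * (prod_list (map (\<lambda>\<xi>. 1 - cnj \<xi> * z) l) * ((1 - cnj \<xi> * z) * h z)) * resolvent_form T y x z)"
    by (intro Cons.IH holomorphic_intros Cons.prems)
  finally show ?case by (simp add: mult_ac)
qed simp

lemma bint_ritt_orbit:
  assumes "distinct \<xi>s" and h: "h holomorphic_on V s t"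
  shows "bint u (\<lambda>z. EP z * h z * resolvent_form T y (ritt_orbit \<xi>s T m x) z)
    = bint u (\<lambda>z. EP z * (z ^ m * EP z * h z) * resolvent_form T y x z)"
proof -
  have EP: "prod_list (map (\<lambda>\<xi>. 1 - cnj \<xi> * z) \<xi>s) = EP z" for z
    unfolding EP_def by (rule prod.distinct_set_conv_list[OF assms(1), symmetric])
  show ?thesis
    unfolding ritt_orbit_def bint_funpow_T[OF h]
  proof (subst bint_E_prod)
    show "(\<lambda>z. z ^ m * h z) holomorphic_on V s t" by (intro holomorphic_intros h)
    have "EP z * (z ^ m * h z) = z ^ m * EP z * h z" for z by (simp only: mult_ac)
    then show "bint u (\<lambda>z. EP z * (prod_list (map (\<lambda>\<xi>. 1 - cnj \<xi> * z) \<xi>s) * (z ^ m * h z)) * resolvent_form T y x z)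
      = bint u (\<lambda>z. EP z * (z ^ m * EP z * h z) * resolvent_form T y x z)"
      by (simp only: EP)
  qed
qed

text \<open>Each factor z^m EP z produces one orbit of x; one of the two is then handed over to y
  through the commuting resolvent.\<close>

lemma bint_ritt_orbit_split:
  assumes "distinct \<xi>s" and h: "h holomorphic_on V s t"
  shows "bint u (\<lambda>z. EP z * (z ^ (2 * m) * EP z ^ 2 * h z) * resolvent_form T y x z)
    = bint u (\<lambda>z. EP z * h z * resolvent_form T (ritt_orbit \<xi>s (cadjoint T) m y) (ritt_orbit \<xi>s T m x) z)"
proof -
  have h': "(\<lambda>z. z ^ m * EP z * h z) holomorphic_on V s t" by (intro holomorphic_intros h)
  have "bint u (\<lambda>z. EP z * (z ^ (2 * m) * EP z ^ 2 * h z) * resolvent_form T y x z)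
      = bint u (\<lambda>z. EP z * (z ^ m * EP z * (z ^ m * EP z * h z)) * resolvent_form T y x z)"
  proof -
    have "z ^ (2 * m) = z ^ m * z ^ m" for z :: complex by (simp add: mult_2 power_add)
    then have "z ^ (2 * m) * EP z ^ 2 * h z = z ^ m * EP z * (z ^ m * EP z * h z)" for z
      by (simp only: power2_eq_square mult.assoc mult.left_commute)
    then show ?thesis by (simp only:)
  qed
  also have "\<dots> = bint u (\<lambda>z. EP z * (z ^ m * EP z * h z) * resolvent_form T y (ritt_orbit \<xi>s T m x) z)"
    by (rule bint_ritt_orbit[OF assms(1) h', symmetric])
  also have "\<dots> = bint u (\<lambda>z. EP z * h z * resolvent_form T y (ritt_orbit \<xi>s T m (ritt_orbit \<xi>s T m x)) z)"
    by (rule bint_ritt_orbit[OF assms, symmetric])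
  also have "\<dots> = bint u (\<lambda>z. EP z * h z * resolvent_form T (ritt_orbit \<xi>s (cadjoint T) m y) (ritt_orbit \<xi>s T m x) z)"
  proof (rule bint_cong)
    fix \<theta> assume "\<theta> \<in> regular u"
    then have "E_bdry \<xi>s u \<theta> \<in> W r" using u by (intro regular_bdry_in_W) auto
    then have "E_bdry \<xi>s u \<theta> \<notin> spectrum T" by (rule W_not_spectrum[rotated]) simp
    then show "EP (E_bdry \<xi>s u \<theta>) * h (E_bdry \<xi>s u \<theta>) * resolvent_form T y (ritt_orbit \<xi>s T m (ritt_orbit \<xi>s T m x)) (E_bdry \<xi>s u \<theta>)
      = EP (E_bdry \<xi>s u \<theta>) * h (E_bdry \<xi>s u \<theta>) * resolvent_form T (ritt_orbit \<xi>s (cadjoint T) m y) (ritt_orbit \<xi>s T m x) (E_bdry \<xi>s u \<theta>)"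
      by (simp add: resolvent_form_ritt_orbit)
  qed
  finally show ?thesis .
qed

end

text \<open>The calculus needs a bound uniform in \<open>u\<close>, while
  \<open>series_calculus_bound\<close> gives a constant for one \<open>u\<close>; this carries the
  bound from one contour to all.\<close>

lemma bint_resolvent_independent:
  assumes u: "r < u" "u < s" "r < u'" "u' < s" "s < 1" and t: "1/2 < t" "t < 1"
    and h: "h holomorphic_on V s t"
  shows "bint u (\<lambda>z. EP z * h z * resolvent_form T y x z) = bint u' (\<lambda>z. EP z * h z * resolvent_form T y x z)"
proof -
  have *: "bint v (\<lambda>z. EP z * h z * resolvent_form T y x z) = bint v' (\<lambda>z. EP z * h z * resolvent_form T y x z)"
    if v: "r < v" "v \<le> v'" "v' < s" for v v'
  proof -
    define s' where "s' = (r + v) / 2"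
    have s': "r < s'" "s' < v" using v by (auto simp: s'_def)
    show ?thesis
      by (rule bint_independent[OF v u(5) s'(2) _ t resolvent_integrand(1)[OF s'(1) _ h]
            resolvent_integrand(2)[OF s'(1) _ h]])
         (use u v s' in auto)
  qed
  show ?thesis
  proof (cases "u \<le> u'")
    case True
    then show ?thesis using u by (intro *) auto
  next
    case False
    then show ?thesis using u by (intro *[symmetric]) auto
  qed
qed

end

section \<open>The bound for dilated functions, uniform in t\<close>

context peripheral_operator
begin

lemma cmod_EP_le: "cmod z \<le> 1 \<Longrightarrow> cmod (EP z) \<le> 2 ^ card (set \<xi>s)"
proof -
  assume "cmod z \<le> 1"
  then have "cmod (\<xi> - z) \<le> 2" if "\<xi> \<in> set \<xi>s" for \<xi>
    using norm_triangle_ineq4[of \<xi> z] cmod_xi[OF that] by simp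
  then have "(\<Prod>\<xi>\<in>set \<xi>s. cmod (\<xi> - z)) \<le> (\<Prod>\<xi>\<in>set \<xi>s. 2)" by (intro prod_mono) auto
  then show ?thesis by (simp add: cmod_EP)
qed

lemma EP_dilate_nonzero: "cmod z < 1 \<Longrightarrow> EP z \<noteq> 0"
  using cmod_xi by (auto simp: EP_eq_0_iff)

lemma V_dilate:
  assumes "z \<in> V s t" "s \<le> 1"
  shows "cmod (of_real t * z) < 1"
  using assms E_dom_subset_ball[of s] by (auto simp: V_def)

text \<open>Each factor grows at most twofold: the displacement (1 - t) |z| is at most 1 - t |z|,
  hence at most the distance from t z to the circle.\<close>

lemma cmod_EP_le_dilate:
  assumes "cmod z \<le> 1" "0 \<le> t" "t \<le> 1"
  shows "cmod (EP z) \<le> 2 ^ card (set \<xi>s) * cmod (EP (of_real t * z))"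
proof -
  have "cmod (\<xi> - z) \<le> 2 * cmod (\<xi> - of_real t * z)" if "\<xi> \<in> set \<xi>s" for \<xi>
  proof -
    have "\<xi> - z = (\<xi> - of_real t * z) - of_real (1 - t) * z" by (simp add: algebra_simps)
    then have "cmod (\<xi> - z) \<le> cmod (\<xi> - of_real t * z) + cmod (of_real (1 - t) * z)"
      by (simp only: norm_triangle_ineq4)
    also have "cmod (of_real (1 - t) * z) = (1 - t) * cmod z"
      using assms by (simp add: norm_mult del: of_real_diff)
    also have "(1 - t) * cmod z \<le> 1 - t" using assms by (simp add: mult_left_le)
    also have "1 - t \<le> 1 - t * cmod z" using assms by (simp add: mult_left_le)
    also have "\<dots> \<le> cmod (\<xi> - of_real t * z)"
      using norm_triangle_ineq2[of \<xi> "of_real t * z"] cmod_xi[OF that] assms by (simp add: norm_mult)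
    finally show ?thesis by simp
  qed
  then have "(\<Prod>\<xi>\<in>set \<xi>s. cmod (\<xi> - z)) \<le> (\<Prod>\<xi>\<in>set \<xi>s. 2 * cmod (\<xi> - of_real t * z))"
    by (intro prod_mono) auto
  then show ?thesis by (simp add: cmod_EP prod.distrib)
qed

lemma regular_bdry_in_V:
  assumes "r \<le> u" "u < s" "s < 1" "0 \<le> t" "t < 1"
  shows "E_bdry \<xi>s u \<theta> \<in> V s t"
  using scaled_closure_in_V[of u s t 1 "E_bdry \<xi>s u \<theta>"] E_bdry_in_closure[of u \<theta>] assms r_pos by simp

lemma regular_nonempty: "regular u \<noteq> {}"
proof
  assume "regular u = {}"
  then have "{0..2 * pi} \<subseteq> singular_angles u" by (auto simp: regular_def)
  then have "finite {0..2 * pi}" using finite_singular_angles finite_subset by blast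
  then show False using infinite_Icc[of 0 "2 * pi"] pi_gt_zero by simp
qed

text \<open>By \<open>bdry_distance\<close>, |z|^(m + 1) is at most exp (- c (m + 1) |\<theta> - p|)
  for some p, and the integral of this is O(1 / (m + 1)).\<close>

lemma bdry_power_integral:
  assumes u: "r \<le> u" "u < 1"
  obtains B where "0 < B"
    "\<And>m. (\<lambda>\<theta>. real (Suc m) * cmod (E_bdry \<xi>s u \<theta>) ^ m) integrable_on regular u"
    "\<And>m. integral (regular u) (\<lambda>\<theta>. real (Suc m) * cmod (E_bdry \<xi>s u \<theta>) ^ m) \<le> B"
proof -
  have u0: "0 < u" using u r_pos by simp
  obtain P c where P: "finite P" "0 < c"
    "\<And>\<theta>. \<theta> \<in> {0..2*pi} \<Longrightarrow> \<exists>p\<in>P. c * \<bar>\<theta> - p\<bar> \<le> 1 - cmod (E_bdry \<xi>s u \<theta>)"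
    using bdry_distance[OF u] by metis
  define B where "B = real (card P) * (2 / c) / u + 1"
  have "0 < B" unfolding B_def using P u0 by (intro add_nonneg_pos) auto
  have ge: "u \<le> cmod (E_bdry \<xi>s u \<theta>)" for \<theta>
    unfolding cmod_E_bdry[OF u] by (rule bdry_radius_props(3)[OF u])
  define f where "f m \<theta> = (\<Sum>p\<in>P. real (Suc m) / u * exp (- (c * real (Suc m)) * \<bar>\<theta> - p\<bar>))" for m \<theta>
  have c0: "0 < c * real (Suc m)" for m using P by simp
  have pi2: "0 \<le> 2 * pi" by simp
  have f_int: "f m integrable_on {0..2*pi}" for m
    unfolding f_def
    by (intro integrable_sum[OF P(1)] integrable_on_mult_right exp_abs_shift_integral(1)[OF c0 pi2])
  have f_reg: "f m integrable_on regular u" for m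
    unfolding regular_def by (rule integrable_on_diff_finite[OF finite_singular_angles f_int])
  have f_le: "integral (regular u) (f m) \<le> B" for m
  proof -
    have "(f m has_integral integral {0..2*pi} (f m)) (regular u)"
      unfolding regular_def has_integral_diff_finite_iff[OF finite_singular_angles]
      by (rule integrable_integral[OF f_int])
    then have "integral (regular u) (f m) = integral {0..2*pi} (f m)" by (rule integral_unique)
    also have "\<dots> = (\<Sum>p\<in>P. real (Suc m) / u * integral {0..2*pi} (\<lambda>\<theta>. exp (- (c * real (Suc m)) * \<bar>\<theta> - p\<bar>)))"
      unfolding f_def
      by (subst integral_sum[OF P(1)])
         (simp_all only: integral_mult_right integrable_on_mult_right exp_abs_shift_integral(1)[OF c0 pi2])
    also have "\<dots> \<le> (\<Sum>p\<in>P. real (Suc m) / u * (2 / (c * real (Suc m))))"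
      by (intro sum_mono mult_left_mono exp_abs_shift_integral(2)[OF c0 pi2]) (use u0 in auto)
    also have "\<dots> = real (card P) * (2 / c) / u" using u0 P by (simp add: field_simps del: of_nat_Suc)
    finally show ?thesis by (simp add: B_def)
  qed
  have bound: "real (Suc m) * cmod (E_bdry \<xi>s u \<theta>) ^ m \<le> f m \<theta>" if \<theta>: "\<theta> \<in> regular u" for m \<theta>
  proof -
    define \<rho> where "\<rho> = cmod (E_bdry \<xi>s u \<theta>)"
    obtain p where p: "p \<in> P" "c * \<bar>\<theta> - p\<bar> \<le> 1 - \<rho>"
      unfolding \<rho>_def using P(3)[of \<theta>] \<theta> by (auto simp: regular_def)
    have "\<rho> \<le> 1 - c * \<bar>\<theta> - p\<bar>" using p by simp
    also have "\<dots> \<le> exp (- (c * \<bar>\<theta> - p\<bar>))" using exp_ge_add_one_self[of "- (c * \<bar>\<theta> - p\<bar>)"] by simp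
    finally have "\<rho> ^ Suc m \<le> exp (- (c * \<bar>\<theta> - p\<bar>)) ^ Suc m"
      by (intro power_mono) (auto simp: \<rho>_def)
    also have "\<dots> = exp (real (Suc m) * - (c * \<bar>\<theta> - p\<bar>))" by (rule exp_of_nat_mult[symmetric])
    also have "\<dots> = exp (- (c * real (Suc m)) * \<bar>\<theta> - p\<bar>)" by (simp add: mult_ac)
    finally have e: "\<rho> ^ Suc m \<le> exp (- (c * real (Suc m)) * \<bar>\<theta> - p\<bar>)" .
    \<comment> \<open>Exponent m + 1 keeps the rate of decay positive at m = 0; returning to
      exponent m costs the factor 1/u, since |z| is at least u.\<close>
    have "u * \<rho> ^ m \<le> \<rho> ^ Suc m" using ge[of \<theta>] by (simp add: \<rho>_def mult_right_mono)
    then have "u * \<rho> ^ m \<le> exp (- (c * real (Suc m)) * \<bar>\<theta> - p\<bar>)" using e by (rule order_trans)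
    then have "\<rho> ^ m \<le> exp (- (c * real (Suc m)) * \<bar>\<theta> - p\<bar>) / u"
      using u0 by (simp add: pos_le_divide_eq mult.commute)
    then have "real (Suc m) * \<rho> ^ m \<le> real (Suc m) * (exp (- (c * real (Suc m)) * \<bar>\<theta> - p\<bar>) / u)"
      by (intro mult_left_mono) auto
    also have "\<dots> = real (Suc m) / u * exp (- (c * real (Suc m)) * \<bar>\<theta> - p\<bar>)" by simp
    also have "\<dots> \<le> f m \<theta>" unfolding f_def
      by (rule member_le_sum[OF p(1) _ P(1)]) (use u0 in auto)
    finally show ?thesis by (simp add: \<rho>_def)
  qed
  have int: "(\<lambda>\<theta>. real (Suc m) * cmod (E_bdry \<xi>s u \<theta>) ^ m) integrable_on regular u" for m
    unfolding regular_def
  proof (rule continuous_dominated_integrable[OF finite_singular_angles])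
    show "continuous_on ({0..2*pi} - singular_angles u) (\<lambda>\<theta>. real (Suc m) * cmod (E_bdry \<xi>s u \<theta>) ^ m)"
      by (intro continuous_intros continuous_on_subset[OF continuous_on_E_bdry[OF u]]) auto
    show "f m integrable_on {0..2*pi} - singular_angles u" using f_reg by (simp add: regular_def)
    show "norm (real (Suc m) * cmod (E_bdry \<xi>s u \<theta>) ^ m) \<le> f m \<theta>" if "\<theta> \<in> {0..2*pi} - singular_angles u" for \<theta>
      using bound[of \<theta> m] that by (simp add: regular_def)
  qed
  have "integral (regular u) (\<lambda>\<theta>. real (Suc m) * cmod (E_bdry \<xi>s u \<theta>) ^ m) \<le> B" for m
    using integral_le[OF int f_reg bound] f_le[of m] by (rule order_trans)
  with \<open>0 < B\<close> int show ?thesis by (rule that)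
qed

text \<open>The identity \<open>1 = EP(z)\<^sup>3 \<Sum> c\<^sub>k z\<^sup>k\<close> with \<open>c\<^sub>k = O(k\<^sup>2)\<close> splits \<open>k\<close> into thirds: two of the
  factors \<open>z\<^sup>m EP(z)\<close> become the square functions of \<open>x\<close> and \<open>y\<close>, and the third one makes the
  contour integrals of \<open>(m + 1) z\<^sup>m\<close> bounded.\<close>

lemma series_calculus_bound:
  fixes D :: real
  assumes dist: "distinct \<xi>s" and u: "r < s'" "s' < u" "u < s" "s < 1" and "0 \<le> D"
    and D: "\<And>n zs x y. (\<And>m. m < n \<Longrightarrow> zs m \<in> W s') \<Longrightarrow>
      (\<Sum>m<n. real (Suc m) * cmod (EP (zs m) *
        resolvent_form T (ritt_orbit \<xi>s (cadjoint T) m y) (ritt_orbit \<xi>s T m x) (zs m)))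
      \<le> D * norm x * norm y"
  obtains K where "0 \<le> K"
    "\<And>t g G x y. 1/2 < t \<Longrightarrow> t < 1 \<Longrightarrow> g holomorphic_on V s t \<Longrightarrow> (\<And>z. z \<in> V s t \<Longrightarrow> cmod (g z) \<le> G) \<Longrightarrow>
      cmod (bint u (\<lambda>z. EP z * (EP z ^ 2 * g z / EP (of_real t * z) ^ 3) * resolvent_form T y x z))
      \<le> K * G * norm x * norm y"
proof -
  have u1: "r \<le> u" "u < 1" "r < u" "r \<le> s'" "s' < 1" using u by auto
  obtain c C0 where "0 < C0" and c: "\<And>k. cmod (c k) \<le> C0 * real (Suc k) ^ 2"
    and csum: "\<And>w. cmod w < 1 \<Longrightarrow> (\<lambda>k. c k * w ^ k) sums (1 / EP w ^ 3)"
    using reciprocal_cube_coefficients[of "set \<xi>s", folded EP_def] nonempty on_circle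
    by (metis finite_set set_empty)
  obtain B where "0 < B"
    and Bint: "\<And>m. (\<lambda>\<theta>. real (Suc m) * cmod (E_bdry \<xi>s u \<theta>) ^ m) integrable_on regular u"
    and B: "\<And>m. integral (regular u) (\<lambda>\<theta>. real (Suc m) * cmod (E_bdry \<xi>s u \<theta>) ^ m) \<le> B"
    using bdry_power_integral[OF u1(1,2)] by blast
  define L where "L = card (set \<xi>s) * (2 / u ^ 3) + 1"
  have L: "cmod (E_bdry_deriv u \<theta>) \<le> L" for \<theta>
    unfolding L_def by (rule E_bdry_deriv_bound[OF u1(1,2)])
  have "0 \<le> L" using order_trans[OF norm_ge_zero L[of 0]] .
  obtain C1 where "0 < C1" and C1: "\<And>z x y. z \<in> W s' \<Longrightarrow> cmod (EP z * resolvent_form T y x z) \<le> C1 * norm x * norm y"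
    using resolvent_form_bound[OF u(1) u1(5)] by blast
  have W: "E_bdry \<xi>s u \<theta> \<in> W s'" if "\<theta> \<in> regular u" for \<theta>
    by (rule regular_bdry_in_W[OF u1(4) u(2) u1(2) that])
  note disc = cmod_E_bdry_le_1[OF u1(1,2)]
  \<comment> \<open>27 = 3 * 3^2: three coefficients per block, each at most C0 (3 (m + 1))^2. L
    bounds the speed of the contour and B the integral of (m + 1) |z|^m.\<close>
  define K where "K = 27 * C0 * L * B * D"
  have "0 \<le> K" using \<open>0 < C0\<close> \<open>0 \<le> L\<close> \<open>0 < B\<close> \<open>0 \<le> D\<close> by (simp add: K_def)
  moreover have "cmod (bint u (\<lambda>z. EP z * (EP z ^ 2 * g z / EP (of_real t * z) ^ 3) * resolvent_form T y x z))
      \<le> K * G * norm x * norm y"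
    if t: "1/2 < t" "t < 1" and g: "g holomorphic_on V s t" and G: "\<And>z. z \<in> V s t \<Longrightarrow> cmod (g z) \<le> G"
    for t g G x y
  proof -
    have V: "E_bdry \<xi>s u \<theta> \<in> V s t" for \<theta>
      by (rule regular_bdry_in_V) (use u u1 t in auto)
    have "0 \<le> G" using order_trans[OF norm_ge_zero G[OF V[of 0]]] .
    define vy where "vy m = ritt_orbit \<xi>s (cadjoint T) m y" for m
    define vx where "vx m = ritt_orbit \<xi>s T m x" for m
    \<comment> \<open>Block m holds k = 3m, 3m + 1, 3m + 2. The power z^(2m) is set aside for the
      two orbits; the remaining exponent is at least m.\<close>
    define q where "q m z = (\<Sum>k\<in>{m*3..<m*3+3}. c k * of_real t ^ k * z ^ (k - 2 * m))" for m and z :: complex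
    have q_hol: "q m holomorphic_on S" for m S
      unfolding q_def by (intro holomorphic_intros)
    have q_bound: "cmod (q m z) \<le> 27 * C0 * real (Suc m) ^ 2 * cmod z ^ m" if z: "cmod z \<le> 1" for m z
    proof -
      have "cmod (c k * of_real t ^ k * z ^ (k - 2 * m)) \<le> C0 * (3 * real (Suc m)) ^ 2 * 1 * cmod z ^ m"
        if k: "k \<in> {m*3..<m*3+3}" for k
      proof -
        have "cmod (c k) \<le> C0 * (3 * real (Suc m)) ^ 2"
          by (rule order_trans[OF c]) (use k \<open>0 < C0\<close> in \<open>auto intro!: mult_left_mono power_mono\<close>)
        moreover have "t ^ k \<le> 1" using t by (intro power_le_one) auto
        moreover have "cmod z ^ (k - 2 * m) \<le> cmod z ^ m" using k z by (intro power_decreasing) auto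
        ultimately show ?thesis
          unfolding norm_mult norm_power using t \<open>0 < C0\<close> by (intro mult_mono) auto
      qed
      then have "cmod (q m z) \<le> (\<Sum>k\<in>{m*3..<m*3+3}. C0 * (3 * real (Suc m)) ^ 2 * 1 * cmod z ^ m)"
        unfolding q_def by (intro sum_norm_le) auto
      then show ?thesis by (simp add: power_mult_distrib del: of_nat_Suc)
    qed
    have q_split: "q m z * z ^ (2 * m) = (\<Sum>k\<in>{m*3..<m*3+3}. c k * (of_real t * z) ^ k)" for m z
      unfolding q_def sum_distrib_right
    proof (rule sum.cong[OF refl])
      fix k assume "k \<in> {m*3..<m*3+3}"
      then have "z ^ (k - 2 * m) * z ^ (2 * m) = z ^ k" by (simp flip: power_add)
      then show "c k * of_real t ^ k * z ^ (k - 2 * m) * z ^ (2 * m) = c k * (of_real t * z) ^ k"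
        by (simp add: power_mult_distrib mult.assoc)
    qed
    define S where "S n z = (\<Sum>m<n. q m z * z ^ (2 * m))" for n z
    have S_hol: "S n holomorphic_on A" for n A
      unfolding S_def by (intro holomorphic_intros q_hol)
    have S_lim: "(\<lambda>n. S n z) \<longlonglongrightarrow> 1 / EP (of_real t * z) ^ 3" if "cmod (of_real t * z) < 1" for z
      using sums_group[OF csum[OF that], of 3] unfolding sums_def S_def q_split by simp
    have t_sum: "summable (\<lambda>k. cmod (c k * of_real t ^ k))"
      by (rule powser_disc_norm_summable[OF sums_summable[OF csum]]) (use t in auto)
    \<comment> \<open>This constant depends on t; it only dominates the limit in n and does not
      enter \<open>K\<close>.\<close>
    define Mc where "Mc = (\<Sum>k. cmod (c k * of_real t ^ k))"
    have S_bound: "cmod (S n z) \<le> Mc" if z: "cmod z \<le> 1" for n z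
    proof -
      have "S n z = (\<Sum>k<n*3. c k * (of_real t * z) ^ k)"
        unfolding S_def q_split by (rule sum.nat_group)
      then have "cmod (S n z) \<le> (\<Sum>k<n*3. cmod (c k * (of_real t * z) ^ k))"
        by (simp only: norm_sum)
      also have "\<dots> \<le> (\<Sum>k<n*3. cmod (c k * of_real t ^ k))"
        using z by (intro sum_mono) (simp add: norm_mult norm_power power_mult_distrib mult_left_le mult.assoc[symmetric] power_le_one)
      also have "\<dots> \<le> Mc" unfolding Mc_def by (rule sum_le_suminf[OF t_sum]) auto
      finally show ?thesis .
    qed
    define a where "a m \<theta> = real (Suc m) * cmod (EP (E_bdry \<xi>s u \<theta>) * resolvent_form T (vy m) (vx m) (E_bdry \<xi>s u \<theta>))" for m \<theta>
    \<comment> \<open>Each contour integral is estimated by a supremum times a mass.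
      \<open>sum_SUP_le\<close> can add the suprema because \<open>D\<close> allows a separate point
      for each m.\<close>
    define \<sigma> where "\<sigma> m = (SUP \<theta>\<in>regular u. a m \<theta>)" for m
    have a_bdd: "bdd_above (a m ` regular u)" for m
    proof (rule bdd_aboveI2)
      fix \<theta> assume "\<theta> \<in> regular u"
      then show "a m \<theta> \<le> real (Suc m) * (C1 * norm (vx m) * norm (vy m))"
        unfolding a_def by (intro mult_left_mono C1 W) auto
    qed
    have a_le: "a m \<theta> \<le> \<sigma> m" if "\<theta> \<in> regular u" for m \<theta>
      unfolding \<sigma>_def by (rule cSUP_upper[OF that a_bdd])
    have \<sigma>_sum: "(\<Sum>m<n. \<sigma> m) \<le> D * norm x * norm y" for n
      unfolding \<sigma>_def
    proof (rule sum_SUP_le[OF _ regular_nonempty a_bdd])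
      fix \<theta> assume "\<And>m. m \<in> {..<n} \<Longrightarrow> \<theta> m \<in> regular u"
      then show "(\<Sum>m<n. a m (\<theta> m)) \<le> D * norm x * norm y"
        unfolding a_def vy_def vx_def by (intro D W) auto
    qed simp
    have h_hol: "(\<lambda>z. q m z * g z) holomorphic_on V s t" for m by (intro holomorphic_intros q_hol g)
    have term_bound: "cmod (bint u (\<lambda>z. EP z * (q m z * g z) * resolvent_form T (vy m) (vx m) z))
        \<le> 27 * C0 * G * L * B * \<sigma> m" for m
    proof -
      have "0 \<le> \<sigma> m" using a_le[of _ m] regular_nonempty unfolding a_def
        by (metis (no_types, lifting) all_not_in_conv mult_nonneg_nonneg norm_ge_zero of_nat_0_le_iff order_trans)
      define k where "k = 27 * C0 * G * L * \<sigma> m"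
      have "0 \<le> k" using \<open>0 < C0\<close> \<open>0 \<le> G\<close> \<open>0 \<le> L\<close> \<open>0 \<le> \<sigma> m\<close> by (simp add: k_def)
      have "cmod (bint u (\<lambda>z. EP z * (q m z * g z) * resolvent_form T (vy m) (vx m) z))
        \<le> integral (regular u) (\<lambda>\<theta>. k * (real (Suc m) * cmod (E_bdry \<xi>s u \<theta>) ^ m))"
        unfolding bint_def
      proof (rule Henstock_Kurzweil_Integration.integral_norm_bound_integral)
        show "(\<lambda>\<theta>. EP (E_bdry \<xi>s u \<theta>) * (q m (E_bdry \<xi>s u \<theta>) * g (E_bdry \<xi>s u \<theta>)) *
            resolvent_form T (vy m) (vx m) (E_bdry \<xi>s u \<theta>) * E_bdry_deriv u \<theta>) integrable_on regular u"
          using bint_resolvent_integrable[OF u1(3) u(3,4) t h_hol] unfolding bintegrable_def .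
        show "(\<lambda>\<theta>. k * (real (Suc m) * cmod (E_bdry \<xi>s u \<theta>) ^ m)) integrable_on regular u"
          by (rule integrable_on_mult_right[OF Bint])
        fix \<theta> assume \<theta>: "\<theta> \<in> regular u"
        define z where "z = E_bdry \<xi>s u \<theta>"
        have "cmod (EP z * (q m z * g z) * resolvent_form T (vy m) (vx m) z * E_bdry_deriv u \<theta>)
          = cmod (q m z) * cmod (g z) * cmod (EP z * resolvent_form T (vy m) (vx m) z) * cmod (E_bdry_deriv u \<theta>)"
          by (simp add: norm_mult)
        \<comment> \<open>Of the square of m + 1, one factor is absorbed by \<sigma>, the other
          joins |z|^m in the integral bounded by \<open>B\<close>.\<close>
        also have "\<dots> \<le> (27 * C0 * real (Suc m) ^ 2 * cmod z ^ m) * G * (\<sigma> m / real (Suc m)) * L"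
        proof (intro mult_mono mult_nonneg_nonneg L)
          show "cmod (q m z) \<le> 27 * C0 * real (Suc m) ^ 2 * cmod z ^ m"
            using q_bound[of z m] disc[of \<theta>] by (simp add: z_def)
          show "cmod (g z) \<le> G" using G V by (simp add: z_def)
          show "cmod (EP z * resolvent_form T (vy m) (vx m) z) \<le> \<sigma> m / real (Suc m)"
            using a_le[OF \<theta>, of m] by (simp add: a_def z_def field_simps)
        qed (use \<open>0 < C0\<close> \<open>0 \<le> G\<close> \<open>0 \<le> L\<close> \<open>0 \<le> \<sigma> m\<close> in auto)
        also have "\<dots> = k * (real (Suc m) * cmod z ^ m)"
          by (simp add: k_def power2_eq_square field_simps)
        finally show "norm (EP (E_bdry \<xi>s u \<theta>) * (q m (E_bdry \<xi>s u \<theta>) * g (E_bdry \<xi>s u \<theta>)) *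
            resolvent_form T (vy m) (vx m) (E_bdry \<xi>s u \<theta>) * E_bdry_deriv u \<theta>)
          \<le> k * (real (Suc m) * cmod (E_bdry \<xi>s u \<theta>) ^ m)"
          by (simp add: z_def)
      qed
      also have "\<dots> = k * integral (regular u) (\<lambda>\<theta>. real (Suc m) * cmod (E_bdry \<xi>s u \<theta>) ^ m)"
        by (rule integral_mult_right)
      also have "\<dots> \<le> k * B" using B \<open>0 \<le> k\<close> by (intro mult_left_mono)
      finally show ?thesis by (simp add: k_def mult_ac)
    qed
    define f where "f n z = EP z * (EP z ^ 2 * g z * S n z) * resolvent_form T y x z" for n z
    have f_bint: "bintegrable u (f n)" for n
      unfolding f_def
      by (rule bint_resolvent_integrable[OF u1(3) u(3,4) t]) (intro holomorphic_intros g S_hol)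
    have f_bound: "cmod (bint u (f n)) \<le> K * G * norm x * norm y" for n
    proof -
      have "f n z = (\<Sum>m<n. EP z * (z ^ (2 * m) * EP z ^ 2 * (q m z * g z)) * resolvent_form T y x z)" for z
        unfolding f_def S_def by (simp add: sum_distrib_left sum_distrib_right mult_ac)
      then have "bint u (f n) = bint u (\<lambda>z. \<Sum>m<n. EP z * (z ^ (2 * m) * EP z ^ 2 * (q m z * g z)) * resolvent_form T y x z)"
        by (intro bint_cong) simp
      also have "\<dots> = (\<Sum>m<n. bint u (\<lambda>z. EP z * (z ^ (2 * m) * EP z ^ 2 * (q m z * g z)) * resolvent_form T y x z))"
        by (intro bint_sum bint_resolvent_integrable[OF u1(3) u(3,4) t] holomorphic_intros q_hol g) auto
      also have "\<dots> = (\<Sum>m<n. bint u (\<lambda>z. EP z * (q m z * g z) * resolvent_form T (vy m) (vx m) z))"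
        unfolding vy_def vx_def
        by (intro sum.cong refl bint_ritt_orbit_split[OF u1(3) u(3,4) t dist h_hol])
      finally have "cmod (bint u (f n)) \<le> (\<Sum>m<n. 27 * C0 * G * L * B * \<sigma> m)"
        by (simp only:) (intro sum_norm_le term_bound)
      also have "\<dots> = 27 * C0 * G * L * B * (\<Sum>m<n. \<sigma> m)" by (simp only: sum_distrib_left)
      also have "\<dots> \<le> 27 * C0 * G * L * B * (D * norm x * norm y)"
        using \<sigma>_sum \<open>0 < C0\<close> \<open>0 \<le> G\<close> \<open>0 \<le> L\<close> \<open>0 < B\<close> by (intro mult_left_mono) auto
      finally show ?thesis by (simp add: K_def mult_ac)
    qed
    have "(\<lambda>n. bint u (f n)) \<longlonglongrightarrow> bint u (\<lambda>z. EP z * (EP z ^ 2 * g z / EP (of_real t * z) ^ 3) * resolvent_form T y x z)"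
      unfolding bint_def
    proof (rule dominated_convergence(2))
      show "(\<lambda>\<theta>. f n (E_bdry \<xi>s u \<theta>) * E_bdry_deriv u \<theta>) integrable_on regular u" for n
        using f_bint unfolding bintegrable_def .
      let ?M = "(2 ^ card (set \<xi>s)) ^ 2 * G * Mc * (C1 * norm x * norm y) * L"
      show "(\<lambda>_. ?M) integrable_on regular u" by (rule integrable_const_regular)
      fix n \<theta> assume \<theta>: "\<theta> \<in> regular u"
      define z where "z = E_bdry \<xi>s u \<theta>"
      have z: "cmod z \<le> 1" "z \<in> V s t" "z \<in> W s'"
        using disc V W[OF \<theta>] by (simp_all add: z_def)
      have "0 \<le> Mc" using order_trans[OF norm_ge_zero S_bound[OF z(1)]] .
      have "cmod (f n z * E_bdry_deriv u \<theta>)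
        = cmod (EP z) ^ 2 * cmod (g z) * cmod (S n z) * cmod (EP z * resolvent_form T y x z) * cmod (E_bdry_deriv u \<theta>)"
        by (simp add: f_def norm_mult norm_power)
      also have "\<dots> \<le> ?M"
        by (intro mult_mono mult_nonneg_nonneg power_mono cmod_EP_le G S_bound C1 L z)
           (use \<open>0 \<le> G\<close> \<open>0 \<le> Mc\<close> \<open>0 < C1\<close> in auto)
      finally show "norm (f n (E_bdry \<xi>s u \<theta>) * E_bdry_deriv u \<theta>) \<le> ?M" by (simp add: z_def)
    next
      fix \<theta> assume \<theta>: "\<theta> \<in> regular u"
      define z where "z = E_bdry \<xi>s u \<theta>"
      have "cmod (of_real t * z) < 1" by (rule V_dilate[of _ s]) (use V u in \<open>auto simp: z_def\<close>)
      from S_lim[OF this]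
      have "(\<lambda>n. f n z * E_bdry_deriv u \<theta>) \<longlonglongrightarrow>
        EP z * (EP z ^ 2 * g z * (1 / EP (of_real t * z) ^ 3)) * resolvent_form T y x z * E_bdry_deriv u \<theta>"
        unfolding f_def by (intro tendsto_intros)
      then show "(\<lambda>n. f n (E_bdry \<xi>s u \<theta>) * E_bdry_deriv u \<theta>) \<longlonglongrightarrow>
        EP (E_bdry \<xi>s u \<theta>) * (EP (E_bdry \<xi>s u \<theta>) ^ 2 * g (E_bdry \<xi>s u \<theta>) / EP (of_real t * E_bdry \<xi>s u \<theta>) ^ 3)
          * resolvent_form T y x (E_bdry \<xi>s u \<theta>) * E_bdry_deriv u \<theta>"
        by (simp add: z_def)
    qed
    then show ?thesis
      by (intro LIMSEQ_le_const2[OF tendsto_norm]) (use f_bound in auto)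
  qed
  ultimately show ?thesis by (rule that)
qed

end

section \<open>Removing the dilation, and the link to \<open>H_calc\<close>\<close>

context peripheral_operator
begin

text \<open>Each distance to E is at most 2, so lowering all exponents to a common one costs a
  constant factor.\<close>

lemma H0_inf_decay:
  assumes "\<phi> \<in> H0_inf \<xi>s s" "s \<le> 1"
  obtains C \<alpha> where "0 < C" "0 < \<alpha>" "\<alpha> \<le> 1" "\<And>w. w \<in> E_dom \<xi>s s \<Longrightarrow> cmod (\<phi> w) \<le> C * cmod (EP w) powr \<alpha>"
proof -
  obtain C a where "0 < C" and a: "\<And>\<xi>. \<xi> \<in> set \<xi>s \<Longrightarrow> 0 < a \<xi>"
    and \<phi>: "\<And>z. z \<in> E_dom \<xi>s s \<Longrightarrow> cmod (\<phi> z) \<le> C * (\<Prod>\<xi>\<in>set \<xi>s. cmod (\<xi> - z) powr a \<xi>)"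
    using assms(1) unfolding H0_inf_def by blast
  \<comment> \<open>Including 1 in the minimum makes \<alpha> - 1 nonpositive, so that lower bounds
    for \<open>EP\<close> can be inserted into the power.\<close>
  define \<alpha> where "\<alpha> = Min (insert 1 (a ` set \<xi>s))"
  have "0 < \<alpha>" "\<alpha> \<le> 1" unfolding \<alpha>_def using a by auto
  have \<alpha>: "\<alpha> \<le> a \<xi>" if "\<xi> \<in> set \<xi>s" for \<xi>
    unfolding \<alpha>_def using that by (intro Min_le) auto
  define B where "B = (\<Prod>\<xi>\<in>set \<xi>s. 2 powr (a \<xi> - \<alpha>))"
  have "0 < B" unfolding B_def by (intro prod_pos) simp
  have "cmod (\<phi> w) \<le> C * B * cmod (EP w) powr \<alpha>" if w: "w \<in> E_dom \<xi>s s" for w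
  proof -
    have "cmod (\<xi> - w) powr a \<xi> \<le> 2 powr (a \<xi> - \<alpha>) * cmod (\<xi> - w) powr \<alpha>" if \<xi>: "\<xi> \<in> set \<xi>s" for \<xi>
    proof -
      have "cmod w \<le> 1" using w E_dom_subset_ball[OF assms(2)] by auto
      then have "cmod (\<xi> - w) \<le> 2" using norm_triangle_ineq4[of \<xi> w] cmod_xi[OF \<xi>] by simp
      then have "cmod (\<xi> - w) powr (a \<xi> - \<alpha>) \<le> 2 powr (a \<xi> - \<alpha>)"
        using \<alpha>[OF \<xi>] by (intro powr_mono2) auto
      then have "cmod (\<xi> - w) powr (a \<xi> - \<alpha>) * cmod (\<xi> - w) powr \<alpha> \<le> 2 powr (a \<xi> - \<alpha>) * cmod (\<xi> - w) powr \<alpha>"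
        by (intro mult_right_mono) auto
      then show ?thesis by (simp flip: powr_add)
    qed
    then have "(\<Prod>\<xi>\<in>set \<xi>s. cmod (\<xi> - w) powr a \<xi>) \<le> (\<Prod>\<xi>\<in>set \<xi>s. 2 powr (a \<xi> - \<alpha>) * cmod (\<xi> - w) powr \<alpha>)"
      by (intro prod_mono) auto
    also have "\<dots> = B * cmod (EP w) powr \<alpha>"
      by (simp add: prod.distrib B_def cmod_EP prod_powr_distrib)
    finally have "C * (\<Prod>\<xi>\<in>set \<xi>s. cmod (\<xi> - w) powr a \<xi>) \<le> C * (B * cmod (EP w) powr \<alpha>)"
      using \<open>0 < C\<close> by (intro mult_left_mono) auto
    then show ?thesis using \<phi>[OF w] by simp
  qed
  then show ?thesis
    using that[of "C * B" \<alpha>] \<open>0 < C\<close> \<open>0 < B\<close> \<open>0 < \<alpha>\<close> \<open>\<alpha> \<le> 1\<close> by simp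
qed

text \<open>The product is at least a constant times a single distance to E, which is at least 1 -
  |z|, which is at least a multiple of the angular distance.\<close>

lemma EP_bdry_lower:
  assumes u: "r \<le> u" "u < 1"
  obtains P \<delta> where "finite P" "0 < \<delta>" "P \<inter> regular u = {}"
    "\<And>\<theta>. \<theta> \<in> {0..2*pi} \<Longrightarrow> \<exists>p\<in>P. \<delta> * \<bar>\<theta> - p\<bar> \<le> cmod (EP (E_bdry \<xi>s u \<theta>))"
proof -
  obtain P c where P: "finite P" "0 < c" "\<And>p. p \<in> P \<Longrightarrow> cis p \<in> set \<xi>s"
    and Pc: "\<And>\<theta>. \<theta> \<in> {0..2*pi} \<Longrightarrow> \<exists>p\<in>P. c * \<bar>\<theta> - p\<bar> \<le> 1 - cmod (E_bdry \<xi>s u \<theta>)"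
    using bdry_distance[OF u] by blast
  obtain d where "0 < d" and d: "\<And>z. \<exists>\<xi>\<in>set \<xi>s. d * cmod (\<xi> - z) \<le> cmod (EP z)"
    using prod_dist_ge_min[of "set \<xi>s"] nonempty unfolding cmod_EP by auto
  have "P \<inter> regular u = {}"
  proof (rule ccontr)
    assume "P \<inter> regular u \<noteq> {}"
    then obtain p where p: "p \<in> P" "p \<in> regular u" by blast
    have "Im (cnj (cis p) * cis p) = 0" by simp
    then show False using P(3)[OF p(1)] p(2) unfolding regular_def singular_angles_def by blast
  qed
  moreover have "\<exists>p\<in>P. (d * c) * \<bar>\<theta> - p\<bar> \<le> cmod (EP (E_bdry \<xi>s u \<theta>))" if \<theta>: "\<theta> \<in> {0..2*pi}" for \<theta>
  proof -
    obtain p where p: "p \<in> P" "c * \<bar>\<theta> - p\<bar> \<le> 1 - cmod (E_bdry \<xi>s u \<theta>)" using Pc[OF \<theta>] by blast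
    obtain \<xi> where \<xi>: "\<xi> \<in> set \<xi>s" "d * cmod (\<xi> - E_bdry \<xi>s u \<theta>) \<le> cmod (EP (E_bdry \<xi>s u \<theta>))"
      using d by blast
    have "c * \<bar>\<theta> - p\<bar> \<le> cmod (\<xi> - E_bdry \<xi>s u \<theta>)"
      using p(2) norm_triangle_ineq2[of \<xi> "E_bdry \<xi>s u \<theta>"] cmod_xi[OF \<xi>(1)] by simp
    then have "d * (c * \<bar>\<theta> - p\<bar>) \<le> d * cmod (\<xi> - E_bdry \<xi>s u \<theta>)"
      using \<open>0 < d\<close> by (intro mult_left_mono) auto
    then have "(d * c) * \<bar>\<theta> - p\<bar> \<le> cmod (EP (E_bdry \<xi>s u \<theta>))" using \<xi>(2) by (simp add: mult.assoc)
    with p(1) show ?thesis by blast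
  qed
  moreover have "0 < d * c" using \<open>0 < d\<close> P by simp
  ultimately show ?thesis using that[OF P(1)] by blast
qed

lemma dilated_holomorphic:
  assumes "\<phi> holomorphic_on E_dom \<xi>s s" "s \<le> 1"
  shows "(\<lambda>z. \<phi> (of_real t * z)) holomorphic_on V s t"
    and "(\<lambda>z. EP z ^ 2 * \<phi> (of_real t * z) / EP (of_real t * z) ^ 3) holomorphic_on V s t"
proof -
  have "(\<phi> \<circ> (\<lambda>z. of_real t * z)) holomorphic_on V s t"
    by (rule holomorphic_on_compose_gen[OF _ assms(1)]) (auto simp: V_def intro!: holomorphic_intros)
  then show *: "(\<lambda>z. \<phi> (of_real t * z)) holomorphic_on V s t" by (simp add: o_def)
  have "EP (of_real t * z) ^ 3 \<noteq> 0" if "z \<in> V s t" for z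
    using EP_dilate_nonzero[OF V_dilate[OF that assms(2)]] by simp
  then show "(\<lambda>z. EP z ^ 2 * \<phi> (of_real t * z) / EP (of_real t * z) ^ 3) holomorphic_on V s t"
    by (intro holomorphic_intros *) auto
qed

text \<open>With w = t z the integrand is at most a constant times |EP w|^(\<alpha> - 1). Comparing
  \<open>EP w\<close> with \<open>EP z\<close> turns this into a majorant with powers of |\<theta> -
  p|, integrable and free of t.\<close>

lemma dilated_calculus_tendsto:
  assumes \<phi>: "\<phi> \<in> H0_inf \<xi>s s" and u: "r < u" "u < s" "s < 1"
  defines "t \<equiv> toward_1 (1/2)"
  shows "(\<lambda>n. bint u (\<lambda>z. EP z * (EP z ^ 2 * \<phi> (of_real (t n) * z) / EP (of_real (t n) * z) ^ 3)
      * resolvent_form T y x z))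
    \<longlonglongrightarrow> bint u (\<lambda>z. \<phi> z * resolvent_form T y x z)"
proof -
  have u1: "r \<le> u" "u < 1" using u by auto
  have t: "1/2 < t n" "t n < 1" for n
    unfolding t_def by (rule toward_1, simp)+
  note t_lim = toward_1_tendsto[of "1/2", folded t_def]
  have hol: "\<phi> holomorphic_on E_dom \<xi>s s" using \<phi> by (simp add: H0_inf_def)
  have s1: "s \<le> 1" using u by simp
  obtain C \<alpha> where "0 < C" "0 < \<alpha>" "\<alpha> \<le> 1"
    and decay: "\<And>w. w \<in> E_dom \<xi>s s \<Longrightarrow> cmod (\<phi> w) \<le> C * cmod (EP w) powr \<alpha>"
    using H0_inf_decay[OF \<phi> s1] by blast
  obtain P \<delta> where P: "finite P" "0 < \<delta>" "P \<inter> regular u = {}"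
    and low: "\<And>\<theta>. \<theta> \<in> {0..2*pi} \<Longrightarrow> \<exists>p\<in>P. \<delta> * \<bar>\<theta> - p\<bar> \<le> cmod (EP (E_bdry \<xi>s u \<theta>))"
    using EP_bdry_lower[OF u1] by blast
  define L where "L = card (set \<xi>s) * (2 / u ^ 3) + 1"
  have L: "cmod (E_bdry_deriv u \<theta>) \<le> L" for \<theta>
    unfolding L_def by (rule E_bdry_deriv_bound[OF u1])
  have "0 \<le> L" using order_trans[OF norm_ge_zero L[of 0]] .
  define s' where "s' = (r + u) / 2"
  have s': "r < s'" "s' < u" "s' < 1" using u by (auto simp: s'_def)
  obtain C1 where "0 < C1" and C1: "\<And>z x y. z \<in> W s' \<Longrightarrow> cmod (EP z * resolvent_form T y x z) \<le> C1 * norm x * norm y"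
    using resolvent_form_bound[OF s'(1,3)] by blast
  have W: "E_bdry \<xi>s u \<theta> \<in> W s'" if "\<theta> \<in> regular u" for \<theta>
    by (rule regular_bdry_in_W[OF _ s'(2) u1(2) that]) (use s' in simp)
  define M where "M = (2 :: real) ^ card (set \<xi>s)"
  have "0 < M" by (simp add: M_def)
  define k where "k = (C1 * norm x * norm y) * M\<^sup>2 * C * L * (\<delta> / M) powr (\<alpha> - 1)"
  have "0 \<le> k" using \<open>0 < C1\<close> \<open>0 < M\<close> \<open>0 < C\<close> \<open>0 \<le> L\<close> by (simp add: k_def)
  show ?thesis
    unfolding bint_def
  proof (rule dominated_convergence(2))
    show "(\<lambda>\<theta>. EP (E_bdry \<xi>s u \<theta>) * (EP (E_bdry \<xi>s u \<theta>) ^ 2 * \<phi> (of_real (t n) * E_bdry \<xi>s u \<theta>)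
        / EP (of_real (t n) * E_bdry \<xi>s u \<theta>) ^ 3) * resolvent_form T y x (E_bdry \<xi>s u \<theta>) * E_bdry_deriv u \<theta>)
      integrable_on regular u" for n
      using bint_resolvent_integrable[OF u t dilated_holomorphic(2)[OF hol s1], of n y x]
      unfolding bintegrable_def .
    have "(\<lambda>\<theta>. \<Sum>p\<in>P. k * \<bar>\<theta> - p\<bar> powr (\<alpha> - 1)) integrable_on {0..2*pi}"
      by (intro integrable_sum[OF P(1)] integrable_on_mult_right powr_abs_shift_integrable \<open>0 < \<alpha>\<close>) simp
    then show "(\<lambda>\<theta>. \<Sum>p\<in>P. k * \<bar>\<theta> - p\<bar> powr (\<alpha> - 1)) integrable_on regular u"
      unfolding regular_def by (rule integrable_on_diff_finite[OF finite_singular_angles])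
  next
    fix n \<theta> assume \<theta>: "\<theta> \<in> regular u"
    define z where "z = E_bdry \<xi>s u \<theta>"
    define w where "w = of_real (t n) * z"
    have z: "cmod z \<le> 1" "z \<in> V s (t n)" "z \<in> W s'"
      using cmod_E_bdry_le_1[OF u1] regular_bdry_in_V[OF u1(1) u(2,3), of "t n" \<theta>] t[of n] W[OF \<theta>]
      by (simp_all add: z_def)
    have wE: "w \<in> E_dom \<xi>s s" using z(2) by (simp add: V_def w_def)
    have "EP w \<noteq> 0" unfolding w_def by (rule EP_dilate_nonzero[OF V_dilate[OF z(2) s1]])
    then have w0: "0 < cmod (EP w)" by simp
    have zw: "cmod (EP z) \<le> M * cmod (EP w)"
      unfolding M_def w_def by (rule cmod_EP_le_dilate[OF z(1)]) (use t[of n] in auto)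
    obtain p where p: "p \<in> P" "\<delta> * \<bar>\<theta> - p\<bar> \<le> cmod (EP z)"
      unfolding z_def using low[of \<theta>] \<theta> by (auto simp: regular_def)
    have "\<theta> \<noteq> p" using p(1) \<theta> P(3) by blast
    have "\<delta> / M * \<bar>\<theta> - p\<bar> \<le> cmod (EP w)"
      using p(2) zw \<open>0 < M\<close> by (simp add: field_simps)
    then have "cmod (EP w) powr (\<alpha> - 1) \<le> (\<delta> / M * \<bar>\<theta> - p\<bar>) powr (\<alpha> - 1)"
      using \<open>\<alpha> \<le> 1\<close> \<open>0 < M\<close> P(2) \<open>\<theta> \<noteq> p\<close> by (intro powr_mono2') auto
    also have "\<dots> = (\<delta> / M) powr (\<alpha> - 1) * \<bar>\<theta> - p\<bar> powr (\<alpha> - 1)"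
      using \<open>0 < M\<close> P(2) by (intro powr_mult)
    finally have sing: "cmod (EP w) powr (\<alpha> - 1) \<le> (\<delta> / M) powr (\<alpha> - 1) * \<bar>\<theta> - p\<bar> powr (\<alpha> - 1)" .
    have "cmod (EP z * (EP z ^ 2 * \<phi> w / EP w ^ 3) * resolvent_form T y x z * E_bdry_deriv u \<theta>)
      = cmod (EP z * resolvent_form T y x z) * cmod (EP z) ^ 2 * cmod (\<phi> w) * cmod (E_bdry_deriv u \<theta>) / cmod (EP w) ^ 3"
      by (simp add: norm_mult norm_divide norm_power)
    \<comment> \<open>One factor \<open>EP z\<close> stays with the resolvent; the other two are
      compared with \<open>EP w\<close> and leave one power of it in the denominator.\<close>
    also have "\<dots> \<le> (C1 * norm x * norm y) * (M * cmod (EP w)) ^ 2 * (C * cmod (EP w) powr \<alpha>) * L / cmod (EP w) ^ 3"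
      by (intro divide_right_mono mult_mono mult_nonneg_nonneg power_mono C1 z decay wE L zw)
         (use \<open>0 < C1\<close> \<open>0 < C\<close> in auto)
    also have "\<dots> = (C1 * norm x * norm y) * M\<^sup>2 * C * L * (cmod (EP w) powr \<alpha> / cmod (EP w))"
      using w0 by (simp add: power_mult_distrib power2_eq_square power3_eq_cube field_simps)
    also have "cmod (EP w) powr \<alpha> / cmod (EP w) = cmod (EP w) powr (\<alpha> - 1)"
      using w0 by (simp add: powr_diff)
    also have "(C1 * norm x * norm y) * M\<^sup>2 * C * L * (cmod (EP w) powr (\<alpha> - 1))
        \<le> (C1 * norm x * norm y) * M\<^sup>2 * C * L * ((\<delta> / M) powr (\<alpha> - 1) * \<bar>\<theta> - p\<bar> powr (\<alpha> - 1))"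
      using sing \<open>0 < C1\<close> \<open>0 < C\<close> \<open>0 \<le> L\<close> by (intro mult_left_mono) auto
    also have "\<dots> = k * \<bar>\<theta> - p\<bar> powr (\<alpha> - 1)" by (simp add: k_def)
    also have "\<dots> \<le> (\<Sum>p\<in>P. k * \<bar>\<theta> - p\<bar> powr (\<alpha> - 1))"
      by (rule member_le_sum[OF p(1) _ P(1)]) (use \<open>0 \<le> k\<close> in auto)
    finally show "norm (EP (E_bdry \<xi>s u \<theta>) * (EP (E_bdry \<xi>s u \<theta>) ^ 2 * \<phi> (of_real (t n) * E_bdry \<xi>s u \<theta>)
        / EP (of_real (t n) * E_bdry \<xi>s u \<theta>) ^ 3) * resolvent_form T y x (E_bdry \<xi>s u \<theta>) * E_bdry_deriv u \<theta>)
      \<le> (\<Sum>p\<in>P. k * \<bar>\<theta> - p\<bar> powr (\<alpha> - 1))"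
      by (simp add: z_def w_def)
  next
    fix \<theta> assume \<theta>: "\<theta> \<in> regular u"
    define z where "z = E_bdry \<xi>s u \<theta>"
    have corner: "z \<notin> set \<xi>s"
      unfolding z_def by (rule regular_angle_not_corner[OF u1]) (use \<theta> in \<open>simp add: regular_def\<close>)
    have "z \<in> E_dom \<xi>s s"
      using closure_E_dom_subset[OF u1(1) u(2)] E_bdry_in_closure[OF u1, of \<theta>] corner by (auto simp: z_def)
    then have c\<phi>: "isCont \<phi> z"
      using holomorphic_on_imp_continuous_on[OF hol] open_E_dom by (simp add: continuous_on_eq_continuous_at)
    have cEP: "isCont EP z"
      using continuous_on_EP[OF continuous_on_id, of UNIV] by (simp add: continuous_on_eq_continuous_at)
    have "(\<lambda>n. of_real (t n) * z) \<longlonglongrightarrow> of_real 1 * z" by (intro tendsto_intros t_lim)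
    then have tz: "(\<lambda>n. of_real (t n) * z) \<longlonglongrightarrow> z" by simp
    have nz: "EP z \<noteq> 0" using corner by (simp add: EP_eq_0_iff)
    have "(\<lambda>n. EP z * (EP z ^ 2 * \<phi> (of_real (t n) * z) / EP (of_real (t n) * z) ^ 3) * resolvent_form T y x z * E_bdry_deriv u \<theta>)
      \<longlonglongrightarrow> EP z * (EP z ^ 2 * \<phi> z / EP z ^ 3) * resolvent_form T y x z * E_bdry_deriv u \<theta>"
      by (intro tendsto_intros isCont_tendsto_compose[OF c\<phi> tz] isCont_tendsto_compose[OF cEP tz]) (use nz in simp)
    moreover have "EP z * (EP z ^ 2 * \<phi> z / EP z ^ 3) = \<phi> z"
      using nz by (simp add: power2_eq_square power3_eq_cube)
    ultimately have "(\<lambda>n. EP z * (EP z ^ 2 * \<phi> (of_real (t n) * z) / EP (of_real (t n) * z) ^ 3) * resolvent_form T y x z * E_bdry_deriv u \<theta>)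
      \<longlonglongrightarrow> \<phi> z * resolvent_form T y x z * E_bdry_deriv u \<theta>" by (simp only:)
    then show "(\<lambda>n. EP (E_bdry \<xi>s u \<theta>) * (EP (E_bdry \<xi>s u \<theta>) ^ 2 * \<phi> (of_real (t n) * E_bdry \<xi>s u \<theta>)
        / EP (of_real (t n) * E_bdry \<xi>s u \<theta>) ^ 3) * resolvent_form T y x (E_bdry \<xi>s u \<theta>) * E_bdry_deriv u \<theta>)
      \<longlonglongrightarrow> \<phi> (E_bdry \<xi>s u \<theta>) * resolvent_form T y x (E_bdry \<xi>s u \<theta>) * E_bdry_deriv u \<theta>"
      unfolding z_def .
  qed
qed

text \<open>If the operator-valued gauge integral does not exist, \<open>integral\<close> returns 0;
  the second alternative records this case, where the norm bound is trivial. If it exists, pairing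
  with x and y commutes with it.\<close>

lemma H_calc_form:
  assumes u: "r \<le> u" "u < 1"
  shows "cblinfun_apply y (cblinfun_apply (H_calc \<xi>s u \<phi> T) x)
      = 1 / (2 * of_real pi * \<i>) * bint u (\<lambda>z. \<phi> z * resolvent_form T y x z)
    \<or> H_calc \<xi>s u \<phi> T = 0"
proof -
  define f where "f \<theta> = (\<phi> (E_bdry \<xi>s u \<theta>) * vector_derivative (E_bdry \<xi>s u) (at \<theta>)) *\<^sub>C resolvent (E_bdry \<xi>s u \<theta>) T" for \<theta>
  have H: "H_calc \<xi>s u \<phi> T = (1 / (2 * of_real pi * \<i>)) *\<^sub>C integral {0..2*pi} f"
    by (simp only: H_calc_def flip: f_def)
  show ?thesis
  proof (cases "f integrable_on {0..2*pi}")
    case False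
    then show ?thesis using H by (simp add: not_integrable_integral scaleC_zero_right)
  next
    case True
    define e where "e A = cblinfun_apply y (cblinfun_apply A x)" for A :: "('a, 'a) cblinfun"
    have e: "bounded_linear e"
    proof (rule bounded_linear_intro[where K="norm y * norm x"])
      show "e (A + B) = e A + e B" for A B by (simp add: e_def cblinfun_apply_add_left cblinfun_apply_add)
      show "e (c *\<^sub>R A) = c *\<^sub>R e A" for c A by (simp add: e_def cblinfun_apply_scaleR_left cblinfun_apply_scaleR)
      have "cmod (e A) \<le> norm y * (norm A * norm x)" for A
        unfolding e_def by (rule order_trans[OF cblinfun_norm_apply]) (intro mult_left_mono cblinfun_norm_apply norm_ge_zero)
      then show "norm (e A) \<le> norm A * (norm y * norm x)" for A by (simp add: mult_ac)
    qed
    have "((\<lambda>\<theta>. e (f \<theta>)) has_integral e (integral {0..2*pi} f)) {0..2*pi}"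
      using has_integral_linear[OF integrable_integral[OF True] e] by (simp add: o_def)
    then have "((\<lambda>\<theta>. e (f \<theta>)) has_integral e (integral {0..2*pi} f)) (regular u)"
      unfolding regular_def has_integral_diff_finite_iff[OF finite_singular_angles] .
    then have "e (integral {0..2*pi} f) = integral (regular u) (\<lambda>\<theta>. e (f \<theta>))" by (rule integral_unique[symmetric])
    also have "\<dots> = bint u (\<lambda>z. \<phi> z * resolvent_form T y x z)"
      unfolding bint_def
    proof (rule integral_cong)
      fix \<theta> assume "\<theta> \<in> regular u"
      then have "vector_derivative (E_bdry \<xi>s u) (at \<theta>) = E_bdry_deriv u \<theta>"
        by (intro vector_derivative_at E_bdry_has_vector_derivative[OF u]) (simp add: regular_def)
      then show "e (f \<theta>) = \<phi> (E_bdry \<xi>s u \<theta>) * resolvent_form T y x (E_bdry \<xi>s u \<theta>) * E_bdry_deriv u \<theta>"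
        by (simp add: e_def f_def cblinfun_apply_scaleC_left cblinfun_apply_scaleC scaleC_complex_def
            resolvent_form_def)
    qed
    finally show ?thesis
      unfolding H by (simp add: e_def cblinfun_apply_scaleC_left cblinfun_apply_scaleC scaleC_complex_def)
  qed
qed

end

section \<open>The bounded calculus from the two square function estimates\<close>

theorem theorem6p5:
  fixes T :: "('a::complex_banach, 'a) cblinfun"
    and M :: "'w measure" and \<epsilon> :: "nat \<Rightarrow> 'w \<Rightarrow> real"
    and \<xi>s :: "complex list" and r C :: real
  assumes "rademacher_seq M \<epsilon>"
    and "\<xi>s \<noteq> []" and "distinct \<xi>s" and "set \<xi>s \<subseteq> sphere 0 1"
    and "0 < r" and "r < 1"
    and "R_Ritt M \<epsilon> \<xi>s T"
    and "R_type M \<epsilon> \<xi>s r T"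
    and "0 < C"
    and "\<And>x :: 'a. square_fun M \<epsilon> \<xi>s T x \<le> ennreal (C * norm x)"
    and "\<And>y :: 'a cdual. square_fun M \<epsilon> \<xi>s (cadjoint T) y \<le> ennreal (C * norm y)"
  shows "\<forall>s\<in>{r<..<1}. bounded_Hinf_calculus \<xi>s r s T"
proof
  fix s assume "s \<in> {r<..<1}"
  then have s: "r < s" "s < 1" by auto
  note R = assms(1)
  have Rb: "R_bounded M \<epsilon> {(\<Prod>\<xi>\<in>set \<xi>s. \<xi> - z) *\<^sub>C resolvent z T | z. z \<in> ball 0 2 - closure (E_dom \<xi>s s')}"
    if "r < s'" "s' < 1" for s'
    using assms(8) that unfolding R_type_def by auto
  interpret peripheral_operator \<xi>s r T
  proof
    show "\<xi>s \<noteq> []" "set \<xi>s \<subseteq> sphere 0 1" "0 < r" "r < 1" by (fact assms)+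
    show "E_large_enough \<xi>s r" "spectrum T \<subseteq> closure (E_dom \<xi>s r)"
      using assms(8) by (auto simp: R_type_def)
    fix s' assume "r < s'" "s' < 1"
    from R_bounded_norm_bound[OF R Rb[OF this]]
    obtain B where "0 < B" and B: "\<And>A x. A \<in> {(\<Prod>\<xi>\<in>set \<xi>s. \<xi> - z) *\<^sub>C resolvent z T | z.
        z \<in> ball 0 2 - closure (E_dom \<xi>s s')} \<Longrightarrow> norm (cblinfun_apply A x) \<le> B * norm x" by blast
    have "norm ((\<Prod>\<xi>\<in>set \<xi>s. \<xi> - z) *\<^sub>C cblinfun_apply (resolvent z T) x) \<le> B * norm x"
      if "z \<in> ball 0 2 - closure (E_dom \<xi>s s')" for z x
      using B[of "(\<Prod>\<xi>\<in>set \<xi>s. \<xi> - z) *\<^sub>C resolvent z T" x] that by (auto simp: cblinfun_apply_scaleC_left)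
    with \<open>0 < B\<close> show "\<exists>C>0. \<forall>z\<in>ball 0 2 - closure (E_dom \<xi>s s'). \<forall>x.
        norm ((\<Prod>\<xi>\<in>set \<xi>s. \<xi> - z) *\<^sub>C cblinfun_apply (resolvent z T) x) \<le> C * norm x" by blast
  qed
  \<comment> \<open>One reference contour for all \<open>u\<close> keeps the constant independent of
    \<open>u\<close>; \<open>s'\<close> lies strictly inside it, so its regular points belong to
    \<open>W s'\<close>.\<close>
  define u0 where "u0 = (r + s) / 2"
  define s' where "s' = (r + u0) / 2"
  have u0: "r < s'" "s' < u0" "u0 < s" "r < u0" "s' < 1" using s by (auto simp: u0_def s'_def field_simps)
  obtain C0 where "0 < C0" and C0: "\<And>n A (x :: nat \<Rightarrow> 'a) (v :: nat \<Rightarrow> 'a cdual).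
      (\<And>k. k \<in> {1..n} \<Longrightarrow> A k \<in> {(\<Prod>\<xi>\<in>set \<xi>s. \<xi> - z) *\<^sub>C resolvent z T | z. z \<in> W s'}) \<Longrightarrow>
       (\<Sum>k=1..n. cmod (cblinfun_apply (v k) (cblinfun_apply (A k) (x k))))
         \<le> C0 * rad_norm M \<epsilon> n v * rad_norm M \<epsilon> n x"
    using R_bounded_absolute_sum[OF R Rb[OF u0(1,5)], folded W_def] by blast
  define D where "D = C0 * C * C"
  have "0 \<le> D" using \<open>0 < C0\<close> \<open>0 < C\<close> by (simp add: D_def)
  have D: "(\<Sum>m<n. real (Suc m) * cmod (EP (zs m) *
        resolvent_form T (ritt_orbit \<xi>s (cadjoint T) m y) (ritt_orbit \<xi>s T m x) (zs m)))
      \<le> D * norm x * norm y"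
    if zs: "\<And>m. m < n \<Longrightarrow> zs m \<in> W s'" for n zs x and y :: "'a cdual"
  proof -
    \<comment> \<open>With k = m + 1, the weights sqrt k of \<open>v\<close> and \<open>w\<close>
      multiply to the factor \<open>real (Suc m)\<close>.\<close>
    define v where "v k = sqrt (real k) *\<^sub>R ritt_orbit \<xi>s (cadjoint T) (k - 1) y" for k
    define w where "w k = sqrt (real k) *\<^sub>R ritt_orbit \<xi>s T (k - 1) x" for k
    define A where "A k = (\<Prod>\<xi>\<in>set \<xi>s. \<xi> - zs (k - 1)) *\<^sub>C resolvent (zs (k - 1)) T" for k
    have "real (Suc m) * cmod (EP (zs m) *
        resolvent_form T (ritt_orbit \<xi>s (cadjoint T) m y) (ritt_orbit \<xi>s T m x) (zs m))
      = cmod (cblinfun_apply (v (Suc m)) (cblinfun_apply (A (Suc m)) (w (Suc m))))" for m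
    proof -
      have "cblinfun_apply (v (Suc m)) (cblinfun_apply (A (Suc m)) (w (Suc m)))
        = (sqrt (real (Suc m)) * sqrt (real (Suc m))) *\<^sub>R ((\<Prod>\<xi>\<in>set \<xi>s. \<xi> - zs m)
          * resolvent_form T (ritt_orbit \<xi>s (cadjoint T) m y) (ritt_orbit \<xi>s T m x) (zs m))"
        unfolding v_def w_def A_def resolvent_form_def diff_Suc_1
        by (simp only: cblinfun_apply_scaleR_left cblinfun_apply_scaleC_left cblinfun_apply_scaleR
            cblinfun_apply_scaleC scaleC_complex_def scaleR_scaleR mult_scaleR_right)
      then show ?thesis
        by (simp add: norm_mult cmod_EP prod_norm del: of_nat_Suc)
    qed
    then have "(\<Sum>m<n. real (Suc m) * cmod (EP (zs m) *
        resolvent_form T (ritt_orbit \<xi>s (cadjoint T) m y) (ritt_orbit \<xi>s T m x) (zs m)))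
      = (\<Sum>k=1..n. cmod (cblinfun_apply (v k) (cblinfun_apply (A k) (w k))))"
      by (simp only: One_nat_def sum.atLeast1_atMost_eq)
    also have "\<dots> \<le> C0 * rad_norm M \<epsilon> n v * rad_norm M \<epsilon> n w"
    proof (rule C0)
      fix k assume "k \<in> {1..n}"
      then have "zs (k - 1) \<in> W s'" by (intro zs) auto
      then show "A k \<in> {(\<Prod>\<xi>\<in>set \<xi>s. \<xi> - z) *\<^sub>C resolvent z T | z. z \<in> W s'}"
        unfolding A_def by blast
    qed
    also have "\<dots> \<le> C0 * (C * norm y) * (C * norm x)"
    proof (intro mult_mono mult_nonneg_nonneg mult_left_mono rad_norm_nonneg)
      show "rad_norm M \<epsilon> n v \<le> C * norm y"
        unfolding v_def ritt_orbit_def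
        by (rule rad_norm_le_square_fun_bound[OF R assms(11)]) (use \<open>0 < C\<close> in simp)
      show "rad_norm M \<epsilon> n w \<le> C * norm x"
        unfolding w_def ritt_orbit_def
        by (rule rad_norm_le_square_fun_bound[OF R assms(10)]) (use \<open>0 < C\<close> in simp)
    qed (use \<open>0 < C0\<close> \<open>0 < C\<close> in auto)
    finally show ?thesis by (simp add: D_def mult_ac)
  qed
  obtain K where "0 \<le> K" and K: "\<And>t g G x y. 1/2 < t \<Longrightarrow> t < 1 \<Longrightarrow> g holomorphic_on V s t \<Longrightarrow>
      (\<And>z. z \<in> V s t \<Longrightarrow> cmod (g z) \<le> G) \<Longrightarrow>
      cmod (bint u0 (\<lambda>z. EP z * (EP z ^ 2 * g z / EP (of_real t * z) ^ 3) * resolvent_form T y x z))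
      \<le> K * G * norm x * norm y"
    using series_calculus_bound[OF assms(3) u0(1-3) s(2) \<open>0 \<le> D\<close> D] by blast
  \<comment> \<open>\<open>K + 1\<close> meets the demand that the constant be at least 1.\<close>
  have "norm (H_calc \<xi>s u \<phi> T) \<le> (K + 1) * sup_norm \<xi>s s \<phi>"
    if \<phi>: "\<phi> \<in> H0_inf \<xi>s s" and "u \<in> {r<..<s}" for \<phi> u
  proof -
    from that have u: "r < u" "u < s" "u < 1" "r \<le> u" using s by auto
    define G where "G = sup_norm \<xi>s s \<phi>"
    have "bounded (\<phi> ` E_dom \<xi>s s)" using \<phi> by (simp add: H0_inf_def)
    then obtain b where "\<And>z. z \<in> E_dom \<xi>s s \<Longrightarrow> cmod (\<phi> z) \<le> b" by (auto simp: bounded_iff)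
    then have "bdd_above ((\<lambda>z. cmod (\<phi> z)) ` E_dom \<xi>s s)" by (rule bdd_aboveI2)
    then have G: "cmod (\<phi> z) \<le> G" if "z \<in> E_dom \<xi>s s" for z
      unfolding G_def sup_norm_def by (intro cSUP_upper that)
    have "0 \<le> G" using order_trans[OF norm_ge_zero G[OF zero_in_E_dom]] s r_pos by simp
    have hol: "\<phi> holomorphic_on E_dom \<xi>s s" using \<phi> by (simp add: H0_inf_def)
    define t where "t = toward_1 (1/2)"
    have t: "1/2 < t n" "t n < 1" for n
      unfolding t_def by (rule toward_1, simp)+
    have "cmod (cblinfun_apply y (cblinfun_apply (H_calc \<xi>s u \<phi> T) x)) \<le> (K * G) * norm x * norm y"
      for x and y :: "'a cdual"
    proof -
      let ?b = "\<lambda>v n. bint v (\<lambda>z. EP z * (EP z ^ 2 * \<phi> (of_real (t n) * z) / EP (of_real (t n) * z) ^ 3)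
        * resolvent_form T y x z)"
      have "cmod (?b u n) \<le> K * G * norm x * norm y" for n
      proof -
        have "?b u n = ?b u0 n"
          by (rule bint_resolvent_independent[OF u(1,2) u0(4,3) s(2) t dilated_holomorphic(2)[OF hol]]) (use s in simp)
        moreover have "cmod (?b u0 n) \<le> K * G * norm x * norm y"
          by (rule K[OF t dilated_holomorphic(1)[OF hol]]) (use s G in \<open>auto simp: V_def\<close>)
        ultimately show ?thesis by simp
      qed
      moreover have "?b u \<longlonglongrightarrow> bint u (\<lambda>z. \<phi> z * resolvent_form T y x z)"
        unfolding t_def by (rule dilated_calculus_tendsto[OF \<phi> u(1,2) s(2)])
      ultimately have b: "cmod (bint u (\<lambda>z. \<phi> z * resolvent_form T y x z)) \<le> K * G * norm x * norm y"
        by (intro LIMSEQ_le_const2[OF tendsto_norm]) auto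
      from H_calc_form[OF u(4,3), of y \<phi> x] show ?thesis
      proof
        assume eq: "cblinfun_apply y (cblinfun_apply (H_calc \<xi>s u \<phi> T) x)
          = 1 / (2 * of_real pi * \<i>) * bint u (\<lambda>z. \<phi> z * resolvent_form T y x z)"
        have "cmod (1 / (2 * of_real pi * \<i>)) \<le> 1"
          using pi_gt3 by (simp add: norm_mult norm_divide)
        then show ?thesis
          unfolding eq norm_mult using b by (meson mult_left_le_one_le norm_ge_zero order_trans)
      next
        assume "H_calc \<xi>s u \<phi> T = 0"
        then have "cblinfun_apply (H_calc \<xi>s u \<phi> T) x = 0"
          by (simp add: cblinfun_apply.rep_eq zero_cblinfun.rep_eq)
        then show ?thesis
          using \<open>0 \<le> K\<close> \<open>0 \<le> G\<close> cblinfun_apply_diff[of y 0 0] by simp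
      qed
    qed
    then have "norm (H_calc \<xi>s u \<phi> T) \<le> K * G"
      by (rule cblinfun_norm_bound_weak) (use \<open>0 \<le> K\<close> \<open>0 \<le> G\<close> in simp)
    also have "\<dots> \<le> (K + 1) * G" using \<open>0 \<le> G\<close> by (intro mult_right_mono) auto
    finally show ?thesis by (simp add: G_def)
  qed
  then show "bounded_Hinf_calculus \<xi>s r s T"
    unfolding bounded_Hinf_calculus_def using \<open>0 \<le> K\<close> by (intro exI[of _ "K + 1"]) auto
qed

end
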